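(* Let $h,k$ be normal operators in a type III von Neumann algebra $\mathcal{M}$. Then $$k\in\overline{\mathcal{U}(h)}^{s}\iff\mathrm{sp}^{ec}(k)\subseteq\mathrm{sp}^{ec}(h),$$ where $\overline{\mathcal{U}(h)}^{s}$ is the strong closure of the unitary orbit of $h$ and $\mathrm{sp}^{ec}$ denotes the essential central spectrum.
   Context: $\mathcal{U}(h)=\{uhu^*\mid u\in\mathcal{M}\text{ unitary}\}$. The strong operator topology is representation-independent on bounded sets. For a properly infinite von Neumann algebra $\mathcal{M}$ with center $\mathcal{Z}(\mathcal{M})$, let $\mathcal{K}$ be the norm-closed two-sided ideal generated by the finite projections of $\mathcal{M}$ (so $\mathcal{K}=\{0\}$ when $\mathcal{M}$ is type III), and let $\Omega(\mathcal{Z}(\mathcal{M}))$ be the maximal ideal space of $\mathcal{Z}(\mathcal{M})$. For $\zeta\in\Omega(\mathcal{Z}(\mathcal{M}))$, $\zeta+\mathcal{K}$ denotes the sum of $\mathcal{K}$ and the norm-closed two-sided ideal of $\mathcal{M}$ generated by $\zeta$. The essential central spectrum $\mathrm{sp}^{ec}(h)$ of $h\in\mathcal{M}$ is the set of all $z\in\mathcal{Z}(\mathcal{M})$ such that, for every $\zeta\in\Omega(\mathcal{Z}(\mathcal{M}))$, the element $h-z+(\zeta+\mathcal{K})$ is not invertible in $\mathcal{M}/(\zeta+\mathcal{K})$. *)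

theory Defs
  imports "HOL-Analysis.Analysis" "HOL-Algebra.QuotRing"
begin

text \<open>
  The form \<open>cinner\<close> is linear in the first and conjugate-linear in the second argument. Basing the
  class on \<^class>\<open>real_inner\<close> is no restriction: the underlying real Hilbert space of a complex
  one carries the real inner product \<open>Re \<langle>x, y\<rangle>\<close>, which induces the same norm.
\<close>

class complex_hilbert_space = real_inner + complete_space +
  fixes scaleC :: "complex \<Rightarrow> 'a \<Rightarrow> 'a"
    and cinner :: "'a \<Rightarrow> 'a \<Rightarrow> complex"
  assumes scaleC_add_right: "scaleC c (x + y) = scaleC c x + scaleC c y"
    and scaleC_add_left: "scaleC (c + d) x = scaleC c x + scaleC d x"
    and scaleC_scaleC: "scaleC c (scaleC d x) = scaleC (c * d) x"
    and scaleC_of_real: "scaleC (complex_of_real r) x = scaleR r x"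
    and cinner_add_left: "cinner (x + y) z = cinner x z + cinner y z"
    and cinner_scaleC_left: "cinner (scaleC c x) y = c * cinner x y"
    and cinner_commute: "cinner y x = cnj (cinner x y)"
    and Re_cinner: "Re (cinner x y) = inner x y"

text \<open>
  The type of \<open>\<real>\<close>-linear bounded operators carries the operator norm, composition and
  \<^const>\<open>strong_operator_topology\<close>; \<open>B(H)\<close> is its subset of \<open>\<complex>\<close>-linear operators.
\<close>

type_synonym 'a operator = "'a \<Rightarrow>\<^sub>L 'a"

definition bounded_operators :: "'a::complex_hilbert_space operator set" where
  "bounded_operators = {T :: 'a operator. \<forall>c x. T (scaleC c x) = scaleC c (T x)}"

definition adj :: "'a::complex_hilbert_space operator \<Rightarrow> 'a operator" where
  "adj T = (THE S. S \<in> bounded_operators \<and> (\<forall>x y. cinner (T x) y = cinner x (S y)))"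

text \<open>The Riesz representation theorem shows that the definite description above is proper (\<open>adjoint_exists\<close>).\<close>

lemma riesz_representation:
  fixes f :: "'a::{real_inner, complete_space} \<Rightarrow> real"
  assumes "bounded_linear f"
  shows "\<exists>z. \<forall>x. f x = inner x z"
proof -
  interpret f: bounded_linear f by fact
  define J where "J = (\<lambda>x. inner x x - 2 * f x)"
  obtain C where C: "\<And>x. norm (f x) \<le> norm x * C"
    using f.bounded by blast
  have J_ge: "- (C\<^sup>2) \<le> J x" for x
  proof -
    have "f x \<le> norm x * C"
      using C[of x] by simp
    moreover have "0 \<le> (norm x - C)\<^sup>2" by simp
    ultimately show ?thesis
      unfolding J_def power2_norm_eq_inner[symmetric] by (simp add: power2_diff)
  qed
  define d where "d = (INF x. J x)"
  have bdd: "bdd_below (range J)"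
    using J_ge by (intro bdd_belowI[of _ "- (C\<^sup>2)"]) auto
  have d_le: "d \<le> J x" for x
    unfolding d_def using bdd by (rule cINF_lower) simp
  have para: "(norm (x - y))\<^sup>2 \<le> 2 * ((J x - d) + (J y - d))" for x y
  proof -
    have "J x + J y - 2 * J ((1/2) *\<^sub>R (x + y)) = (1/2) * (norm (x - y))\<^sup>2"
      unfolding J_def power2_norm_eq_inner
      by (simp add: f.add f.scaleR inner_add_left inner_add_right inner_diff_left inner_diff_right
          inner_commute algebra_simps)
    with d_le[of "(1/2) *\<^sub>R (x + y)"] show ?thesis by simp
  qed
  have "\<exists>x. J x < d + 1 / Suc n" for n
  proof -
    have "\<exists>y \<in> range J. y < d + 1 / Suc n"
      using cInf_less_iff[OF _ bdd, of "d + 1 / Suc n"] unfolding d_def by fastforce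
    then show ?thesis by blast
  qed
  then obtain X where X: "\<And>n. J (X n) < d + 1 / Suc n" by metis
  have "Cauchy X"
  proof (rule metric_CauchyI)
    fix e :: real assume "0 < e"
    then obtain N where N: "1 / real (Suc N) < e\<^sup>2 / 4"
      using nat_approx_posE[of "e\<^sup>2 / 4"] by auto
    have J_less: "J (X m) < d + e\<^sup>2 / 4" if "m \<ge> N" for m
    proof -
      have "1 / real (Suc m) \<le> 1 / real (Suc N)"
        using that by (intro frac_le) auto
      with N have "1 / real (Suc m) < e\<^sup>2 / 4" by (rule le_less_trans[rotated])
      with X[of m] show ?thesis by linarith
    qed
    have "dist (X m) (X n) < e" if "m \<ge> N" "n \<ge> N" for m n
    proof -
      have "(norm (X m - X n))\<^sup>2 < e\<^sup>2"
        using para[of "X m" "X n"] J_less[OF that(1)] J_less[OF that(2)] by argo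
      then show ?thesis
        using \<open>0 < e\<close> by (simp add: dist_norm power2_less_imp_less)
    qed
    then show "\<exists>M. \<forall>m\<ge>M. \<forall>n\<ge>M. dist (X m) (X n) < e" by blast
  qed
  then obtain z where z: "X \<longlonglongrightarrow> z"
    using Cauchy_convergent convergent_def by blast
  have "(\<lambda>n. J (X n)) \<longlonglongrightarrow> J z"
    unfolding J_def by (intro tendsto_intros z f.tendsto)
  moreover have "(\<lambda>n. d + 1 / Suc n) \<longlonglongrightarrow> d + 0"
    by (intro tendsto_intros LIMSEQ_Suc[OF lim_1_over_n])
  ultimately have "J z \<le> d"
    using X by (intro LIMSEQ_le[of "\<lambda>n. J (X n)" "J z" "\<lambda>n. d + 1 / Suc n" d]) (auto intro: less_imp_le)
  then have min: "J z \<le> J x" for x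
    using d_le[of x] by simp
  have "f x = inner x z" for x
  proof (rule ccontr)
    define a where "a = inner x z - f x"
    assume "f x \<noteq> inner x z"
    then have "a \<noteq> 0" by (simp add: a_def)
    then have "x \<noteq> 0" by (auto simp: a_def f.zero)
    define q where "q = inner x x"
    have q: "q > 0"
      using \<open>x \<noteq> 0\<close> by (simp add: q_def)
    have J_line: "J (z + t *\<^sub>R x) = J z + 2 * t * a + t\<^sup>2 * q" for t
      unfolding J_def a_def q_def
      by (simp add: f.add f.scaleR inner_add_left inner_add_right inner_commute algebra_simps power2_eq_square)
    have "0 \<le> 2 * (- a / q) * a + (- a / q)\<^sup>2 * q"
      using min[of "z + (- a / q) *\<^sub>R x"] unfolding J_line by linarith
    also have "\<dots> = - (a\<^sup>2 / q)"
      using q by (simp add: power2_eq_square field_simps)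
    finally have "a\<^sup>2 / q \<le> 0" by simp
    moreover have "0 < a\<^sup>2 / q"
      using q \<open>a \<noteq> 0\<close> by simp
    ultimately show False by simp
  qed
  then show ?thesis by blast
qed

lemma inner_eq_all_imp_eq:
  fixes x y :: "'a::complex_hilbert_space"
  assumes "\<And>u. inner u x = inner u y"
  shows "x = y"
proof -
  have "inner (x - y) (x - y) = 0"
    using assms[of "x - y"] unfolding inner_diff_right by simp
  then show ?thesis by simp
qed

lemma Im_cinner:
  fixes x y :: "'a::complex_hilbert_space"
  shows "Im (cinner x y) = - inner (scaleC \<i> x) y"
  unfolding Re_cinner[symmetric] cinner_scaleC_left by simp

lemma cinner_scaleC_right:
  fixes x y :: "'a::complex_hilbert_space"
  shows "cinner x (scaleC c y) = cnj c * cinner x y"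
  by (subst (1 2) cinner_commute) (simp add: cinner_scaleC_left)

lemma adjoint_exists:
  fixes T :: "'a::complex_hilbert_space operator"
  assumes T: "T \<in> bounded_operators"
  shows "\<exists>!S. S \<in> bounded_operators \<and> (\<forall>x y. cinner (T x) y = cinner x (S y))"
proof (rule ex_ex1I)
  have "\<exists>z. \<forall>x. inner (T x) y = inner x z" for y
    by (rule riesz_representation)
      (rule bounded_linear_compose[OF bounded_linear_inner_left blinfun.bounded_linear_right])
  then obtain s where s: "\<And>x y. inner (T x) y = inner x (s y)" by metis
  have T': "T (scaleC c x) = scaleC c (T x)" for c x
    using T unfolding bounded_operators_def by blast
  have s': "cinner (T x) y = cinner x (s y)" for x y
    unfolding complex_eq_iff Re_cinner Im_cinner T'[symmetric] s by simp
  have lin: "bounded_linear s"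
  proof (rule bounded_linear_intro[where K = "norm T"])
    show "s (x + y) = s x + s y" for x y
      by (rule inner_eq_all_imp_eq) (simp only: inner_add_right s[symmetric])
    show "s (r *\<^sub>R x) = r *\<^sub>R s x" for r x
      by (rule inner_eq_all_imp_eq) (simp only: inner_scaleR_right s[symmetric])
    show "norm (s y) \<le> norm y * norm T" for y
    proof (cases "s y = 0")
      case False
      have "norm (s y) * norm (s y) = inner (T (s y)) y"
        unfolding s dot_square_norm power2_eq_square by (rule refl)
      also have "inner (T (s y)) y \<le> norm (T (s y)) * norm y"
        by (rule norm_cauchy_schwarz)
      also have "norm (T (s y)) * norm y \<le> (norm T * norm (s y)) * norm y"
        by (rule mult_right_mono[OF norm_blinfun norm_ge_zero])
      also have "(norm T * norm (s y)) * norm y = (norm y * norm T) * norm (s y)"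
        by (simp only: ac_simps)
      finally have "norm (s y) * norm (s y) \<le> (norm y * norm T) * norm (s y)" .
      moreover have "0 < norm (s y)" using False by (simp only: zero_less_norm_iff simp_thms)
      ultimately show ?thesis by (rule mult_right_le_imp_le)
    qed simp
  qed
  have "s (scaleC c y) = scaleC c (s y)" for c y
    by (rule inner_eq_all_imp_eq) (unfold Re_cinner[symmetric] cinner_scaleC_right s'[symmetric], rule refl)
  then have "Blinfun s \<in> bounded_operators"
    by (simp add: bounded_operators_def bounded_linear_Blinfun_apply lin)
  moreover have "\<forall>x y. cinner (T x) y = cinner x (Blinfun s y)"
    unfolding bounded_linear_Blinfun_apply[OF lin] using s' by blast
  ultimately show "\<exists>S. S \<in> bounded_operators \<and> (\<forall>x y. cinner (T x) y = cinner x (blinfun_apply S y))"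
    by blast
next
  fix S S' :: "'a operator"
  assume S: "S \<in> bounded_operators \<and> (\<forall>x y. cinner (T x) y = cinner x (S y))"
    and S': "S' \<in> bounded_operators \<and> (\<forall>x y. cinner (T x) y = cinner x (S' y))"
  have "cinner x (S y) = cinner x (S' y)" for x y
    using S[THEN conjunct2, rule_format, of x y] S'[THEN conjunct2, rule_format, of x y] by simp
  then show "S = S'"
    by (intro blinfun_eqI inner_eq_all_imp_eq) (simp flip: Re_cinner)
qed

definition normal_operator :: "'a::complex_hilbert_space operator \<Rightarrow> bool" where
  "normal_operator T \<longleftrightarrow> T \<in> bounded_operators \<and> adj T o\<^sub>L T = T o\<^sub>L adj T"

definition commutant :: "'a::complex_hilbert_space operator set \<Rightarrow> 'a operator set" where
  "commutant A = {T \<in> bounded_operators. \<forall>S\<in>A. T o\<^sub>L S = S o\<^sub>L T}"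

definition von_neumann_algebra :: "'a::complex_hilbert_space operator set \<Rightarrow> bool" where
  "von_neumann_algebra M \<longleftrightarrow>
     M \<subseteq> bounded_operators \<and> (\<forall>T\<in>M. adj T \<in> M) \<and> commutant (commutant M) = M"

definition center :: "'a::complex_hilbert_space operator set \<Rightarrow> 'a operator set" where
  "center M = M \<inter> commutant M"

definition unitaries :: "'a::complex_hilbert_space operator set \<Rightarrow> 'a operator set" where
  "unitaries M = {u \<in> M. adj u o\<^sub>L u = id_blinfun \<and> u o\<^sub>L adj u = id_blinfun}"

definition unitary_orbit ::
    "'a::complex_hilbert_space operator set \<Rightarrow> 'a operator \<Rightarrow> 'a operator set" where
  "unitary_orbit M h = {u o\<^sub>L h o\<^sub>L adj u |u. u \<in> unitaries M}"

definition projections :: "'a::complex_hilbert_space operator set \<Rightarrow> 'a operator set" where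
  "projections M = {p \<in> M. adj p = p \<and> p o\<^sub>L p = p}"

definition mvn_equivalent ::
    "'a::complex_hilbert_space operator set \<Rightarrow> 'a operator \<Rightarrow> 'a operator \<Rightarrow> bool" where
  "mvn_equivalent M p q \<longleftrightarrow> (\<exists>v\<in>M. adj v o\<^sub>L v = p \<and> v o\<^sub>L adj v = q)"

text \<open>For projections, \<open>q \<le> p\<close> is expressed as \<open>p q = q\<close>.\<close>

definition finite_projection ::
    "'a::complex_hilbert_space operator set \<Rightarrow> 'a operator \<Rightarrow> bool" where
  "finite_projection M p \<longleftrightarrow> p \<in> projections M \<and>
     (\<forall>q\<in>projections M. p o\<^sub>L q = q \<and> mvn_equivalent M p q \<longrightarrow> q = p)"

definition type_III :: "'a::complex_hilbert_space operator set \<Rightarrow> bool" where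
  "type_III M \<longleftrightarrow> (\<forall>p. finite_projection M p \<longrightarrow> p = 0)"

text \<open>
  Ideals, cosets and quotients are those of \<open>HOL-Algebra\<close>, applied to the following ring. Since
  \<open>M\<close> and its center contain the scalar operators, their ring ideals are linear subspaces.
\<close>

definition operator_ring :: "'a::complex_hilbert_space operator set \<Rightarrow> 'a operator ring" where
  "operator_ring A = \<lparr>carrier = A, mult = (o\<^sub>L), one = id_blinfun, zero = 0, add = (+)\<rparr>"

lemma ring_operator_ring_commutant:
  fixes A :: "'a::complex_hilbert_space operator set"
  shows "ring (operator_ring (commutant A))"
proof -
  have scaleC_zero: "scaleC c 0 = (0 :: 'a)" for c
    using scaleC_add_right[of c 0 "0 :: 'a"] by simp
  have scaleC_minus: "scaleC c (- x) = - scaleC c x" for c and x :: 'a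
    using scaleC_add_right[of c x "- x"] by (simp add: scaleC_zero eq_neg_iff_add_eq_0 add.commute)
  have commutant_iff: "T \<in> commutant A \<longleftrightarrow>
      (\<forall>c x. T (scaleC c x) = scaleC c (T x)) \<and> (\<forall>S\<in>A. \<forall>x. T (S x) = S (T x))" for T
    unfolding commutant_def bounded_operators_def
    by (auto intro!: blinfun_eqI dest: arg_cong[where f = blinfun_apply] fun_cong)
      (metis blinfun_apply_blinfun_compose)
  have zero: "0 \<in> commutant A" and one: "id_blinfun \<in> commutant A"
    unfolding commutant_iff by (simp_all add: blinfun.bilinear_simps scaleC_zero)
  have add: "S + T \<in> commutant A" and mult: "S o\<^sub>L T \<in> commutant A"
    if "S \<in> commutant A" "T \<in> commutant A" for S T
    using that unfolding commutant_iff blinfun.add_left blinfun_apply_blinfun_compose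
      blinfun.add_right scaleC_add_right by metis+
  have minus: "\<exists>S\<in>commutant A. S + T = 0" if "T \<in> commutant A" for T
  proof
    show "- T \<in> commutant A"
      using that unfolding commutant_iff blinfun.minus_left blinfun.minus_right scaleC_minus by metis
  qed simp
  show ?thesis
  proof (intro ringI abelian_groupI monoidI)
    fix R S T :: "'a operator"
    show "(R \<otimes>\<^bsub>operator_ring (commutant A)\<^esub> S) \<otimes>\<^bsub>operator_ring (commutant A)\<^esub> T =
        R \<otimes>\<^bsub>operator_ring (commutant A)\<^esub> (S \<otimes>\<^bsub>operator_ring (commutant A)\<^esub> T)"
      by (simp add: operator_ring_def blinfun_eqI)
  qed (use zero one add mult minus in \<open>simp_all add: operator_ring_def blinfun_eqI
      blinfun.add_left blinfun.add_right add.assoc add.commute\<close>)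
qed

lemma ring_operator_ring:
  assumes "von_neumann_algebra M"
  shows "ring (operator_ring M)" and "ring (operator_ring (center M))"
proof -
  have M: "M = commutant (commutant M)"
    using assms by (simp add: von_neumann_algebra_def)
  show "ring (operator_ring M)"
    by (subst M) (rule ring_operator_ring_commutant)
  have "commutant (A \<union> B) = commutant A \<inter> commutant B" for A B :: "'a operator set"
    by (auto simp: commutant_def)
  then have "center M = commutant (commutant M \<union> M)"
    using M by (simp add: center_def)
  then show "ring (operator_ring (center M))"
    by (simp add: ring_operator_ring_commutant)
qed

definition closed_ideal_generated ::
    "'a::complex_hilbert_space operator set \<Rightarrow> 'a operator set \<Rightarrow> 'a operator set" where
  "closed_ideal_generated M S = \<Inter>{I. ideal I (operator_ring M) \<and> closed I \<and> S \<subseteq> I}"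

definition finite_ideal :: "'a::complex_hilbert_space operator set \<Rightarrow> 'a operator set" where
  "finite_ideal M = closed_ideal_generated M {p. finite_projection M p}"

definition maximal_ideal_space ::
    "'a::complex_hilbert_space operator set \<Rightarrow> 'a operator set set" where
  "maximal_ideal_space Z = {\<zeta>. maximalideal \<zeta> (operator_ring Z)}"

definition essential_ideal ::
    "'a::complex_hilbert_space operator set \<Rightarrow> 'a operator set \<Rightarrow> 'a operator set" where
  "essential_ideal M \<zeta> = closed_ideal_generated M \<zeta> <+>\<^bsub>operator_ring M\<^esub> finite_ideal M"

definition essential_central_spectrum ::
    "'a::complex_hilbert_space operator set \<Rightarrow> 'a operator \<Rightarrow> 'a operator set" where
  "essential_central_spectrum M h =
     {z \<in> center M. \<forall>\<zeta>\<in>maximal_ideal_space (center M).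
        essential_ideal M \<zeta> +>\<^bsub>operator_ring M\<^esub> (h - z)
          \<notin> Units (operator_ring M Quot essential_ideal M \<zeta>)}"

end

theory Submission
  imports Defs
begin

text \<open>
  For normal \<open>h\<close>, a central \<open>z\<close> lies in the essential central spectrum of \<open>h\<close> iff \<open>h - z\<close> is not bounded
  below on \<open>f H\<close> for any central projection \<open>f \<noteq> 0\<close>. A lower bound for \<open>h - z\<close> on \<open>f H\<close> holds for all
  \<open>u h u\<^sup>* - z\<close> and survives strong limits, which gives one implication.

  For the other one, cut \<open>h\<close> and \<open>k\<close> into finitely many spectral pieces. Successive approximation produces,
  near each approximate eigenvalue of \<open>k\<close>, a point of the essential central spectrum of \<open>k\<close>, hence of \<open>h\<close>;
  after a further cut by central projections, \<open>h\<close> and \<open>k\<close> are close to \<open>\<Sum> \<mu>\<^sub>l p\<^sub>l\<close> and \<open>\<Sum> \<mu>\<^sub>l Q\<^sub>l\<close> with \<open>Q\<^sub>l\<close>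
  below the central support of \<open>p\<^sub>l\<close>. Strong neighbourhoods only see finitely many vectors, so only
  countably generated subprojections of the \<open>Q\<^sub>l\<close> have to be moved under the \<open>p\<^sub>l\<close>, which type III permits.
  No comparison of projections that are not \<open>\<sigma>\<close>-finite is needed.
\<close>

text \<open>The inclusion of spectra speaks of central operators only. An approximate eigenvalue
  \<open>\<mu>\<close> of \<open>k\<close> belongs to one spectral piece and says nothing outside
  the central support of that piece, so it need not lie in the spectrum. It is corrected to a
  central operator that is close to \<open>\<mu>\<close> on the piece and completed elsewhere to an
  actual member of the spectrum.

  The second obstacle is size: in a type III algebra equal central supports need not make two
  projections equivalent when they are not countably generated. The spectral pieces of
  \<open>h\<close> and \<open>k\<close> can thus not be matched exactly, but each piece of
  \<open>k\<close> can be matched on any finite set of vectors, and this is all that the strong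
  topology asks for.

  No functional calculus is set up. Projections and partial isometries arise as strong limits of
  polynomials in the given operators, as norm-convergent series, or as projections onto joint
  kernels. Such objects inherit the commutation relations of the data, and this is how they are
  known to lie in \<open>M\<close> or in its center.\<close>

instance complex_hilbert_space \<subseteq> banach ..

section \<open>Bounded operators on a real Hilbert space\<close>

text \<open>Defined for every bounded real-linear operator, so that products, limits and series can
  be treated before complex linearity is at hand; \<open>adj_eq_radj\<close> identifies it with
  \<open>adj\<close> on complex-linear operators.\<close>

definition radj :: "('a::{real_inner,banach} \<Rightarrow>\<^sub>L 'a) \<Rightarrow> 'a \<Rightarrow>\<^sub>L 'a" where
  "radj T = (SOME S :: 'a \<Rightarrow>\<^sub>L 'a. \<forall>x y. inner (T x) y = inner x (S y))"

lemma inner_eqI: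
  fixes x y :: "'a::real_inner"
  assumes "\<And>u. inner u x = inner u y"
  shows "x = y"
proof -
  have "inner (x - y) (x - y) = 0"
    using assms[of "x - y"] unfolding inner_diff_right by simp
  then show ?thesis by simp
qed

lemma radj_exists:
  fixes T :: "'a::{real_inner,banach} \<Rightarrow>\<^sub>L 'a"
  shows "\<exists>S :: 'a \<Rightarrow>\<^sub>L 'a. \<forall>x y. inner (T x) y = inner x (S y)"
proof -
  have "\<exists>z. \<forall>x. inner (T x) y = inner x z" for y
    by (rule riesz_representation)
      (rule bounded_linear_compose[OF bounded_linear_inner_left blinfun.bounded_linear_right])
  then obtain s where s: "\<And>x y. inner (T x) y = inner x (s y)" by metis
  have lin: "bounded_linear s"
  proof (rule bounded_linear_intro[where K = "norm T"])
    show "s (x + y) = s x + s y" for x y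
      by (rule inner_eqI) (simp only: inner_add_right s[symmetric])
    show "s (r *\<^sub>R x) = r *\<^sub>R s x" for r x
      by (rule inner_eqI) (simp only: inner_scaleR_right s[symmetric])
    show "norm (s y) \<le> norm y * norm T" for y
    proof (cases "s y = 0")
      case False
      have "norm (s y) * norm (s y) = inner (T (s y)) y"
        unfolding s dot_square_norm power2_eq_square by (rule refl)
      also have "\<dots> \<le> norm (T (s y)) * norm y"
        by (rule norm_cauchy_schwarz)
      also have "\<dots> \<le> (norm T * norm (s y)) * norm y"
        by (rule mult_right_mono[OF norm_blinfun norm_ge_zero])
      also have "\<dots> = (norm y * norm T) * norm (s y)"
        by (simp only: ac_simps)
      finally have "norm (s y) * norm (s y) \<le> (norm y * norm T) * norm (s y)" .
      moreover have "0 < norm (s y)" using False by simp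
      ultimately show ?thesis by (rule mult_right_le_imp_le)
    qed simp
  qed
  then show ?thesis
    by (intro exI[of _ "Blinfun s"]) (simp add: bounded_linear_Blinfun_apply s)
qed

lemma inner_radj: "inner (T x) y = inner x (radj T y)" for T :: "'a::{real_inner,banach} operator"
  using someI_ex[OF radj_exists[of T]] unfolding radj_def by blast

lemma inner_radj': "inner (radj T x) y = inner x (T y)" for T :: "'a::{real_inner,banach} operator"
  by (metis inner_commute inner_radj)

lemma radj_eqI:
  fixes S T :: "'a::{real_inner,banach} operator"
  assumes "\<And>x y. inner (T x) y = inner x (S y)"
  shows "radj T = S"
proof (rule blinfun_eqI, rule inner_eqI)
  show "inner u (radj T x) = inner u (S x)" for u x
    using assms[of u x] inner_radj[of T u x] by simp
qed

lemma radj_radj [simp]: "radj (radj T) = T"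
  by (rule radj_eqI) (rule inner_radj')

lemma radj_compose [simp]: "radj (S o\<^sub>L T) = radj T o\<^sub>L radj S"
  by (rule radj_eqI) (simp add: inner_radj)

lemma radj_add [simp]: "radj (S + T) = radj S + radj T"
  by (rule radj_eqI) (simp add: blinfun.bilinear_simps inner_left_distrib inner_right_distrib inner_radj)

lemma radj_diff [simp]: "radj (S - T) = radj S - radj T"
  by (rule radj_eqI) (simp add: blinfun.bilinear_simps inner_diff_left inner_diff_right inner_radj)

lemma radj_scaleR [simp]: "radj (r *\<^sub>R T) = r *\<^sub>R radj T"
  by (rule radj_eqI) (simp add: blinfun.bilinear_simps inner_radj)

lemma radj_id [simp]: "radj id_blinfun = id_blinfun"
  by (rule radj_eqI) simp

lemma radj_sum [simp]: "radj (\<Sum>i\<in>I. T i) = (\<Sum>i\<in>I. radj (T i))"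
  by (rule radj_eqI) (simp add: blinfun.bilinear_simps inner_sum_left inner_sum_right inner_radj)

lemma norm_radj_apply_square: "(norm (T x))\<^sup>2 = inner (radj T (T x)) x" for T :: "'a::{real_inner,banach} operator"
  by (simp add: power2_norm_eq_inner inner_radj')

lemma norm_blinfun_le: "norm (T x) \<le> K * norm x" if "norm T \<le> K" for T :: "'a::real_normed_vector \<Rightarrow>\<^sub>L 'b::real_normed_vector"
  by (meson mult_right_mono norm_blinfun norm_ge_zero order_trans that)

section \<open>Self-adjoint operators and orthogonal projections\<close>

definition selfadj :: "('a::{real_inner,banach} \<Rightarrow>\<^sub>L 'a) \<Rightarrow> bool" where
  "selfadj T \<longleftrightarrow> (\<forall>x y. inner (T x) y = inner x (T y))"

definition pos_op :: "('a::{real_inner,banach} \<Rightarrow>\<^sub>L 'a) \<Rightarrow> bool" where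
  "pos_op T \<longleftrightarrow> selfadj T \<and> (\<forall>x. 0 \<le> inner (T x) x)"

definition orth_proj :: "('a::{real_inner,banach} \<Rightarrow>\<^sub>L 'a) \<Rightarrow> bool" where
  "orth_proj p \<longleftrightarrow> selfadj p \<and> (\<forall>x. p (p x) = p x)"

definition commutes :: "('a::{real_inner,banach} \<Rightarrow>\<^sub>L 'a) \<Rightarrow> ('a \<Rightarrow>\<^sub>L 'a) \<Rightarrow> bool" where
  "commutes S T \<longleftrightarrow> (\<forall>x. S (T x) = T (S x))"

lemma blinfun_eq_iff: "S = T \<longleftrightarrow> (\<forall>x. blinfun_apply S x = T x)"
  by (auto intro: blinfun_eqI)

lemma commutesD: "commutes S T \<Longrightarrow> S (T x) = T (S x)"
  by (simp add: commutes_def)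

lemma commutes_iff: "commutes S T \<longleftrightarrow> S o\<^sub>L T = T o\<^sub>L S"
  unfolding commutes_def blinfun_eq_iff by simp

lemma commutes_sym: "commutes S T \<Longrightarrow> commutes T S"
  by (simp add: commutes_def)

lemma commutes_radj: "commutes S T \<Longrightarrow> commutes (radj S) (radj T)"
  unfolding commutes_iff by (metis radj_compose)

lemma selfadj_iff: "selfadj T \<longleftrightarrow> radj T = T"
  unfolding selfadj_def by (metis inner_radj radj_eqI)

lemma orth_proj_iff: "orth_proj p \<longleftrightarrow> radj p = p \<and> p o\<^sub>L p = p"
  unfolding orth_proj_def selfadj_iff blinfun_eq_iff by simp

lemma orth_projD:
  assumes "orth_proj p"
  shows "p (p x) = p x" and "inner (p x) y = inner x (p y)" and "radj p = p"
  using assms unfolding orth_proj_def selfadj_iff[symmetric] by (auto simp: selfadj_def)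

lemma orth_proj_inner: "orth_proj p \<Longrightarrow> inner (p x) x = (norm (p x))\<^sup>2"
  by (metis orth_projD(1,2) power2_norm_eq_inner)

lemma orth_proj_zero [simp]: "orth_proj 0" and orth_proj_id [simp]: "orth_proj id_blinfun"
  by (auto simp: orth_proj_def selfadj_def)

lemma orth_proj_compl: "orth_proj p \<Longrightarrow> orth_proj (id_blinfun - p)"
  by (auto simp: orth_proj_def selfadj_def blinfun.bilinear_simps inner_diff_left inner_diff_right)

lemma orth_proj_pythagoras:
  assumes "orth_proj p"
  shows "(norm x)\<^sup>2 = (norm (p x))\<^sup>2 + (norm (x - p x))\<^sup>2"
proof -
  have "inner (p x) (x - p x) = 0"
    using orth_projD[OF assms] by (metis inner_diff_right right_minus_eq)
  then have "orthogonal (p x) (x - p x)" by (simp add: orthogonal_def)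
  from norm_add_Pythagorean[OF this] show ?thesis by simp
qed

lemma orth_proj_norm_le: "orth_proj p \<Longrightarrow> norm (p x) \<le> norm x"
  using orth_proj_pythagoras[of p x] by (metis abs_norm_cancel le_add_same_cancel1 norm_ge_zero power2_le_iff_abs_le zero_le_power2)

lemma orth_proj_norm_eq: "orth_proj p \<Longrightarrow> norm (p x) = norm x \<Longrightarrow> p x = x"
  using orth_proj_pythagoras[of p x] by simp

text \<open>Taking adjoints turns \<open>p q = q\<close> into \<open>q p = q\<close>, so either
  product may serve as the order of projections.\<close>

lemma orth_proj_le_sym:
  assumes "orth_proj p" "orth_proj q"
  shows "(\<forall>x. p (q x) = q x) \<longleftrightarrow> (\<forall>x. q (p x) = q x)"
proof -
  have "p o\<^sub>L q = q \<longleftrightarrow> q o\<^sub>L p = q"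
    by (metis assms orth_projD(3) radj_compose)
  then show ?thesis
    by (metis blinfun_apply_blinfun_compose blinfun_eqI)
qed

lemma orth_proj_comp: "orth_proj p \<Longrightarrow> orth_proj q \<Longrightarrow> commutes p q \<Longrightarrow> orth_proj (p o\<^sub>L q)"
  by (auto simp: orth_proj_def selfadj_def commutes_def)

lemma selfadj_zero_form:
  assumes T: "selfadj T" and z: "\<And>x. inner (T x) x = 0"
  shows "T = 0"
proof (rule blinfun_eqI)
  fix x
  \<comment> \<open>Polarisation of the form at \<open>x\<close> and \<open>T x\<close>.
    Self-adjointness makes the two cross terms agree; on a real space a quarter turn has zero form
    without being zero.\<close>
  have "inner (T (x + T x)) (x + T x) = 2 * inner (T x) (T x)"
    using T z by (simp add: blinfun.bilinear_simps inner_add_left inner_add_right selfadj_def)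
  then have "inner (T x) (T x) = 0" using z by simp
  then show "T x = blinfun_apply 0 x" by simp
qed

text \<open>The parallelogram law makes a minimising sequence for the distance Cauchy, and
  \<open>y\<close> is its limit. Orthogonality follows because no multiple of \<open>m\<close> can
  bring \<open>y\<close> closer to \<open>x\<close>.\<close>

lemma nearest_point:
  fixes x :: "'a::{real_inner,banach}"
  assumes L: "subspace L" "closed L"
  shows "\<exists>y\<in>L. \<forall>l\<in>L. inner (x - y) l = 0"
proof -
  define d where "d = (INF l\<in>L. (norm (x - l))\<^sup>2)"
  have ne: "L \<noteq> {}" using L(1) subspace_0 by blast
  have bdd: "bdd_below ((\<lambda>l. (norm (x - l))\<^sup>2) ` L)" by (intro bdd_belowI[of _ 0]) auto
  have d_le: "d \<le> (norm (x - l))\<^sup>2" if "l \<in> L" for l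
    unfolding d_def using bdd that by (rule cINF_lower)
  have para: "(norm (l - m))\<^sup>2 \<le> 2 * (((norm (x - l))\<^sup>2 - d) + ((norm (x - m))\<^sup>2 - d))" if "l \<in> L" "m \<in> L" for l m
  proof -
    have "(1/2) *\<^sub>R (l + m) \<in> L" using that L(1) by (simp add: subspace_add subspace_mul)
    moreover have "(norm (x - l))\<^sup>2 + (norm (x - m))\<^sup>2 - 2 * (norm (x - (1/2) *\<^sub>R (l + m)))\<^sup>2 = (1/2) * (norm (l - m))\<^sup>2"
      unfolding power2_norm_eq_inner
      by (simp add: inner_add_left inner_add_right inner_diff_left inner_diff_right inner_commute algebra_simps)
    ultimately show ?thesis using d_le[of "(1/2) *\<^sub>R (l + m)"] by simp
  qed
  have "\<exists>l\<in>L. (norm (x - l))\<^sup>2 < d + 1 / Suc n" for n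
  proof -
    have "\<exists>y\<in>(\<lambda>l. (norm (x - l))\<^sup>2) ` L. y < d + 1 / Suc n"
      using cInf_less_iff[OF _ bdd, of "d + 1 / Suc n"] ne unfolding d_def by fastforce
    then show ?thesis by blast
  qed
  then obtain l where l: "\<And>n. l n \<in> L" "\<And>n. (norm (x - l n))\<^sup>2 < d + 1 / Suc n" by metis
  have "Cauchy l"
  proof (rule metric_CauchyI)
    fix e :: real assume "0 < e"
    then obtain N where N: "1 / real (Suc N) < e\<^sup>2 / 4"
      using nat_approx_posE[of "e\<^sup>2 / 4"] by auto
    have less: "(norm (x - l m))\<^sup>2 < d + e\<^sup>2 / 4" if "m \<ge> N" for m
    proof -
      have "1 / real (Suc m) \<le> 1 / real (Suc N)"
        using that by (intro frac_le) auto
      with N l(2)[of m] show ?thesis by linarith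
    qed
    have "dist (l m) (l n) < e" if "m \<ge> N" "n \<ge> N" for m n
    proof -
      have "(norm (l m - l n))\<^sup>2 < e\<^sup>2"
        using para[OF l(1) l(1), of m n] less[OF that(1)] less[OF that(2)] by argo
      then show ?thesis
        using \<open>0 < e\<close> by (simp add: dist_norm power2_less_imp_less)
    qed
    then show "\<exists>M. \<forall>m\<ge>M. \<forall>n\<ge>M. dist (l m) (l n) < e" by blast
  qed
  then obtain y where y: "l \<longlonglongrightarrow> y"
    using Cauchy_convergent convergent_def by blast
  then have yL: "y \<in> L" using L(2) l(1) closed_sequentially by blast
  have "(\<lambda>n. (norm (x - l n))\<^sup>2) \<longlonglongrightarrow> (norm (x - y))\<^sup>2" by (intro tendsto_intros y)
  moreover have "(\<lambda>n. d + 1 / Suc n) \<longlonglongrightarrow> d + 0"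
    by (intro tendsto_intros LIMSEQ_Suc[OF lim_1_over_n])
  ultimately have yd: "(norm (x - y))\<^sup>2 \<le> d"
    using l(2) by (intro LIMSEQ_le[of "\<lambda>n. (norm (x - l n))\<^sup>2" _ "\<lambda>n. d + 1 / Suc n" d]) (auto intro: less_imp_le)
  have "inner (x - y) m = 0" if m: "m \<in> L" for m
  proof (cases "m = 0")
    case False
    define a q where "a = inner (x - y) m" and "q = inner m m"
    have q: "q > 0" using False by (simp add: q_def)
    \<comment> \<open>\<open>a / q\<close> is the step that minimises the distance along
      \<open>m\<close>; it lowers the squared distance by \<open>a\<^sup>2 / q\<close>.\<close>
    have "y + (a / q) *\<^sub>R m \<in> L" using L(1) m yL by (simp add: subspace_add subspace_mul)
    from order_trans[OF yd d_le[OF this]] have "(norm (x - y))\<^sup>2 \<le> (norm ((x - y) - (a / q) *\<^sub>R m))\<^sup>2"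
      by (simp only: diff_diff_eq)
    also have "\<dots> = (norm (x - y))\<^sup>2 - 2 * (a / q) * a + (a / q)\<^sup>2 * q"
    proof -
      have "(norm (w - r *\<^sub>R m))\<^sup>2 = (norm w)\<^sup>2 - 2 * r * inner w m + r\<^sup>2 * inner m m" for w r
        unfolding power2_norm_eq_inner
        by (simp add: inner_diff_left inner_diff_right inner_commute algebra_simps power2_eq_square)
      then show ?thesis by (simp only: a_def q_def)
    qed
    also have "\<dots> = (norm (x - y))\<^sup>2 - a\<^sup>2 / q" using q by (simp add: power2_eq_square field_simps)
    finally have "a\<^sup>2 / q \<le> 0" by simp
    with q show ?thesis unfolding a_def[symmetric] by (simp add: divide_le_0_iff)
  qed simp
  with yL show ?thesis by blast
qed

lemma orth_proj_exists:
  fixes L :: "'a::{real_inner,banach} set"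
  assumes L: "subspace L" "closed L"
  shows "\<exists>p. orth_proj p \<and> range (blinfun_apply p) = L"
proof -
  obtain f where f: "\<And>x. f x \<in> L" "\<And>x l. l \<in> L \<Longrightarrow> inner (x - f x) l = 0"
    using nearest_point[OF L] by metis
  have uniq: "f x = y" if "y \<in> L" "\<And>l. l \<in> L \<Longrightarrow> inner (x - y) l = 0" for x y
  proof -
    have "f x - y \<in> L" using f(1) that(1) L(1) subspace_diff by blast
    then have "inner (x - y) (f x - y) = 0" "inner (x - f x) (f x - y) = 0" using f(2) that(2) by blast+
    then have "inner (f x - y) (f x - y) = 0" by (simp add: inner_diff_left)
    then show ?thesis by simp
  qed
  have pyth: "norm (f x) \<le> norm x" for x
  proof -
    have "inner (x - f x) (f x) = 0" using f by blast
    then have "orthogonal (x - f x) (f x)" by (simp add: orthogonal_def)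
    from norm_add_Pythagorean[OF this] have "(norm (f x))\<^sup>2 \<le> (norm x)\<^sup>2" by simp
    then show ?thesis by (rule power2_le_imp_le) simp
  qed
  have lin: "bounded_linear f"
  proof (rule bounded_linear_intro[where K = 1])
    show "f (x + y) = f x + f y" for x y
    proof (rule uniq)
      show "f x + f y \<in> L" using f(1) L(1) subspace_add by blast
      show "inner (x + y - (f x + f y)) l = 0" if "l \<in> L" for l
        using f(2)[OF that, of x] f(2)[OF that, of y] by (simp add: inner_diff_left inner_add_left)
    qed
    show "f (r *\<^sub>R x) = r *\<^sub>R f x" for r x
    proof (rule uniq)
      show "r *\<^sub>R f x \<in> L" using f(1) L(1) subspace_mul by blast
      show "inner (r *\<^sub>R x - r *\<^sub>R f x) l = 0" if "l \<in> L" for l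
        using f(2)[OF that, of x] by (simp add: inner_diff_left)
    qed
  qed (use pyth in simp)
  have fL: "f l = l" if "l \<in> L" for l using that by (intro uniq) auto
  have sym: "inner (f x) y = inner x (f y)" for x y
  proof -
    have "inner (x - f x) (f y) = 0" "inner (y - f y) (f x) = 0" using f by blast+
    then show ?thesis by (metis inner_commute inner_diff_left right_minus_eq)
  qed
  have "orth_proj (Blinfun f)"
    using sym fL f(1) by (simp add: orth_proj_def selfadj_def bounded_linear_Blinfun_apply[OF lin])
  moreover have "range (blinfun_apply (Blinfun f)) = L"
    using fL f(1) by (auto simp: bounded_linear_Blinfun_apply[OF lin] image_iff) metis
  ultimately show ?thesis by blast
qed

text \<open>This is \<open>T\<^sup>2 \<le> c T\<close> for \<open>0 \<le> T \<le> c\<close>.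
  Positivity of \<open>T\<close> is tested at \<open>x - T x / c\<close>, which avoids a square
  root; the lemma is the device below for turning bounds on forms into bounds on norms.\<close>

lemma pos_op_norm_le:
  assumes T: "pos_op T" and le: "\<And>y. inner (T y) y \<le> c * (norm y)\<^sup>2" and c: "c > 0"
  shows "(norm (T x))\<^sup>2 \<le> c * inner (T x) x"
proof -
  have "0 \<le> inner (T (x - (1/c) *\<^sub>R T x)) (x - (1/c) *\<^sub>R T x)"
    using T by (simp add: pos_op_def)
  also have "\<dots> = inner (T x) x - 2 * (1/c) * (norm (T x))\<^sup>2 + (1/c)\<^sup>2 * inner (T (T x)) (T x)"
  proof -
    have e: "inner (T (T x)) x = (norm (T x))\<^sup>2" "inner (T x) (T x) = (norm (T x))\<^sup>2"
      using T by (simp_all add: pos_op_def selfadj_def power2_norm_eq_inner)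
    have "inner (T (x - r *\<^sub>R T x)) (x - r *\<^sub>R T x)
        = inner (T x) x - r * inner (T x) (T x) - r * inner (T (T x)) x + r * r * inner (T (T x)) (T x)" for r
      by (simp add: blinfun.bilinear_simps inner_diff_left inner_diff_right algebra_simps)
    then show ?thesis unfolding e by (simp add: power2_eq_square)
  qed
  also have "\<dots> \<le> inner (T x) x - 2 * (1/c) * (norm (T x))\<^sup>2 + (1/c)\<^sup>2 * (c * (norm (T x))\<^sup>2)"
    using le[of "T x"] by (simp add: mult_left_mono)
  also have "\<dots> = inner (T x) x - (norm (T x))\<^sup>2 / c"
    using c by (simp add: power2_eq_square field_simps)
  finally show ?thesis using c by (simp add: field_simps)
qed

text \<open>Riesz: writing \<open>A\<close> (scaled to \<open>A \<le> 1\<close>) as the sum of the squares of \<open>A\<^sub>0 = A\<close>,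
  \<open>A\<^sub>n\<^sub>+\<^sub>1 = A\<^sub>n - A\<^sub>n\<^sup>2\<close> makes square roots unnecessary.\<close>

lemma pos_op_compose_contraction:
  assumes A: "pos_op A" and A1: "\<And>x. inner (A x) x \<le> (norm x)\<^sup>2"
    and B: "pos_op B" and AB: "commutes A B"
  shows "0 \<le> inner (B (A x)) x"
proof -
  define F where "F = rec_nat A (\<lambda>_ T. T - (T o\<^sub>L T))"
  have F0: "F 0 = A" and FS: "F (Suc n) = F n - (F n o\<^sub>L F n)" for n by (simp_all add: F_def)
  have F: "pos_op (F n) \<and> (\<forall>x. inner (F n x) x \<le> (norm x)\<^sup>2) \<and> commutes (F n) B" for n
  proof (induction n)
    case 0 then show ?case using A A1 AB by (simp add: F0)
  next
    case (Suc n)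
    then have sa: "selfadj (F n)" by (simp add: pos_op_def)
    have sq: "inner (F n (F n x)) x = (norm (F n x))\<^sup>2" for x
      using sa by (simp add: selfadj_def power2_norm_eq_inner)
    \<comment> \<open>\<open>F n \<le> 1\<close> gives \<open>F n\<^sup>2 \<le> F n\<close>, which
      keeps the next iterate positive.\<close>
    have "(norm (F n x))\<^sup>2 \<le> inner (F n x) x" for x
      using pos_op_norm_le[of "F n" 1 x] Suc by simp
    moreover have "selfadj (F (Suc n))"
      using sa by (simp add: FS selfadj_def blinfun.bilinear_simps inner_diff_left inner_diff_right)
    moreover have "inner (F (Suc n) x) x \<le> (norm x)\<^sup>2" for x
      using Suc by (smt (verit) sq FS blinfun.diff_left blinfun_apply_blinfun_compose inner_diff_left zero_le_power2)
    moreover have "commutes (F (Suc n)) B"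
      using Suc by (simp add: FS commutes_def blinfun.bilinear_simps)
    ultimately show ?case
      by (simp add: pos_op_def FS blinfun.bilinear_simps inner_diff_left sq)
  qed
  have sq: "inner (F n (F n x)) y = inner (F n x) (F n y)" for n x y
    using F[of n] by (simp add: pos_op_def selfadj_def)
  have sum: "A x = (\<Sum>k<n. F k (F k x)) + F n x" for n x
  proof (induction n)
    case (Suc n)
    have "F n x = F n (F n x) + F (Suc n) x"
      by (simp add: FS blinfun.bilinear_simps)
    with Suc show ?case by (simp add: add.assoc)
  qed (simp add: F0)
  have "(\<Sum>k<n. (norm (F k x))\<^sup>2) \<le> inner (A x) x" for n
  proof -
    have "inner (A x) x = (\<Sum>k<n. (norm (F k x))\<^sup>2) + inner (F n x) x"
      by (subst sum[of x n]) (simp add: inner_add_left inner_sum_left sq power2_norm_eq_inner)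
    then show ?thesis using F[of n] by (simp add: pos_op_def)
  qed
  then have "summable (\<lambda>k. (norm (F k x))\<^sup>2)"
    by (intro summableI_nonneg_bounded[where x = "inner (A x) x"]) auto
  then have "(\<lambda>k. sqrt ((norm (F k x))\<^sup>2)) \<longlonglongrightarrow> sqrt 0"
    by (intro tendsto_real_sqrt summable_LIMSEQ_zero)
  then have "(\<lambda>k. F k x) \<longlonglongrightarrow> 0" by (simp add: tendsto_norm_zero_iff)
  then have "(\<lambda>k. inner (B (F k x)) x) \<longlonglongrightarrow> inner (B 0) x"
    by (intro tendsto_intros blinfun.tendsto)
  \<comment> \<open>The difference is the sum of the terms \<open>inner (B (F k x)) (F k x)\<close>,
    each nonnegative, because \<open>B\<close> moves past one factor \<open>F k\<close>. The left
    side tends to 0, which leaves the claim.\<close>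
  moreover have "inner (B (F n x)) x \<le> inner (B (A x)) x" for n
  proof -
    have "inner (B (A x)) x = (\<Sum>k<n. inner (B (F k (F k x))) x) + inner (B (F n x)) x"
      by (subst sum[of x n]) (simp add: blinfun.bilinear_simps inner_add_left inner_sum_left)
    moreover have "inner (B (F k (F k x))) x \<ge> 0" for k
    proof -
      have "B (F k (F k x)) = F k (B (F k x))" using F[of k] by (simp add: commutes_def)
      then have "inner (B (F k (F k x))) x = inner (B (F k x)) (F k x)"
        using F[of k] by (simp add: pos_op_def selfadj_def)
      then show ?thesis using B by (simp add: pos_op_def)
    qed
    ultimately show ?thesis by (simp add: sum_nonneg)
  qed
  ultimately show ?thesis
    using LIMSEQ_le_const2[of "\<lambda>k. inner (B (F k x)) x" "inner (B 0) x"] by (simp add: blinfun.zero_right)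
qed

lemma pos_op_compose:
  assumes A: "pos_op A" and B: "pos_op B" and AB: "commutes A B"
  shows "pos_op (A o\<^sub>L B)"
proof -
  define c where "c = 1 / (1 + norm A)"
  have c: "c > 0" "c * norm A \<le> 1" by (simp_all add: c_def add_pos_nonneg)
  have "pos_op (c *\<^sub>R A)" using A c by (simp add: pos_op_def selfadj_iff blinfun.bilinear_simps)
  moreover have "inner ((c *\<^sub>R A) x) x \<le> (norm x)\<^sup>2" for x
  proof -
    have "inner ((c *\<^sub>R A) x) x \<le> norm ((c *\<^sub>R A) x) * norm x" by (rule norm_cauchy_schwarz)
    also have "norm ((c *\<^sub>R A) x) \<le> 1 * norm x" using c by (intro norm_blinfun_le) simp
    finally show ?thesis by (simp add: power2_eq_square mult_right_mono)
  qed
  moreover have "commutes (c *\<^sub>R A) B" using AB by (simp add: commutes_def blinfun.bilinear_simps)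
  ultimately have "0 \<le> inner (B ((c *\<^sub>R A) x)) x" for x
    using B by (intro pos_op_compose_contraction)
  then have "0 \<le> c * inner (B (A x)) x" for x by (simp add: blinfun.bilinear_simps)
  then have "0 \<le> inner (B (A x)) x" for x using c(1) by (simp add: zero_le_mult_iff)
  then show ?thesis using A B AB by (simp add: pos_op_def selfadj_def commutes_def)
qed

section \<open>Strong limits of sequences of operators\<close>

lemma pointwise_limit_blinfun:
  fixes T :: "nat \<Rightarrow> 'a::real_normed_vector \<Rightarrow>\<^sub>L 'b::real_normed_vector"
  assumes conv: "\<And>x. convergent (\<lambda>n. T n x)" and K: "\<And>n x. norm (T n x) \<le> K * norm x"
  shows "\<exists>S :: 'a \<Rightarrow>\<^sub>L 'b. \<forall>x. (\<lambda>n. T n x) \<longlonglongrightarrow> S x"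
proof -
  obtain f where f: "\<And>x. (\<lambda>n. T n x) \<longlonglongrightarrow> f x" using conv unfolding convergent_def by metis
  have "bounded_linear f"
  proof (rule bounded_linear_intro[where K = K])
    show "f (x + y) = f x + f y" for x y
      by (rule LIMSEQ_unique[OF f]) (simp add: blinfun.bilinear_simps tendsto_add f)
    show "f (r *\<^sub>R x) = r *\<^sub>R f x" for r x
      by (rule LIMSEQ_unique[OF f]) (simp add: blinfun.bilinear_simps tendsto_scaleR f)
    show "norm (f x) \<le> norm x * K" for x
      by (rule LIMSEQ_le_const2[OF tendsto_norm[OF f]]) (use K in \<open>auto simp: mult.commute\<close>)
  qed
  then show ?thesis by (intro exI[of _ "Blinfun f"]) (simp add: bounded_linear_Blinfun_apply f)
qed

text \<open>Strong convergence of a norm-bounded sequence tolerates a moving argument, since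
  \<open>K\<close> controls \<open>T n (y n - z)\<close>. Limits of products such as
  \<open>D n (D n x)\<close> are taken through it.\<close>

lemma tendsto_blinfun_compose:
  fixes T :: "nat \<Rightarrow> 'a::real_normed_vector \<Rightarrow>\<^sub>L 'b::real_normed_vector"
  assumes T: "\<And>x. (\<lambda>n. T n x) \<longlonglongrightarrow> S x" and K: "\<And>n x. norm (T n x) \<le> K * norm x" and y: "y \<longlonglongrightarrow> z"
  shows "(\<lambda>n. T n (y n)) \<longlonglongrightarrow> S z"
proof -
  have "(\<lambda>n. T n (y n - z)) \<longlonglongrightarrow> 0"
  proof (rule Lim_null_comparison)
    show "\<forall>\<^sub>F n in sequentially. norm (T n (y n - z)) \<le> K * norm (y n - z)" using K by simp
    show "(\<lambda>n. K * norm (y n - z)) \<longlonglongrightarrow> 0"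
      using tendsto_mult_right_zero tendsto_norm_zero LIM_zero[OF y] by blast
  qed
  from tendsto_add[OF this T[of z]] show ?thesis by (simp add: blinfun.bilinear_simps)
qed

text \<open>The forms decrease to a limit. \<open>pos_op_norm_le\<close>, applied to
  \<open>D m - D n\<close>, bounds the squared distance of the vectors by the difference of the
  forms, so the vectors converge in norm.\<close>

lemma decreasing_pos_op_limit:
  assumes D: "\<And>n. pos_op (D n)" and le1: "\<And>n x. inner (D n x) x \<le> (norm x)\<^sup>2"
    and dec: "\<And>n x. inner (D (Suc n) x) x \<le> inner (D n x) x"
  shows "\<exists>E :: 'a::{real_inner,banach} operator. \<forall>x. (\<lambda>n. D n x) \<longlonglongrightarrow> E x"
proof (rule pointwise_limit_blinfun[where K = 1])
  have mono: "inner (D n x) x \<le> inner (D m x) x" if "m \<le> n" for m n x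
    using lift_Suc_antimono_le[of "\<lambda>n. inner (D n x) x", OF dec that] .
  have nonneg: "0 \<le> inner (D n x) x" for n x using D by (simp add: pos_op_def)
  have diff: "(norm (D m x - D n x))\<^sup>2 \<le> inner (D m x) x - inner (D n x) x" if "m \<le> n" for m n x
  proof -
    have "(norm ((D m - D n) x))\<^sup>2 \<le> 1 * inner ((D m - D n) x) x"
    proof (rule pos_op_norm_le)
      show "pos_op (D m - D n)" using D[of m] D[of n] mono[OF that]
        by (simp add: pos_op_def selfadj_def blinfun.bilinear_simps inner_diff_left inner_diff_right)
      show "inner ((D m - D n) y) y \<le> 1 * (norm y)\<^sup>2" for y
        using le1[of m y] nonneg[of n y] by (simp add: blinfun.bilinear_simps inner_diff_left)
    qed simp
    then show ?thesis by (simp add: blinfun.bilinear_simps inner_diff_left)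
  qed
  show "convergent (\<lambda>n. D n x)" for x
  proof -
    have "convergent (\<lambda>n. inner (D n x) x)"
      by (rule Bseq_monoseq_convergent)
        (auto intro!: BseqI'[where K = "(norm x)\<^sup>2"] decseq_imp_monoseq simp: decseq_def le1 nonneg mono)
    then have C: "Cauchy (\<lambda>n. inner (D n x) x)" by (simp add: Cauchy_convergent_iff)
    have "Cauchy (\<lambda>n. D n x)"
    proof (rule metric_CauchyI)
      fix e :: real assume "e > 0"
      then obtain N where N: "\<And>m n. m \<ge> N \<Longrightarrow> n \<ge> N \<Longrightarrow> \<bar>inner (D m x) x - inner (D n x) x\<bar> < e\<^sup>2"
        using metric_CauchyD[OF C, of "e\<^sup>2"] by (auto simp: dist_real_def)
      have *: "norm (D m x - D n x) < e" if "N \<le> m" "m \<le> n" for m n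
      proof -
        have "(norm (D m x - D n x))\<^sup>2 < e\<^sup>2" using diff[OF that(2), of x] N[of m n] that by simp
        then show ?thesis using \<open>e > 0\<close> by (simp add: power2_less_imp_less)
      qed
      then have "dist (D m x) (D n x) < e" if "N \<le> m" "N \<le> n" for m n
        using *[of m n] *[of n m] that by (cases "m \<le> n") (auto simp: dist_norm norm_minus_commute)
      then show "\<exists>M. \<forall>m\<ge>M. \<forall>n\<ge>M. dist (D m x) (D n x) < e" by blast
    qed
    then show ?thesis by (simp add: Cauchy_convergent_iff)
  qed
  show "norm (D n x) \<le> 1 * norm x" for n x
  proof -
    have "(norm (D n x))\<^sup>2 \<le> (norm x)\<^sup>2" using pos_op_norm_le[OF D, of n 1 x] le1[of n] order_trans[OF _ le1[of n x]] by simp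
    then have "norm (D n x) \<le> norm x" by (rule power2_le_imp_le) simp
    then show ?thesis by simp
  qed
qed

section \<open>Polar decomposition and spectral cuts\<close>

lemma pos_op_D:
  assumes "pos_op T"
  shows "selfadj T" and "radj T = T" and "0 \<le> inner (T x) x" and "inner (T x) y = inner x (T y)"
  using assms unfolding pos_op_def selfadj_iff[symmetric] by (auto simp: selfadj_def)

text \<open>The Newton-Schulz iteration \<open>V\<^sub>n\<^sub>+\<^sub>1 = V\<^sub>n (3 - V\<^sub>n\<^sup>* V\<^sub>n) / 2\<close> with \<open>V\<^sub>n = a X\<^sub>n\<close>; the defect
  \<open>D\<^sub>n = 1 - V\<^sub>n\<^sup>* V\<^sub>n\<close> satisfies \<open>D\<^sub>n\<^sub>+\<^sub>1 = D\<^sub>n\<^sup>2 (3 + D\<^sub>n) / 4\<close> and decreases to the projection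
  onto the kernel of \<open>a\<close>.\<close>

lemma polar_iteration:
  fixes a :: "'a::{real_inner,banach} operator"
  assumes a1: "\<And>x. norm (a x) \<le> norm x"
  shows "\<exists>X v E. (\<forall>n. pos_op (X n)) \<and> (\<forall>n S. commutes S (radj a o\<^sub>L a) \<longrightarrow> commutes S (X n)) \<and>
    (\<forall>x. (\<lambda>n. a (X n x)) \<longlonglongrightarrow> blinfun_apply v x) \<and> orth_proj E \<and>
    (\<forall>x. E x = x \<longleftrightarrow> a x = 0) \<and> (\<forall>x. (norm (v x))\<^sup>2 = (norm x)\<^sup>2 - (norm (E x))\<^sup>2)"
proof -
  define t where "t = radj a o\<^sub>L a"
  define DD where "DD = (\<lambda>X. id_blinfun - (t o\<^sub>L (X o\<^sub>L X)))"
  define X where "X = rec_nat id_blinfun (\<lambda>_ X. X + (1/2) *\<^sub>R (X o\<^sub>L DD X))"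
  define D where "D = (\<lambda>n. DD (X n))"
  have X0: "X 0 = id_blinfun" and XS: "X (Suc n) = X n + (1/2) *\<^sub>R (X n o\<^sub>L D n)" for n
    by (simp_all add: X_def D_def)
  have D: "D n x = x - t (X n (X n x))" for n x
    by (simp add: D_def DD_def blinfun.bilinear_simps)
  have XS': "X (Suc n) x = X n x + (1/2) *\<^sub>R X n (D n x)" for n x
    by (simp add: XS blinfun.bilinear_simps)
  have t: "inner (t x) y = inner (a x) (a y)" for x y by (simp add: t_def inner_radj')
  then have t': "inner x (t y) = inner (a x) (a y)" for x y by (metis inner_commute)
  have post: "pos_op t" by (simp add: pos_op_def selfadj_def t t')
  \<comment> \<open>\<open>X n\<close> and \<open>D n\<close> are polynomials in \<open>t\<close>;
    in particular all of them commute with one another.\<close>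
  have comm: "commutes S (X n) \<and> commutes S (D n)" if "commutes S t" for n S
  proof -
    have "commutes S (X n)"
    proof (induction n)
      case (Suc n)
      then show ?case using that by (simp add: commutes_def XS' D blinfun.bilinear_simps)
    qed (simp add: X0 commutes_def)
    with that show ?thesis by (simp add: commutes_def D blinfun.bilinear_simps)
  qed
  have tX: "X n (t x) = t (X n x)" for n x
    using comm[of t n] by (simp add: commutes_def)
  have XX: "commutes (X m) (X n)" and XD: "commutes (X m) (D n)" for m n
    using comm[of "X m" n] tX by (auto simp: commutes_def)
  have XDa: "D n (X m x) = X m (D n x)" for m n x using XD[of m n] by (simp add: commutes_def)
  have tXX: "t (X n (X n x)) = x - D n x" for n x
    by (simp add: D)
  have sa_DX: "selfadj (D n)" if "selfadj (X n)" for n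
  proof -
    have "inner (t (X n (X n x))) y = inner x (t (X n (X n y)))" for x y
    proof -
      have "inner (t (X n (X n x))) y = inner (X n (X n x)) (t y)" by (simp only: t t')
      also have "\<dots> = inner x (X n (X n (t y)))" using that by (simp only: selfadj_def)
      finally show ?thesis by (simp only: tX)
    qed
    then show ?thesis by (simp add: selfadj_def D inner_diff_left inner_diff_right)
  qed
  have saX: "selfadj (X n)" for n
  proof (induction n)
    case (Suc n)
    have saD: "selfadj (D n)"
      by (rule sa_DX) (rule Suc)
    have "inner (X n (D n x)) y = inner x (X n (D n y))" for x y
    proof -
      have "inner (X n (D n x)) y = inner (D n x) (X n y)" using Suc by (simp only: selfadj_def)
      also have "\<dots> = inner x (D n (X n y))" using saD by (simp only: selfadj_def)
      finally show ?thesis by (simp only: XDa)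
    qed
    with Suc show ?case
      by (simp add: selfadj_def XS' inner_add_left inner_add_right)
  qed (simp add: X0 selfadj_def)
  have saD: "selfadj (D n)" for n
    by (rule sa_DX) (rule saX)
  have innerD: "inner (D n x) x = (norm x)\<^sup>2 - (norm (a (X n x)))\<^sup>2" for n x
  proof -
    have "inner (t (X n (X n x))) x = inner (t (X n x)) (X n x)"
      using saX[of n] by (simp only: selfadj_def tX[symmetric])
    then show ?thesis by (simp add: D inner_diff_left power2_norm_eq_inner t)
  qed
  have D_le1: "inner (D n x) x \<le> (norm x)\<^sup>2" for n x by (simp add: innerD)
  have DS: "D (Suc n) x = (3/4) *\<^sub>R D n (D n x) + (1/4) *\<^sub>R D n (D n (D n x))" for n x
  proof -
    have "X (Suc n) (X (Suc n) x) = X n (X n x) + X n (X n (D n x)) + (1/4) *\<^sub>R X n (X n (D n (D n x)))"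
      by (simp add: XS' blinfun.bilinear_simps XDa scaleR_add_right flip: scaleR_add_left)
    then have "t (X (Suc n) (X (Suc n) x)) = (x - D n x) + (D n x - D n (D n x)) + (1/4) *\<^sub>R (D n (D n x) - D n (D n (D n x)))"
      by (simp add: blinfun.bilinear_simps tXX)
    then have "D (Suc n) x = (D n (D n x) - (1/4) *\<^sub>R D n (D n x)) + (1/4) *\<^sub>R D n (D n (D n x))"
      unfolding D[of "Suc n"] by (simp add: scaleR_diff_right)
    moreover have "y - (1/4) *\<^sub>R y = (3/4) *\<^sub>R y" for y :: 'a
      using scaleR_diff_left[of 1 "1/4" y] by simp
    ultimately show ?thesis by simp
  qed
  have posD: "pos_op (D n)" for n
  proof (induction n)
    case 0
    have "(norm (a x))\<^sup>2 \<le> (norm x)\<^sup>2" for x using a1 by (simp add: power_mono)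
    then show ?case using saD[of 0] innerD[of 0] by (simp add: pos_op_def X0)
  next
    case (Suc n)
    have "0 \<le> inner (D (Suc n) x) x" for x
    proof -
      have "inner (D n (D n x)) x = inner (D n x) (D n x)" "inner (D n (D n (D n x))) x = inner (D n (D n x)) (D n x)"
        using saD[of n] by (simp_all add: selfadj_def)
      then show ?thesis using pos_op_D(3)[OF Suc, of "D n x"]
        by (simp add: DS inner_add_left)
    qed
    then show ?case using saD by (simp add: pos_op_def)
  qed
  have DD_le: "(norm (D n x))\<^sup>2 \<le> inner (D n x) x" for n x
    using pos_op_norm_le[OF posD, of n 1] D_le1 by simp
  have dec: "inner (D (Suc n) x) x \<le> inner (D n x) x" for n x
  proof -
    have "inner (D n (D n x)) x = (norm (D n x))\<^sup>2" "inner (D n (D n (D n x))) x = inner (D n (D n x)) (D n x)"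
      using saD[of n] by (simp_all add: selfadj_def power2_norm_eq_inner)
    then have "inner (D (Suc n) x) x = (3/4) * (norm (D n x))\<^sup>2 + (1/4) * inner (D n (D n x)) (D n x)"
      by (simp add: DS inner_add_left)
    with DD_le[of n x] D_le1[of n "D n x"] show ?thesis by simp
  qed
  have normD: "norm (D n x) \<le> 1 * norm x" for n x
  proof -
    have "(norm (D n x))\<^sup>2 \<le> (norm x)\<^sup>2" using DD_le D_le1 order_trans by blast
    then have "norm (D n x) \<le> norm x" by (rule power2_le_imp_le) simp
    then show ?thesis by simp
  qed
  obtain E :: "'a operator" where E: "\<And>x. (\<lambda>n. D n x) \<longlonglongrightarrow> E x"
    using decreasing_pos_op_limit[of D, OF posD D_le1 dec] by blast
  have Elim: "(\<lambda>n. D n (y n)) \<longlonglongrightarrow> E z" if "y \<longlonglongrightarrow> z" for y z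
    using tendsto_blinfun_compose[OF E normD that] .
  have saE: "inner (E x) y = inner x (E y)" for x y
  proof -
    have "(\<lambda>n. inner (D n x) y) \<longlonglongrightarrow> inner x (E y)"
      using tendsto_inner[OF tendsto_const E, of x y] saD by (simp add: selfadj_def)
    then show ?thesis using LIMSEQ_unique tendsto_inner[OF E tendsto_const] by blast
  qed
  have posE: "0 \<le> inner (E x) x" for x
    using LIMSEQ_le_const[OF tendsto_inner[OF E tendsto_const, of x x], of 0] posD by (auto simp: pos_op_def)
  have Eeq: "E x = (3/4) *\<^sub>R E (E x) + (1/4) *\<^sub>R E (E (E x))" for x
  proof -
    have "(\<lambda>n. D (Suc n) x) \<longlonglongrightarrow> (3/4) *\<^sub>R E (E x) + (1/4) *\<^sub>R E (E (E x))"
      unfolding DS by (intro tendsto_intros Elim E)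
    then show ?thesis using LIMSEQ_unique LIMSEQ_Suc[OF E] by blast
  qed
  have idem: "E (E x) = E x" for x
  proof -
    \<comment> \<open>\<open>4 E - 3 E\<^sup>2 - E\<^sup>3\<close> factors as
      \<open>(4 + E) (E - E\<^sup>2)\<close>, and \<open>4 + E\<close> is injective because
      \<open>E\<close> is positive.\<close>
    define w where "w = E (x - E x)"
    have "4 *\<^sub>R E x = 4 *\<^sub>R ((3/4) *\<^sub>R E (E x) + (1/4) *\<^sub>R E (E (E x)))" using Eeq by simp
    also have "\<dots> = 3 *\<^sub>R E (E x) + E (E (E x))" by (simp add: scaleR_add_right)
    finally have e: "4 *\<^sub>R E x = 3 *\<^sub>R E (E x) + E (E (E x))" .
    have "4 *\<^sub>R w + E w = 4 *\<^sub>R E x - 3 *\<^sub>R E (E x) - E (E (E x))"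
    proof -
      have "4 *\<^sub>R y = 3 *\<^sub>R y + y" for y :: 'a
        using scaleR_add_left[of 3 1 y] by simp
      then show ?thesis by (simp add: w_def blinfun.bilinear_simps scaleR_diff_right)
    qed
    then have "4 *\<^sub>R w + E w = 0" using e by simp
    then have "inner (4 *\<^sub>R w + E w) w = 0" by simp
    then have "4 * inner w w + inner (E w) w = 0" by (simp add: inner_add_left)
    then have "inner w w = 0" using posE[of w] inner_ge_zero[of w] by linarith
    then show ?thesis by (simp add: w_def blinfun.bilinear_simps)
  qed
  have projE: "orth_proj E" using saE idem by (simp add: orth_proj_def selfadj_def)
  have decE: "inner (E x) x \<le> (norm x)\<^sup>2 - (norm (a (X n x)))\<^sup>2" for n x
  proof -
    have "inner (E x) x \<le> inner (D n x) x"
    proof (rule LIMSEQ_le_const2[OF tendsto_inner[OF E tendsto_const]])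
      show "\<exists>N. \<forall>k\<ge>N. inner (D k x) x \<le> inner (D n x) x"
        using lift_Suc_antimono_le[of "\<lambda>n. inner (D n x) x", OF dec] by blast
    qed
    then show ?thesis by (simp add: innerD)
  qed
  have kerE: "E x = x \<longleftrightarrow> a x = 0" for x
  proof
    assume "E x = x"
    then have "(norm (a x))\<^sup>2 \<le> 0" using decE[of x 0] by (simp add: X0 power2_norm_eq_inner)
    then show "a x = 0" by simp
  next
    assume "a x = 0"
    then have "t x = 0" by (simp add: t_def blinfun.bilinear_simps)
    then have "D n x = x" for n by (simp add: D blinfun.bilinear_simps flip: tX)
    then show "E x = x" using LIMSEQ_unique[OF E[of x], of x] by simp
  qed
  have posX: "pos_op (X n)" for n
  proof (induction n)
    case (Suc n)
    have "0 \<le> inner (X n (D n x)) x" for x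
      using pos_op_D(3)[OF pos_op_compose[OF Suc posD XD[of n n]], of x] by simp
    then show ?case using Suc saX[of "Suc n"] by (simp add: pos_op_def XS' inner_add_left)
  qed (simp add: X0 pos_op_def selfadj_def)
  have Xmono: "inner (X m x) x \<le> inner (X n x) x" if "m \<le> n" for m n x
  proof (rule lift_Suc_mono_le[of "\<lambda>n. inner (X n x) x", OF _ that])
    fix n
    have "0 \<le> inner (X n (D n x)) x"
      using pos_op_D(3)[OF pos_op_compose[OF posX posD XD[of n n]], of x] by simp
    then show "inner (X n x) x \<le> inner (X (Suc n) x) x" by (simp add: XS' inner_add_left)
  qed
  \<comment> \<open>Positivity of \<open>t X\<^sub>m (X\<^sub>n - X\<^sub>m)\<close> says that the
    inner product of \<open>a (X n x)\<close> and \<open>a (X m x)\<close> is at least the squared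
    norm of \<open>a (X m x)\<close>. Hence convergence of the norms, known from the defects, forces
    the vectors to be Cauchy.\<close>
  have Vdiff: "(norm (a (X n x) - a (X m x)))\<^sup>2 \<le> (norm (a (X n x)))\<^sup>2 - (norm (a (X m x)))\<^sup>2" if "m \<le> n" for m n x
  proof -
    have "pos_op (X n - X m)"
      using saX[of n] saX[of m] Xmono[OF that]
      by (simp add: pos_op_def selfadj_def blinfun.bilinear_simps inner_diff_left inner_diff_right)
    moreover have "commutes t (X m)" using tX by (simp add: commutes_def)
    then have "pos_op (t o\<^sub>L X m)" using post posX by (intro pos_op_compose)
    moreover have "commutes (t o\<^sub>L X m) (X n - X m)"
      using XX[of m n] by (simp add: commutes_def blinfun.bilinear_simps tX)
    ultimately have "pos_op ((t o\<^sub>L X m) o\<^sub>L (X n - X m))"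
      using pos_op_compose[of "t o\<^sub>L X m" "X n - X m"] by simp
    from pos_op_D(3)[OF this, of x] have "0 \<le> inner (t (X m (X n x))) x - inner (t (X m (X m x))) x"
      by (simp add: blinfun.bilinear_simps inner_diff_left)
    moreover have "inner (t (X m y)) x = inner (a y) (a (X m x))" for y
      by (metis saX selfadj_def t tX)
    ultimately have "(norm (a (X m x)))\<^sup>2 \<le> inner (a (X n x)) (a (X m x))"
      by (simp add: power2_norm_eq_inner)
    then show ?thesis
      by (simp add: power2_norm_eq_inner inner_diff_left inner_diff_right inner_commute)
  qed
  have Vnorm: "norm (a (X n x)) \<le> 1 * norm x" for n x
  proof -
    have "(norm (a (X n x)))\<^sup>2 \<le> (norm x)\<^sup>2"
      using innerD[of n x] pos_op_D(3)[OF posD, of n x] by simp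
    then have "norm (a (X n x)) \<le> norm x" by (rule power2_le_imp_le) simp
    then show ?thesis by simp
  qed
  have "convergent (\<lambda>n. (a o\<^sub>L X n) x)" for x
  proof -
    have "convergent (\<lambda>n. inner (D n x) x)"
      using tendsto_inner[OF E tendsto_const] convergent_def by blast
    then have C: "Cauchy (\<lambda>n. inner (D n x) x)" by (simp add: Cauchy_convergent_iff)
    have "Cauchy (\<lambda>n. (a o\<^sub>L X n) x)"
    proof (rule metric_CauchyI)
      fix e :: real assume "e > 0"
      then obtain N where N: "\<And>m n. m \<ge> N \<Longrightarrow> n \<ge> N \<Longrightarrow> \<bar>inner (D m x) x - inner (D n x) x\<bar> < e\<^sup>2"
        using metric_CauchyD[OF C, of "e\<^sup>2"] by (auto simp: dist_real_def)
      have *: "norm (a (X n x) - a (X m x)) < e" if "N \<le> m" "m \<le> n" for m n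
      proof -
        have "(norm (a (X n x) - a (X m x)))\<^sup>2 < e\<^sup>2"
          using Vdiff[OF that(2), of x] N[of m n] that by (simp add: innerD)
        then show ?thesis using \<open>e > 0\<close> by (simp add: power2_less_imp_less)
      qed
      then have "dist ((a o\<^sub>L X m) x) ((a o\<^sub>L X n) x) < e" if "N \<le> m" "N \<le> n" for m n
        using *[of m n] *[of n m] that by (cases "m \<le> n") (auto simp: dist_norm norm_minus_commute)
      then show "\<exists>M. \<forall>m\<ge>M. \<forall>n\<ge>M. dist ((a o\<^sub>L X m) x) ((a o\<^sub>L X n) x) < e" by blast
    qed
    then show ?thesis by (simp add: Cauchy_convergent_iff)
  qed
  then have "\<exists>v :: 'a operator. \<forall>x. (\<lambda>n. (a o\<^sub>L X n) x) \<longlonglongrightarrow> v x"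
    using Vnorm by (intro pointwise_limit_blinfun[where K = 1]) auto
  then obtain v :: "'a operator" where v: "\<And>x. (\<lambda>n. a (X n x)) \<longlonglongrightarrow> v x"
    by auto
  have "(norm (v x))\<^sup>2 = (norm x)\<^sup>2 - (norm (E x))\<^sup>2" for x
  proof -
    have "(\<lambda>n. (norm x)\<^sup>2 - inner (D n x) x) \<longlonglongrightarrow> (norm x)\<^sup>2 - inner (E x) x"
      by (intro tendsto_intros E)
    then have "(\<lambda>n. (norm (a (X n x)))\<^sup>2) \<longlonglongrightarrow> (norm x)\<^sup>2 - inner (E x) x" by (simp add: innerD)
    then have "(norm (v x))\<^sup>2 = (norm x)\<^sup>2 - inner (E x) x"
      using LIMSEQ_unique tendsto_power[OF tendsto_norm[OF v]] by blast
    then show ?thesis by (simp add: orth_proj_inner[OF projE])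
  qed
  with posX comm v projE kerE show ?thesis
    unfolding t_def by (intro exI[of _ X] exI[of _ v] exI[of _ E]) blast
qed

lemma contraction_scale:
  fixes a :: "'a::real_normed_vector operator"
  obtains c :: real where "c > 0" "\<And>x. norm ((c *\<^sub>R a) x) \<le> norm x"
proof
  define c where "c = 1 / (1 + norm a)"
  show c: "c > 0" by (simp add: c_def add_pos_nonneg)
  have "norm (c *\<^sub>R a) \<le> 1" by (simp add: c_def divide_le_eq_1 add_pos_nonneg)
  then show "norm ((c *\<^sub>R a) x) \<le> norm x" for x
    using norm_blinfun_le by fastforce
qed

text \<open>\<open>v\<close> is the strong limit of the Newton-Schulz iterates. That its range stays
  in the closed range of \<open>a\<close> is phrased through operators \<open>b\<close> annihilating
  the range, a form that passes to limits; the last clause later places \<open>v\<close> in every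
  commutant that contains \<open>a\<close> and its adjoint.\<close>

lemma polar_decomposition:
  fixes a :: "'a::{real_inner,banach} operator"
  shows "\<exists>v E. orth_proj E \<and> (\<forall>x. E x = x \<longleftrightarrow> a x = 0) \<and> radj v o\<^sub>L v = id_blinfun - E \<and>
    (\<forall>b :: 'a operator. (\<forall>x. b (a x) = 0) \<longrightarrow> (\<forall>x. b (v x) = 0)) \<and>
    (\<forall>S. commutes S a \<and> commutes S (radj a) \<longrightarrow> commutes S v)"
proof -
  obtain c :: real where c: "c > 0" and ca: "\<And>x. norm ((c *\<^sub>R a) x) \<le> norm x"
    using contraction_scale[of a] by blast
  define A where "A = c *\<^sub>R a"
  have "norm (A x) \<le> norm x" for x using ca by (simp add: A_def)
  from polar_iteration[of A, OF this] obtain X v E where *: "\<forall>n. pos_op (X n)"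
    "\<forall>n S. commutes S (radj A o\<^sub>L A) \<longrightarrow> commutes S (X n)"
    "\<forall>x. (\<lambda>n. A (X n x)) \<longlonglongrightarrow> blinfun_apply v x" "orth_proj E"
    "\<forall>x. E x = x \<longleftrightarrow> A x = 0" "\<forall>x. (norm (v x))\<^sup>2 = (norm x)\<^sup>2 - (norm (E x))\<^sup>2"
    by (elim exE conjE)
  note posX = *(1)[rule_format] and X = *(2)[rule_format] and v = *(3)[rule_format]
    and E = *(4) and ker = *(5)[rule_format] and nv = *(6)[rule_format]
  have A: "A x = c *\<^sub>R a x" for x by (simp add: A_def blinfun.bilinear_simps)
  have "E x = x \<longleftrightarrow> a x = 0" for x using ker[of x] c by (simp add: A)
  moreover have "(radj v o\<^sub>L v) - (id_blinfun - E) = 0"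
  proof (rule selfadj_zero_form)
    show "selfadj ((radj v o\<^sub>L v) - (id_blinfun - E))" using E by (simp add: selfadj_iff orth_projD)
    show "inner (((radj v o\<^sub>L v) - (id_blinfun - E)) x) x = 0" for x
      using nv[of x] by (simp add: blinfun.bilinear_simps inner_diff_left inner_radj' orth_proj_inner[OF E] power2_norm_eq_inner)
  qed
  moreover have "b (v x) = 0" if "\<And>x. b (a x) = 0" for b :: "'a operator" and x
    using LIMSEQ_unique[OF blinfun.tendsto[OF tendsto_const v[of x], of b], of 0] that
    by (simp add: A blinfun.bilinear_simps)
  moreover have "commutes S v" if S: "commutes S a" "commutes S (radj a)" for S
  proof -
    have "commutes S (X n)" for n
      using S by (intro X) (simp add: commutes_def A_def blinfun.bilinear_simps)
    then have "S (A (X n x)) = A (X n (S x))" for n x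
      using S(1) by (simp add: commutes_def A blinfun.bilinear_simps)
    then have "S (v x) = v (S x)" for x
      using LIMSEQ_unique[OF blinfun.tendsto[OF tendsto_const[of S] v[of x]]] v[of "S x"] by simp
    then show ?thesis by (simp add: commutes_def)
  qed
  ultimately show ?thesis using E by (intro exI[of _ v] exI[of _ E]) simp
qed

text \<open>The polar part \<open>v\<close> of \<open>A - t\<close> is its sign:
  \<open>v\<^sup>2\<close> projects onto the complement of the kernel, and
  \<open>(v\<^sup>2 + v) / 2\<close> is the projection where the sign is positive. Its complement
  \<open>p\<close> is the spectral projection for values up to \<open>t\<close>, with the kernel of
  \<open>A - t\<close> included.\<close>

lemma spectral_cut:
  fixes A :: "'a::{real_inner,banach} operator"
  assumes A: "selfadj A"
  shows "\<exists>p. orth_proj p \<and> (\<forall>S. commutes S A \<longrightarrow> commutes S p) \<and>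
    (\<forall>x. p x = x \<longrightarrow> inner (A x) x \<le> t * (norm x)\<^sup>2) \<and> (\<forall>x. p x = 0 \<longrightarrow> t * (norm x)\<^sup>2 \<le> inner (A x) x)"
proof -
  obtain c :: real where c: "c > 0" and cb: "\<And>x. norm ((c *\<^sub>R (A - t *\<^sub>R id_blinfun)) x) \<le> norm x"
    using contraction_scale[of "A - t *\<^sub>R id_blinfun"] by blast
  define b where "b = c *\<^sub>R (A - t *\<^sub>R id_blinfun)"
  have b: "b x = c *\<^sub>R (A x - t *\<^sub>R x)" for x by (simp add: b_def blinfun.bilinear_simps)
  have rb: "radj b = b" using A by (simp add: b_def selfadj_iff)
  then have sb: "inner (b x) y = inner x (b y)" for x y using inner_radj[of b] by simp
  have "norm (b x) \<le> norm x" for x using cb by (simp add: b_def)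
  from polar_iteration[of b, OF this] obtain X v E where *: "\<forall>n. pos_op (X n)"
    "\<forall>n S. commutes S (radj b o\<^sub>L b) \<longrightarrow> commutes S (X n)"
    "\<forall>x. (\<lambda>n. b (X n x)) \<longlonglongrightarrow> blinfun_apply v x" "orth_proj E"
    "\<forall>x. E x = x \<longleftrightarrow> b x = 0" "\<forall>x. (norm (v x))\<^sup>2 = (norm x)\<^sup>2 - (norm (E x))\<^sup>2"
    by (elim exE conjE)
  note posX = *(1)[rule_format] and X = *(2)[rule_format] and v = *(3)[rule_format]
    and E = *(4) and ker = *(5)[rule_format] and nv = *(6)[rule_format]
  have comm_v: "commutes S v" if "commutes S b" for S
  proof -
    have "commutes S (X n)" for n using that by (intro X) (simp add: commutes_def rb)
    then have "S (b (X n x)) = b (X n (S x))" for n x using that by (simp add: commutes_def)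
    then have "S (v x) = v (S x)" for x
      using LIMSEQ_unique[OF blinfun.tendsto[OF tendsto_const[of S] v[of x]]] v[of "S x"] by simp
    then show ?thesis by (simp add: commutes_def)
  qed
  have bX: "b (X n x) = X n (b x)" for n x
    using X[of b n] by (simp add: commutes_def rb)
  have vb: "v (b x) = b (v x)" for x using comm_v[of b] by (simp add: commutes_def)
  have sv: "inner (v x) y = inner x (v y)" for x y
  proof -
    have "inner (b (X n x)) y = inner x (b (X n y))" for n
      by (metis bX pos_op_D(4)[OF posX] sb)
    then have "(\<lambda>n. inner x (b (X n y))) \<longlonglongrightarrow> inner (v x) y"
      using tendsto_inner[OF v[of x] tendsto_const[of y]] by simp
    then show ?thesis using LIMSEQ_unique tendsto_inner[OF tendsto_const v] by blast
  qed
  \<comment> \<open>\<open>v b\<close> is the absolute value of \<open>b\<close>; it is positive as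
    the limit of \<open>b X\<^sub>n b\<close>.\<close>
  have vb_pos: "0 \<le> inner (v (b x)) x" for x
  proof (rule LIMSEQ_le_const[OF tendsto_inner[OF v tendsto_const]])
    have "inner (b (X n (b x))) x = inner (X n (b x)) (b x)" for n by (rule sb)
    then show "\<exists>N. \<forall>n\<ge>N. 0 \<le> inner (b (X n (b x))) x" using pos_op_D(3)[OF posX] by simp
  qed
  have vv: "v (v x) = x - E x" for x
  proof -
    have "(v o\<^sub>L v) - (id_blinfun - E) = 0"
    proof (rule selfadj_zero_form)
      have "selfadj v" using sv by (simp add: selfadj_def)
      then show "selfadj ((v o\<^sub>L v) - (id_blinfun - E))" using E by (simp add: selfadj_iff orth_projD)
      show "inner (((v o\<^sub>L v) - (id_blinfun - E)) x) x = 0" for x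
        using nv[of x] sv[of "v x" x]
        by (simp add: blinfun.bilinear_simps inner_diff_left orth_proj_inner[OF E] power2_norm_eq_inner)
    qed
    then have "(v o\<^sub>L v) x = (id_blinfun - E) x" by simp
    then show ?thesis by (simp add: blinfun.bilinear_simps)
  qed
  have vE: "v (E x) = 0" and bE: "b (E x) = 0" for x
    using nv[of "E x"] ker[of "E x"] orth_projD(1)[OF E] by simp_all
  have vvv: "v (v (v x)) = v x" for x by (simp add: vv[of x] blinfun.bilinear_simps vE)
  define p where "p = id_blinfun - (1/2) *\<^sub>R ((v o\<^sub>L v) + v)"
  have p: "p x = x - (1/2) *\<^sub>R (v (v x) + v x)" for x by (simp add: p_def blinfun.bilinear_simps)
  have half: "(1/2) *\<^sub>R (y + y) = y" for y :: 'a by (simp flip: scaleR_2)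
  have "p (p x) = p x" for x
  proof -
    define w where "w = v (v x) + v x"
    have vw: "v w = w" by (simp add: w_def blinfun.bilinear_simps vvv add.commute)
    have "v (p x) = v x - (1/2) *\<^sub>R w" "v (v (p x)) = v (v x) - (1/2) *\<^sub>R w"
      by (simp_all add: p w_def[symmetric] blinfun.bilinear_simps vw)
    then have "v (v (p x)) + v (p x) = w - (1/2) *\<^sub>R (w + w)"
      by (simp add: w_def scaleR_add_right)
    then have "v (v (p x)) + v (p x) = 0" by (simp only: half diff_self)
    then show ?thesis by (simp add: p[of "p x"])
  qed
  moreover have "selfadj p"
  proof -
    have "selfadj v" using sv by (simp add: selfadj_def)
    then show ?thesis by (simp add: selfadj_iff p_def)
  qed
  ultimately have "orth_proj p" by (simp add: orth_proj_def)
  moreover have "commutes S p" if "commutes S A" for S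
  proof -
    have "commutes S b" using that by (simp add: commutes_def b blinfun.bilinear_simps)
    from comm_v[OF this] show ?thesis by (simp add: commutes_def p blinfun.bilinear_simps)
  qed
  moreover have bform: "inner (b x) x = c * (inner (A x) x - t * (norm x)\<^sup>2)" for x
    by (simp add: b inner_diff_left power2_norm_eq_inner)
  have "inner (A x) x \<le> t * (norm x)\<^sup>2" if "p x = x" for x
  proof -
    have "v (v x) = - v x" using that by (simp add: p eq_neg_iff_add_eq_0)
    then have "b (v (v x)) = - b (v x)" by (simp add: blinfun.bilinear_simps)
    then have "b x = - v (b x)" by (simp add: vv blinfun.bilinear_simps bE vb)
    then have "inner (b x) x = - inner (v (b x)) x" by (metis inner_minus_left)
    then have "inner (b x) x \<le> 0" using vb_pos[of x] by simp
    then show ?thesis using c by (simp add: bform mult_le_0_iff)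
  qed
  moreover have "t * (norm x)\<^sup>2 \<le> inner (A x) x" if "p x = 0" for x
  proof -
    have x: "x = (1/2) *\<^sub>R (v (v x) + v x)" using that by (simp add: p)
    have "v x = (1/2) *\<^sub>R (v (v (v x)) + v (v x))"
      using arg_cong[OF x, of v] by (simp only: blinfun.bilinear_simps)
    then have "v x = x" using x by (simp add: vvv add.commute)
    then have "0 \<le> inner (b x) x" using vb_pos[of x] by (simp add: vb)
    then show ?thesis using c by (simp add: bform zero_le_mult_iff)
  qed
  ultimately show ?thesis by blast
qed

text \<open>The adjoint of \<open>p (radj S) p = (radj S) p\<close> is \<open>p S p = p S\<close>,
  which meets \<open>p S p = S p\<close>: a subspace invariant under an operator and its adjoint
  reduces it.\<close>

lemma orth_proj_commutesI:
  fixes p S :: "'a::{real_inner,banach} operator"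
  assumes p: "orth_proj p" and S: "\<And>x. p (S (p x)) = S (p x)" and S': "\<And>x. p (radj S (p x)) = radj S (p x)"
  shows "commutes p S"
proof -
  have "p o\<^sub>L (radj S o\<^sub>L p) = radj S o\<^sub>L p" using S' by (intro blinfun_eqI) simp
  then have "radj (p o\<^sub>L (radj S o\<^sub>L p)) = radj (radj S o\<^sub>L p)" by simp
  then have "(p o\<^sub>L S) o\<^sub>L p = p o\<^sub>L S" using orth_projD(3)[OF p] by simp
  then have "p (S (p x)) = p (S x)" for x by (metis blinfun_apply_blinfun_compose)
  with S show ?thesis by (simp add: commutes_def)
qed

text \<open>On the range of \<open>r\<close> the operator \<open>t - A\<close> lies between 0 and
  \<open>s\<close> in the sense of forms, and \<open>pos_op_norm_le\<close> converts this into a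
  norm bound. Compressing by \<open>r\<close> makes the form bounds hold on the whole space.\<close>

lemma selfadj_band_norm_le:
  assumes A: "selfadj A" and r: "orth_proj r" "commutes r A" and s: "s > 0"
    and band: "\<And>x. r x = x \<Longrightarrow> (t - s) * (norm x)\<^sup>2 \<le> inner (A x) x"
      "\<And>x. r x = x \<Longrightarrow> inner (A x) x \<le> t * (norm x)\<^sup>2"
    and x: "r x = x"
  shows "norm (A x - t *\<^sub>R x) \<le> s * norm x"
proof -
  define T where "T = r o\<^sub>L (t *\<^sub>R id_blinfun - A)"
  have T: "T y = t *\<^sub>R r y - r (A y)" for y by (simp add: T_def blinfun.bilinear_simps)
  have rr: "r (r y) = r y" "inner (r y) z = inner y (r z)" for y z using orth_projD[OF r(1)] by auto
  have rA: "r (A y) = A (r y)" for y using r(2) by (simp add: commutes_def)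
  have form: "inner (T y) y = t * (norm (r y))\<^sup>2 - inner (A (r y)) (r y)" for y
  proof -
    have "inner (A (r y)) y = inner (A (r y)) (r y)" using rr rA by metis
    then show ?thesis by (simp add: T rA inner_diff_left orth_proj_inner[OF r(1)])
  qed
  have "radj T = T"
    using A orth_projD(3)[OF r(1)] r(2)
    by (intro blinfun_eqI) (simp add: T_def selfadj_iff blinfun.bilinear_simps commutes_def)
  then have "pos_op T"
    using band(2)[OF rr(1)] by (simp add: pos_op_def selfadj_iff form)
  moreover have T_le: "inner (T y) y \<le> s * (norm y)\<^sup>2" for y
  proof -
    have "inner (T y) y \<le> s * (norm (r y))\<^sup>2"
      using band(1)[OF rr(1), of y] by (simp add: form algebra_simps)
    also have "\<dots> \<le> s * (norm y)\<^sup>2"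
      using s orth_proj_norm_le[OF r(1)] by (simp add: power_mono)
    finally show ?thesis .
  qed
  ultimately have "(norm (T x))\<^sup>2 \<le> s * inner (T x) x" using s by (intro pos_op_norm_le)
  also have "\<dots> \<le> s * (s * (norm x)\<^sup>2)" using T_le s by (simp add: mult_left_mono)
  finally have "(norm (T x))\<^sup>2 \<le> (s * norm x)\<^sup>2" by (simp add: power2_eq_square ac_simps)
  then have "norm (T x) \<le> s * norm x" by (rule power2_le_imp_le) (use s in simp)
  then show ?thesis by (simp add: T x rA norm_minus_commute)
qed

section \<open>Commutants and countably generated projections\<close>

lemma compl_apply_eq_0: "(id_blinfun - p) x = 0 \<longleftrightarrow> p x = x"
  by (auto simp: blinfun.bilinear_simps)

lemma orth_proj_eqI:
  assumes "orth_proj p" "orth_proj q" "\<And>x. p x = x \<longleftrightarrow> q x = x"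
  shows "p = q"
proof (rule blinfun_eqI)
  fix x
  have "q (p x) = p x" "p (q x) = q x" for x using assms orth_projD(1) by metis+
  then show "p x = q x" using orth_proj_le_sym[OF assms(1,2)] by metis
qed

fun opow :: "'a::real_normed_vector operator \<Rightarrow> nat \<Rightarrow> 'a operator" where
  "opow s 0 = id_blinfun"
| "opow s (Suc n) = s o\<^sub>L opow s n"

text \<open>The range of \<open>d\<close> is a wandering subspace for the shift \<open>s\<close>: it
  is orthogonal to the range of \<open>s\<close>, and \<open>s\<close> is isometric on
  \<open>e\<close>. Common powers of \<open>s\<close> cancel, and what remains is the case of one
  exponent 0.\<close>

lemma shift_orthogonal:
  fixes s d e :: "'a::{real_inner,banach} operator"
  assumes ss: "radj s o\<^sub>L s = e" and es: "\<And>x. e (s x) = s x" and ed: "\<And>x. e (d x) = d x"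
    and ds: "\<And>x y. inner (d x) (s y) = 0"
  shows "inner (opow s m (d x)) (opow s n (d y)) = (if m = n then inner (d x) (d y) else 0)"
    and "e (opow s n (d x)) = opow s n (d x)"
proof -
  show eU: "e (opow s n (d x)) = opow s n (d x)" for n x
    by (cases n) (simp_all add: ed es)
  have iso: "inner (s u) (s w) = inner (e u) w" for u w
    by (metis blinfun_apply_blinfun_compose inner_commute inner_radj ss)
  show "inner (opow s m (d x)) (opow s n (d y)) = (if m = n then inner (d x) (d y) else 0)"
  proof (induction m arbitrary: n)
    case 0
    then show ?case by (cases n) (simp_all add: ds)
  next
    case (Suc m)
    then show ?case
    proof (cases n)
      case 0
      then show ?thesis using ds[of y] by (simp add: inner_commute)
    next
      case (Suc k)
      then show ?thesis using Suc.IH[of k] by (simp add: iso eU)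
    qed
  qed
qed

text \<open>A complex von Neumann algebra \<open>M\<close> is of this form on the underlying real Hilbert space: \<open>N\<close> consists
  of its commutant and of the scalar operators, so that \<open>\<complex>\<close>-linearity becomes one more commutation relation.\<close>

locale operator_algebra =
  fixes N M :: "'a::{real_inner,banach} operator set"
  assumes N_radj: "S \<in> N \<Longrightarrow> radj S \<in> N"
    and mem_iff: "T \<in> M \<longleftrightarrow> (\<forall>S\<in>N. commutes T S)"
begin

lemma memD: "T \<in> M \<Longrightarrow> S \<in> N \<Longrightarrow> T (S x) = S (T x)"
  by (simp add: mem_iff commutes_def)

lemma id_mem: "id_blinfun \<in> M" and zero_mem: "0 \<in> M"
  and add_mem: "S \<in> M \<Longrightarrow> T \<in> M \<Longrightarrow> S + T \<in> M"
  and diff_mem: "S \<in> M \<Longrightarrow> T \<in> M \<Longrightarrow> S - T \<in> M"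
  and scaleR_mem: "T \<in> M \<Longrightarrow> r *\<^sub>R T \<in> M"
  and comp_mem: "S \<in> M \<Longrightarrow> T \<in> M \<Longrightarrow> S o\<^sub>L T \<in> M"
  by (auto simp: mem_iff commutes_def blinfun.bilinear_simps)

lemma sum_mem: "(\<And>i. i \<in> I \<Longrightarrow> T i \<in> M) \<Longrightarrow> (\<Sum>i\<in>I. T i) \<in> M"
  by (induction I rule: infinite_finite_induct) (auto simp: zero_mem add_mem)

lemma radj_mem: "T \<in> M \<Longrightarrow> radj T \<in> M"
  unfolding mem_iff by (metis N_radj commutes_radj radj_radj)

lemma opow_mem: "s \<in> M \<Longrightarrow> opow s n \<in> M"
  by (induction n) (simp_all add: id_mem comp_mem)

section \<open>Projections of the algebra and of its center\<close>

definition projs :: "'a operator set" where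
  "projs = {p \<in> M. orth_proj p}"

definition central_projs :: "'a operator set" where
  "central_projs = {f \<in> projs. \<forall>T\<in>M. commutes f T}"

lemma projsD:
  assumes "p \<in> projs"
  shows "p \<in> M" and "orth_proj p" and "p (p x) = p x" and "inner (p x) y = inner x (p y)" and "radj p = p"
  using assms orth_projD by (auto simp: projs_def)

lemma central_projsD:
  assumes "f \<in> central_projs"
  shows "f \<in> projs" and "T \<in> M \<Longrightarrow> f (T x) = T (f x)"
  using assms by (auto simp: central_projs_def commutes_def)

lemma id_projs: "id_blinfun \<in> projs" and zero_projs: "0 \<in> projs"
  by (simp_all add: projs_def id_mem zero_mem)

lemma compl_projs: "p \<in> projs \<Longrightarrow> id_blinfun - p \<in> projs"
  by (simp add: projs_def id_mem diff_mem orth_proj_compl)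

lemma id_central: "id_blinfun \<in> central_projs" and zero_central: "0 \<in> central_projs"
  by (simp_all add: central_projs_def id_projs zero_projs commutes_def)

lemma compl_central: "f \<in> central_projs \<Longrightarrow> id_blinfun - f \<in> central_projs"
  by (simp add: central_projs_def compl_projs commutes_def blinfun.bilinear_simps)

lemma central_comp_projs: "f \<in> central_projs \<Longrightarrow> p \<in> projs \<Longrightarrow> f o\<^sub>L p \<in> projs"
  unfolding central_projs_def projs_def by (auto intro: comp_mem orth_proj_comp)

lemma central_comp: "f \<in> central_projs \<Longrightarrow> g \<in> central_projs \<Longrightarrow> f o\<^sub>L g \<in> central_projs"
  using central_comp_projs[of f g] unfolding central_projs_def by (auto simp: commutes_def)

lemma range_orth_proj: "orth_proj p \<Longrightarrow> x \<in> range (blinfun_apply p) \<longleftrightarrow> p x = x"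
  by (metis orth_projD(1) rangeE rangeI)

text \<open>Since \<open>N\<close> is closed under adjoints, an invariant subspace reduces every
  member of \<open>N\<close>, so its projection lies in the commutant \<open>M\<close>.\<close>

lemma proj_onto:
  assumes L: "subspace L" "closed L" and inv: "\<And>S x. S \<in> N \<Longrightarrow> x \<in> L \<Longrightarrow> blinfun_apply S x \<in> L"
  shows "\<exists>p\<in>projs. \<forall>x. p x = x \<longleftrightarrow> x \<in> L"
proof -
  obtain p where p: "orth_proj p" "range (blinfun_apply p) = L" using orth_proj_exists[OF L] by blast
  have pL: "p x = x \<longleftrightarrow> x \<in> L" for x using range_orth_proj[OF p(1)] p(2) by blast
  have "p (S (p x)) = S (p x)" if "S \<in> N" for S x
    using inv[OF that, of "p x"] pL p(2) by blast
  then have "p \<in> M" unfolding mem_iff using p(1) N_radj by (blast intro: orth_proj_commutesI)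
  with p pL show ?thesis by (auto simp: projs_def)
qed

lemma subspace_null: "subspace {x. \<forall>b\<in>B. blinfun_apply b x = 0}"
  by (simp add: subspace_def blinfun.bilinear_simps)

lemma closed_null: "closed {x. \<forall>b\<in>B. blinfun_apply b x = 0}" for B :: "'a operator set"
proof -
  have *: "{x. \<forall>b\<in>B. blinfun_apply b x = 0} = (\<Inter>b\<in>B. {x. blinfun_apply b x = 0})" by auto
  have "closed {x. blinfun_apply b x = 0}" for b :: "'a operator"
    by (intro closed_Collect_eq continuous_intros)
  then show ?thesis unfolding * by (intro closed_INT ballI)
qed

text \<open>The main source of projections below: the members of \<open>B\<close> commute with
  \<open>N\<close>, so their joint kernel is invariant under \<open>N\<close>.\<close>

lemma null_proj:
  assumes "B \<subseteq> M"
  shows "\<exists>p\<in>projs. \<forall>x. p x = x \<longleftrightarrow> (\<forall>b\<in>B. b x = 0)"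
proof -
  have "S x \<in> {x. \<forall>b\<in>B. blinfun_apply b x = 0}" if "S \<in> N" "x \<in> {x. \<forall>b\<in>B. blinfun_apply b x = 0}" for S x
  proof -
    have "b (S x) = 0" if "b \<in> B" for b
      using memD[of b S x] that \<open>S \<in> N\<close> \<open>x \<in> _\<close> assms by (auto simp: blinfun.bilinear_simps)
    then show ?thesis by blast
  qed
  from proj_onto[OF subspace_null closed_null this] show ?thesis by auto
qed

lemma central_null_proj:
  assumes B: "B \<subseteq> M" and inv: "\<And>T b x. T \<in> M \<Longrightarrow> b \<in> B \<Longrightarrow> \<forall>b\<in>B. blinfun_apply b x = 0 \<Longrightarrow> b (T x) = 0"
  shows "\<exists>f\<in>central_projs. \<forall>x. f x = x \<longleftrightarrow> (\<forall>b\<in>B. b x = 0)"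
proof -
  obtain f where f: "f \<in> projs" "\<And>x. f x = x \<longleftrightarrow> (\<forall>b\<in>B. b x = 0)" using null_proj[OF B] by blast
  have *: "f (T (f x)) = T (f x)" if "T \<in> M" for T x
  proof -
    have "\<forall>b\<in>B. b (f x) = 0" using f(2)[of "f x"] projsD(3)[OF f(1)] by simp
    then show ?thesis unfolding f(2) using inv[OF that] by blast
  qed
  have "commutes f T" if "T \<in> M" for T
    using projsD(2)[OF f(1)] *[OF that] *[OF radj_mem[OF that]] by (rule orth_proj_commutesI)
  with f show ?thesis by (auto simp: central_projs_def)
qed

text \<open>Described by its kernel: for a projection \<open>q\<close> the vectors killed by all
  \<open>q a\<close> form the orthogonal complement of \<open>M q H\<close>. All later uses ask
  whether some \<open>a\<close> in \<open>M\<close> carries a vector into \<open>q\<close>, and this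
  form answers that directly.\<close>

definition central_support :: "'a operator \<Rightarrow> 'a operator" where
  "central_support q = (SOME c. c \<in> central_projs \<and> (\<forall>x. c x = 0 \<longleftrightarrow> (\<forall>a\<in>M. q (a x) = 0)))"

lemma central_support:
  assumes q: "q \<in> M"
  shows "central_support q \<in> central_projs" and "central_support q x = 0 \<longleftrightarrow> (\<forall>a\<in>M. q (a x) = 0)"
proof -
  have "\<exists>f\<in>central_projs. \<forall>x. f x = x \<longleftrightarrow> (\<forall>b\<in>(\<lambda>a. q o\<^sub>L a) ` M. b x = 0)"
  proof (rule central_null_proj)
    show "(\<lambda>a. q o\<^sub>L a) ` M \<subseteq> M" using q by (auto intro: comp_mem)
    show "b (T x) = 0" if "T \<in> M" "b \<in> (\<lambda>a. q o\<^sub>L a) ` M" "\<forall>b\<in>(\<lambda>a. q o\<^sub>L a) ` M. blinfun_apply b x = 0" for T b x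
    proof -
      from that(2) obtain a where a: "a \<in> M" "b = q o\<^sub>L a" by blast
      have "(q o\<^sub>L (a o\<^sub>L T)) x = 0" using that(1,3) a(1) comp_mem by blast
      then show ?thesis by (simp add: a(2))
    qed
  qed
  then obtain f where f: "f \<in> central_projs" "\<And>x. f x = x \<longleftrightarrow> (\<forall>a\<in>M. q (a x) = 0)" by auto
  then have "id_blinfun - f \<in> central_projs \<and> (\<forall>x. (id_blinfun - f) x = 0 \<longleftrightarrow> (\<forall>a\<in>M. q (a x) = 0))"
    by (simp add: compl_central compl_apply_eq_0)
  then have "central_support q \<in> central_projs \<and> (\<forall>x. central_support q x = 0 \<longleftrightarrow> (\<forall>a\<in>M. q (a x) = 0))"
    unfolding central_support_def by (rule someI)
  then show "central_support q \<in> central_projs" "central_support q x = 0 \<longleftrightarrow> (\<forall>a\<in>M. q (a x) = 0)" by auto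
qed

lemma central_support_apply:
  assumes q: "q \<in> projs"
  shows "central_support q (q x) = q x" and "q (central_support q x) = q x"
proof -
  note c = central_support(1)[OF projsD(1)[OF q]]
  have "central_support q (x - central_support q x) = 0"
    using projsD(3)[OF central_projsD(1)[OF c]] by (simp add: blinfun.bilinear_simps)
  then have "q (id_blinfun (x - central_support q x)) = 0"
    unfolding central_support(2)[OF projsD(1)[OF q]] using id_mem by blast
  then show "q (central_support q x) = q x" by (simp add: blinfun.bilinear_simps)
  then show "central_support q (q x) = q x" using central_projsD(2)[OF c projsD(1)[OF q]] by simp
qed

text \<open>Countable generation by a separating set of vectors takes the place of \<open>\<sigma>\<close>-finiteness.\<close>

definition gen :: "'a operator \<Rightarrow> 'a set \<Rightarrow> bool" where
  "gen e Y \<longleftrightarrow> e \<in> projs \<and> countable Y \<and> (\<forall>y\<in>Y. e y = y) \<and>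
    (\<forall>a\<in>M. (\<forall>y\<in>Y. a y = 0) \<longrightarrow> (\<forall>x. a (e x) = 0))"

lemma genD:
  assumes "gen e Y"
  shows "e \<in> projs" "countable Y" "y \<in> Y \<Longrightarrow> e y = y"
    "a \<in> M \<Longrightarrow> (\<And>y. y \<in> Y \<Longrightarrow> a y = 0) \<Longrightarrow> a (e x) = 0"
  using assms by (auto simp: gen_def)

text \<open>\<open>e\<close> is the least projection of \<open>M\<close> fixing \<open>Y\<close>. If
  \<open>a\<close> kills \<open>Y\<close>, the projection onto the kernel of \<open>a\<close> fixes
  \<open>Y\<close>, so it dominates \<open>e\<close>, and \<open>a\<close> kills the range of
  \<open>e\<close>.\<close>

lemma gen_exists:
  assumes "countable Y"
  shows "\<exists>e. gen e Y"
proof -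
  define P where "P = {p \<in> projs. \<forall>y\<in>Y. p y = y}"
  have "(\<lambda>p. id_blinfun - p) ` P \<subseteq> M" by (auto simp: P_def projs_def intro: diff_mem id_mem)
  from null_proj[OF this] obtain e where e: "e \<in> projs" "\<And>x. e x = x \<longleftrightarrow> (\<forall>p\<in>P. p x = x)"
    by (auto simp: compl_apply_eq_0)
  have "a (e x) = 0" if "a \<in> M" "\<forall>y\<in>Y. a y = 0" for a x
  proof -
    have "{a} \<subseteq> M" using that by simp
    from null_proj[OF this] obtain p where p: "p \<in> projs" "\<And>x. p x = x \<longleftrightarrow> a x = 0" by auto
    then have "p \<in> P" using that(2) by (auto simp: P_def)
    moreover have "e (e x) = e x" by (rule projsD(3)[OF e(1)])
    ultimately have "p (e x) = e x" using e(2)[of "e x"] by auto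
    then show ?thesis using p(2) by simp
  qed
  moreover have "e y = y" if "y \<in> Y" for y unfolding e(2) using that by (simp add: P_def)
  ultimately show ?thesis using e(1) assms by (auto simp: gen_def)
qed

lemma gen_le:
  assumes "gen e Y" "q \<in> projs" "\<And>y. y \<in> Y \<Longrightarrow> q y = y"
  shows "q (e x) = e x"
proof -
  have "(id_blinfun - q) (e x) = 0"
    using assms by (intro genD(4)[OF assms(1)]) (auto simp: blinfun.bilinear_simps intro: diff_mem id_mem projsD)
  then show ?thesis by (simp add: blinfun.bilinear_simps)
qed

text \<open>If \<open>a\<close> kills \<open>p Y\<close>, then \<open>a p\<close> kills
  \<open>Y\<close> and hence the range of \<open>e\<close>; and \<open>p e = p\<close>.\<close>

lemma gen_sub:
  assumes e: "gen e Y" and p: "p \<in> projs" "\<And>x. e (p x) = p x"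
  shows "gen p (p ` Y)"
proof -
  have pe: "p (e x) = p x" for x
    using p orth_proj_le_sym[OF projsD(2)[OF genD(1)[OF e]] projsD(2)[OF p(1)]] by blast
  have "a (p x) = 0" if "a \<in> M" "\<forall>y\<in>p ` Y. a y = 0" for a x
  proof -
    have "(a o\<^sub>L p) (e x) = 0" using that p(1) by (intro genD(4)[OF e]) (auto intro: comp_mem projsD)
    then show ?thesis by (simp add: pe)
  qed
  then show ?thesis using p(1) genD(2)[OF e] projsD(3)[OF p(1)] by (auto simp: gen_def)
qed

text \<open>A countably generated projection carries a faithful weight \<open>\<phi>\<close> below, so families of
  subprojections that are closed under countable infima have a least element.\<close>

lemma least_projection:
  assumes e: "gen e Y" and F: "F \<subseteq> projs" "F \<noteq> {}" "\<And>g x. g \<in> F \<Longrightarrow> e (g x) = g x"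
    and inf: "\<And>G :: nat \<Rightarrow> 'a operator. (\<And>n. G n \<in> F) \<Longrightarrow> \<exists>g\<in>F. \<forall>n x. G n (g x) = g x"
  shows "\<exists>g\<in>F. \<forall>g'\<in>F. \<forall>x. g' (g x) = g x"
proof -
  \<comment> \<open>Inserting 0 allows an enumeration even when \<open>Y\<close> is empty.\<close>
  define y where "y = from_nat_into (insert 0 Y)"
  have y: "range y = insert 0 Y" unfolding y_def using genD(2)[OF e] by (intro range_from_nat_into) auto
  define c where "c = (\<lambda>n. (1/2)^n / (1 + (norm (y n))\<^sup>2))"
  have c: "c n > 0" for n by (simp add: c_def add_pos_nonneg)
  define \<phi> where "\<phi> = (\<lambda>g :: 'a operator. \<Sum>n. c n * (norm (g (y n)))\<^sup>2)"
  have summ: "summable (\<lambda>n. c n * (norm (g (y n)))\<^sup>2)" if "g \<in> F" for g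
  proof (rule summable_comparison_test)
    have "c n * (norm (g (y n)))\<^sup>2 \<le> (1/2)^n" for n
    proof -
      have "(norm (g (y n)))\<^sup>2 \<le> 1 + (norm (y n))\<^sup>2"
        using orth_proj_norm_le[OF projsD(2), of g "y n"] that F(1) by (smt (verit) norm_ge_zero power_mono subsetD)
      then show ?thesis unfolding c_def by (simp add: divide_simps add_pos_nonneg)
    qed
    then show "\<exists>N. \<forall>n\<ge>N. norm (c n * (norm (g (y n)))\<^sup>2) \<le> (1/2)^n"
      using c by (intro exI[of _ 0]) (simp add: abs_mult less_imp_le)
    show "summable (\<lambda>n. (1/2::real)^n)" by (rule summable_geometric) simp
  qed
  have below: "norm (g x) \<le> norm (g' x)" "g (g' x) = g x"
    if "g \<in> F" "g' \<in> F" "\<And>x. g' (g x) = g x" for g g' x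
  proof -
    have g: "orth_proj g" "orth_proj g'" using that F(1) by (auto simp: projs_def)
    show *: "g (g' x) = g x" using orth_proj_le_sym[OF g(2,1)] that(3) by blast
    show "norm (g x) \<le> norm (g' x)" using orth_proj_norm_le[OF g(1), of "g' x"] * by simp
  qed
  have mono: "c n * (norm (g (y n)))\<^sup>2 \<le> c n * (norm (g' (y n)))\<^sup>2"
    if "g \<in> F" "g' \<in> F" "\<And>x. g' (g x) = g x" for g g' n
    using below(1)[OF that] c[of n] by (simp add: mult_left_mono power_mono less_imp_le)
  have \<phi>_mono: "\<phi> g \<le> \<phi> g'" if "g \<in> F" "g' \<in> F" "\<And>x. g' (g x) = g x" for g g'
    unfolding \<phi>_def using mono[OF that] summ that by (intro suminf_le) auto
  define d where "d = Inf (\<phi> ` F)"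
  have bdd: "bdd_below (\<phi> ` F)"
    using c by (intro bdd_belowI[of _ 0]) (auto simp: \<phi>_def less_imp_le intro!: suminf_nonneg summ)
  have d_le: "d \<le> \<phi> g" if "g \<in> F" for g
    unfolding d_def using bdd that by (intro cInf_lower) auto
  have "\<exists>g\<in>F. \<phi> g < d + 1 / Suc n" for n
    using cInf_less_iff[OF _ bdd, of "d + 1 / Suc n"] F(2) unfolding d_def by fastforce
  then obtain G where G: "\<And>n. G n \<in> F" "\<And>n. \<phi> (G n) < d + 1 / Suc n" by metis
  from inf[of G, OF G(1)] obtain g where g: "g \<in> F" "\<And>n x. G n (g x) = g x" by blast
  have "\<phi> g \<le> d"
  proof (rule LIMSEQ_le_const)
    have "(\<lambda>n. d + 1 / Suc n) \<longlonglongrightarrow> d + 0"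
      by (intro tendsto_intros LIMSEQ_Suc[OF lim_1_over_n])
    then show "(\<lambda>n. d + 1 / Suc n) \<longlonglongrightarrow> d" by simp
    have "\<phi> g \<le> d + 1 / Suc n" for n
      using \<phi>_mono[OF g(1) G(1) g(2), of n] G(2)[of n] by linarith
    then show "\<exists>N. \<forall>n\<ge>N. \<phi> g \<le> d + 1 / Suc n" by blast
  qed
  have "g' (g x) = g x" if g': "g' \<in> F" for g' x
  proof -
    \<comment> \<open>The hypothesis on countable families also gives a common lower bound
      \<open>h\<close> of two members, here through the sequence
      \<open>g, g', g', ...\<close>.\<close>
    define G' where "G' = (\<lambda>n :: nat. if n = 0 then g else g')"
    have "G' n \<in> F" for n using g(1) g' by (simp add: G'_def)
    from inf[of G', OF this] obtain h where h: "h \<in> F" "\<forall>n x. G' n (h x) = h x" by blast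
    have hg: "g (h x) = h x" "g' (h x) = h x" for x
      using h(2)[rule_format, of 0 x] h(2)[rule_format, of 1 x] by (simp_all add: G'_def)
    have *: "(\<Sum>n. c n * (norm (g (y n)))\<^sup>2 - c n * (norm (h (y n)))\<^sup>2) = \<phi> g - \<phi> h"
      unfolding \<phi>_def using summ[OF g(1)] summ[OF h(1)] by (rule suminf_diff[symmetric])
    \<comment> \<open>Equal weights force equal norms termwise; as \<open>h\<close> lies below
      \<open>g\<close>, the two agree on \<open>Y\<close>, and generation extends this to all of
      \<open>e\<close>.\<close>
    have "\<phi> g - \<phi> h = 0" using \<phi>_mono[OF h(1) g(1) hg(1)] d_le[OF h(1)] \<open>\<phi> g \<le> d\<close> by simp
    then have "\<forall>n. c n * (norm (g (y n)))\<^sup>2 - c n * (norm (h (y n)))\<^sup>2 = 0"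
      using mono[OF h(1) g(1) hg(1)] * summable_diff[OF summ[OF g(1)] summ[OF h(1)]]
      by (subst suminf_eq_zero_iff[symmetric]) auto
    then have nn: "norm (h (y n)) = norm (g (y n))" for n
      using c[of n] by (simp flip: right_diff_distrib) (metis less_irrefl)
    have hy: "h (y n) = g (y n)" for n
    proof -
      have "orth_proj h" using h(1) F(1) by (auto simp: projs_def)
      then show ?thesis
        using orth_proj_norm_eq[of h "g (y n)"] nn[of n] below(2)[OF h(1) g(1) hg(1)] by metis
    qed
    have "(g - h) (e x) = 0"
    proof (rule genD(4)[OF e])
      show "g - h \<in> M" using g(1) h(1) F(1) by (auto simp: projs_def intro: diff_mem)
      show "(g - h) z = 0" if "z \<in> Y" for z
      proof -
        have "z \<in> range y" using y that by simp
        then obtain n where "z = y n" by blast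
        then show ?thesis using hy by (simp add: blinfun.bilinear_simps)
      qed
    qed
    moreover have "k (e x) = k x" if "k \<in> F" for k
      using F(1,3) that genD(1)[OF e] orth_proj_le_sym[OF projsD(2) projsD(2), of e k] by blast
    ultimately have "g x = h x" using g(1) h(1) by (simp add: blinfun.bilinear_simps)
    then show ?thesis using hg(2) by simp
  qed
  with g(1) show ?thesis by blast
qed

text \<open>By definition the central support of \<open>q\<close> is detected by all of
  \<open>M\<close>. The projections onto the joint kernels in \<open>e\<close> of countable families
  \<open>q a\<^sub>n\<close> are closed under countable infima, hence have a least member; a family
  belonging to it cannot be improved by any further element of \<open>M\<close>.\<close>

lemma countable_detection:
  assumes e: "gen e Y" and q: "q \<in> M"
  shows "\<exists>a :: nat \<Rightarrow> 'a operator. (\<forall>n. a n \<in> M) \<and>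
    (\<forall>x. e x = x \<longrightarrow> (\<forall>n. q (a n x) = 0) \<longrightarrow> central_support q x = 0)"
proof -
  define Q where "Q = (\<lambda>a :: nat \<Rightarrow> 'a operator. \<lambda>g :: 'a operator. (\<forall>n. a n \<in> M) \<and> (\<forall>x. g x = x \<longleftrightarrow> e x = x \<and> (\<forall>n. q (a n x) = 0)))"
  define F where "F = {g \<in> projs. \<exists>a. Q a g}"
  have e1: "e \<in> projs" using genD(1)[OF e] .
  have ex: "\<exists>g\<in>F. Q a g" if "\<And>n. a n \<in> M" for a
  proof -
    have "insert (id_blinfun - e) (range (\<lambda>n. q o\<^sub>L a n)) \<subseteq> M"
      using that q projsD(1)[OF e1] by (auto intro: diff_mem id_mem comp_mem)
    from null_proj[OF this] obtain g where "g \<in> projs"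
      "\<And>x. g x = x \<longleftrightarrow> e x = x \<and> (\<forall>n. q (a n x) = 0)" by (auto simp: compl_apply_eq_0)
    then show ?thesis using that unfolding F_def Q_def by blast
  qed
  have "\<exists>g\<in>F. \<forall>g'\<in>F. \<forall>x. g' (g x) = g x"
  proof (rule least_projection[OF e])
    show "F \<subseteq> projs" by (auto simp: F_def)
    show "F \<noteq> {}" using ex[of "\<lambda>_. 0"] zero_mem by auto
    show "e (g x) = g x" if "g \<in> F" for g x
      using that projsD(3)[of g x] unfolding F_def Q_def by blast
    show "\<exists>g\<in>F. \<forall>n x. G n (g x) = g x" if "\<And>n. G n \<in> F" for G :: "nat \<Rightarrow> 'a operator"
    proof -
      have "\<forall>n. \<exists>a. Q a (G n)" using that unfolding F_def by blast
      from choice[OF this] obtain a where a: "\<And>n. Q (a n) (G n)" by blast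
      \<comment> \<open>The pairing function merges countably many sequences into one, whose joint
        kernel lies below all the given ones.\<close>
      define b where "b = (\<lambda>k. a (fst (prod_decode k)) (snd (prod_decode k)))"
      have "b k \<in> M" for k using a by (simp add: b_def Q_def)
      from ex[of b, OF this] obtain g where g: "g \<in> F" "Q b g" by blast
      have "G n (g x) = g x" for n x
      proof -
        have "g (g x) = g x" using g(1) by (auto simp: F_def intro: projsD)
        then have gx: "e (g x) = g x" "\<And>k. q (b k (g x)) = 0" using g(2) unfolding Q_def by blast+
        have "q (a n m (g x)) = 0" for m using gx(2)[of "prod_encode (n, m)"] by (simp add: b_def)
        with gx(1) a[of n] show ?thesis unfolding Q_def by blast
      qed
      with g(1) show ?thesis by blast
    qed
  qed
  then obtain g where g: "g \<in> F" "\<And>g' x. g' \<in> F \<Longrightarrow> g' (g x) = g x" by blast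
  from g(1) obtain a where a: "Q a g" by (auto simp: F_def)
  have "central_support q x = 0" if "e x = x" "\<forall>n. q (a n x) = 0" for x
    unfolding central_support(2)[OF q]
  proof
    fix b assume "b \<in> M"
    with ex[of "\<lambda>_. b"] obtain g' where g': "g' \<in> F" "Q (\<lambda>_. b) g'" by blast
    have "g x = x" using a that unfolding Q_def by blast
    then have "g' x = x" using g(2)[OF g'(1), of x] by simp
    then show "q (b x) = 0" using g'(2) unfolding Q_def by blast
  qed
  with a show ?thesis unfolding Q_def by blast
qed

text \<open>Orthogonality of the ranges rules out cancellation, so the weighted sum has the
  intersection of the kernels as its kernel. This glues countably many local constructions into one
  operator; the weights make the series converge in norm.\<close>

lemma orthogonal_series:
  assumes T: "\<And>n :: nat. T n \<in> M" and orth: "\<And>m n x y. m \<noteq> n \<Longrightarrow> inner (T m x) (T n y) = 0"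
  shows "\<exists>S\<in>M. (\<forall>x. S x = 0 \<longleftrightarrow> (\<forall>n. T n x = 0)) \<and>
    (\<forall>b :: 'a operator. (\<forall>n x. b (T n x) = 0) \<longrightarrow> (\<forall>x. b (S x) = 0))"
proof -
  define w where "w = (\<lambda>n. (1/2)^n / (1 + norm (T n)))"
  have w: "w n > 0" for n by (simp add: w_def add_pos_nonneg)
  have "summable (\<lambda>n. w n *\<^sub>R T n)"
  proof (rule summable_comparison_test)
    have "norm (w n *\<^sub>R T n) \<le> (1/2)^n" for n
    proof -
      have "norm (w n *\<^sub>R T n) = (1/2)^n * (norm (T n) / (1 + norm (T n)))"
        using w[of n] by (simp add: w_def)
      also have "\<dots> \<le> (1/2)^n * 1" by (intro mult_left_mono) (simp_all add: divide_le_eq_1 add_pos_nonneg)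
      finally show ?thesis by simp
    qed
    then show "\<exists>N. \<forall>n\<ge>N. norm (w n *\<^sub>R T n) \<le> (1/2)^n" by blast
    show "summable (\<lambda>n. (1/2::real)^n)" by (rule summable_geometric) simp
  qed
  then obtain S where S: "(\<lambda>n. w n *\<^sub>R T n) sums S" by (auto simp: summable_def)
  have Sx: "(\<lambda>n. b (w n *\<^sub>R T n x)) sums b (S x)" for b :: "'a operator" and x
    using bounded_linear.sums[OF blinfun.bounded_linear_right, of _ _ b, OF
        bounded_linear.sums[OF blinfun.bounded_linear_left S, of x]]
    by (simp add: blinfun.bilinear_simps)
  have bS: "b (S x) = 0" if "\<And>n. b (T n x) = 0" for b :: "'a operator" and x
    using Sx[of b x] that by (simp add: blinfun.bilinear_simps sums_iff)
  have "commutes S R" if "R \<in> N" for R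
  proof -
    have "R (S x) = S (R x)" for x
      using sums_unique2[OF Sx[of R x], of "S (R x)"] Sx[of id_blinfun "R x"] memD[OF T that]
      by (simp add: blinfun.bilinear_simps)
    then show ?thesis by (simp add: commutes_def)
  qed
  then have "S \<in> M" by (simp add: mem_iff)
  moreover have "T m x = 0" if "S x = 0" for m x
  proof -
    \<comment> \<open>Applying \<open>radj (T m)\<close> isolates the term of index
      \<open>m\<close>.\<close>
    have z: "inner (radj (T m) (T n x)) u = 0" if "m \<noteq> n" for n u
      by (metis inner_commute inner_radj orth that)
    have "radj (T m) (T n x) = 0" if "n \<noteq> m" for n
      using z[of n "radj (T m) (T n x)"] that by auto
    then have "(\<lambda>n. radj (T m) (w n *\<^sub>R T n x)) sums radj (T m) (w m *\<^sub>R T m x)"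
      by (intro sums_finite[of "{m}", simplified]) (auto simp: blinfun.bilinear_simps)
    moreover have "(\<lambda>n. radj (T m) (w n *\<^sub>R T n x)) sums 0"
      using Sx[of "radj (T m)" x] by (simp only: \<open>S x = 0\<close> blinfun.zero_right)
    ultimately have "radj (T m) (w m *\<^sub>R T m x) = 0" by (rule sums_unique2)
    then have "w m *\<^sub>R radj (T m) (T m x) = 0" by (simp only: blinfun.scaleR_right)
    then have "radj (T m) (T m x) = 0" using w[of m] by simp
    then have "inner (T m x) (T m x) = 0" by (simp add: inner_radj)
    then show ?thesis by simp
  qed
  moreover have "S x = 0" if "\<forall>n. T n x = 0" for x using bS[of id_blinfun x] that by simp
  ultimately show ?thesis using bS by blast
qed

text \<open>The kernel condition fixes the initial projection of the polar part to be
  \<open>e\<close>, and the commutation clause of the polar decomposition places the polar part in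
  \<open>M\<close>.\<close>

lemma polar_mem:
  assumes a: "a \<in> M" and e: "e \<in> projs" and ae: "\<And>x. a x = 0 \<longleftrightarrow> e x = 0"
  shows "\<exists>v\<in>M. radj v o\<^sub>L v = e \<and> (\<forall>b :: 'a operator. (\<forall>x. b (a x) = 0) \<longrightarrow> (\<forall>x. b (v x) = 0))"
proof -
  obtain v E where E: "orth_proj E" "\<And>x. E x = x \<longleftrightarrow> a x = 0" and v: "radj v o\<^sub>L v = id_blinfun - E"
    and vb: "\<And>b :: 'a operator. (\<forall>x. b (a x) = 0) \<Longrightarrow> (\<forall>x. b (v x) = 0)"
    and vS: "\<And>S. commutes S a \<Longrightarrow> commutes S (radj a) \<Longrightarrow> commutes S v"
    using polar_decomposition[of a] by (elim exE conjE) blast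
  have "E = id_blinfun - e"
    using E(1) orth_proj_compl[OF projsD(2)[OF e]]
    by (rule orth_proj_eqI) (simp add: E(2) ae blinfun.bilinear_simps)
  moreover have "v \<in> M"
    unfolding mem_iff using vS a radj_mem[OF a] by (meson commutes_sym mem_iff)
  ultimately show ?thesis using v vb by (intro bexI[of _ v]) auto
qed

end

section \<open>Comparison of projections in type III algebras\<close>

context operator_algebra
begin

lemma partial_isometry_source:
  assumes e: "e \<in> projs" and vv: "radj v o\<^sub>L v = e"
  shows "v (e x) = v x" and "norm (v x) = norm (e x)" and "radj v (v x) = e x" and "e (radj v x) = radj v x"
proof -
  show *: "radj v (v x) = e x" for x using arg_cong[OF vv, of "\<lambda>T. T x"] by simp
  show n: "norm (v x) = norm (e x)" for x
  proof -
    have "(norm (v x))\<^sup>2 = inner (e x) x" by (simp only: norm_radj_apply_square *)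
    also have "\<dots> = (norm (e x))\<^sup>2" by (rule orth_proj_inner[OF projsD(2)[OF e]])
    finally show ?thesis by simp
  qed
  have "norm (v (x - e x)) = 0" for x by (simp only: n) (simp add: blinfun.bilinear_simps projsD(3)[OF e])
  then have "v x = v (e x)" for x
    by (simp only: norm_eq_zero blinfun.diff_right right_minus_eq)
  then show ve: "v (e x) = v x" for x by (rule sym)
  have "radj (v o\<^sub>L e) = radj v" using ve by (simp add: blinfun_eq_iff) (metis blinfun_apply_blinfun_compose blinfun_eqI radj_compose)
  then have "e o\<^sub>L radj v = radj v" by (simp add: projsD(5)[OF e])
  then show "e (radj v x) = radj v x" by (metis blinfun_apply_blinfun_compose)
qed

lemma partial_isometry_range:
  assumes e: "e \<in> projs" and v: "v \<in> M" and vv: "radj v o\<^sub>L v = e"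
  shows "v o\<^sub>L radj v \<in> projs" and "v (radj v (v x)) = v x"
    and "(\<And>x. p (v x) = v x) \<Longrightarrow> p ((v o\<^sub>L radj v) x) = (v o\<^sub>L radj v) x"
proof -
  note ps = partial_isometry_source[OF e vv]
  show *: "v (radj v (v x)) = v x" for x by (simp add: ps)
  show "v o\<^sub>L radj v \<in> projs"
    using v by (auto simp: projs_def orth_proj_iff comp_mem radj_mem blinfun_eq_iff *)
  show "p ((v o\<^sub>L radj v) x) = (v o\<^sub>L radj v) x" if "\<And>x. p (v x) = v x" using that by simp
qed

lemma partial_isometry_of_range_le:
  assumes a: "a \<in> M" and e: "e \<in> projs" and q: "q \<in> projs" and ae: "\<And>x. a x = 0 \<longleftrightarrow> e x = 0"
    and qa: "\<And>x. q (a x) = a x"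
  shows "\<exists>v\<in>M. radj v o\<^sub>L v = e \<and> (\<forall>x. q (v x) = v x)"
proof -
  from polar_mem[OF a e ae] obtain v where v: "v \<in> M" "radj v o\<^sub>L v = e"
    and b: "\<And>b :: 'a operator. (\<forall>x. b (a x) = 0) \<Longrightarrow> (\<forall>x. b (v x) = 0)" by blast
  have "q (v x) = v x" for x
    using b[of "id_blinfun - q"] qa unfolding compl_apply_eq_0 by blast
  with v show ?thesis by blast
qed

lemma central_apply_le:
  assumes "f \<in> central_projs" "e \<in> projs"
  shows "f (e x) = e (f x)" "e (f (e x)) = f (e x)" "f (f x) = f x"
  using assms central_projsD[OF assms(1)] projsD by metis+

text \<open>Up to polar decomposition, this says that \<open>g\<close> is the source of two partial isometries
  with orthogonal ranges below \<open>g\<close>; injectivity is easier to glue than isometry.\<close>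

definition halved :: "'a operator \<Rightarrow> bool" where
  "halved g \<longleftrightarrow> (\<exists>a\<in>M. \<exists>b\<in>M. \<forall>x. g (blinfun_apply a x) = a x \<and> g (blinfun_apply b x) = b x \<and> radj b (a x) = 0 \<and>
     (a x = 0 \<longleftrightarrow> g x = 0) \<and> (b x = 0 \<longleftrightarrow> g x = 0))"

lemma halved_central:
  assumes f: "f \<in> central_projs" and g: "g \<in> projs" and h: "halved g"
  shows "halved (f o\<^sub>L g)"
proof -
  from h obtain a b where ab: "a \<in> M" "b \<in> M" "\<And>x. g (a x) = a x" "\<And>x. g (b x) = b x"
    "\<And>x. radj b (a x) = 0" "\<And>x. a x = 0 \<longleftrightarrow> g x = 0" "\<And>x. b x = 0 \<longleftrightarrow> g x = 0"
    unfolding halved_def by blast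
  note c = central_projsD(2)[OF f] and ff = central_apply_le(3)[OF f g]
  have "a o\<^sub>L f \<in> M" "b o\<^sub>L f \<in> M" using ab f by (auto intro: comp_mem projsD central_projsD)
  moreover have "(f o\<^sub>L g) ((a o\<^sub>L f) x) = (a o\<^sub>L f) x \<and> (f o\<^sub>L g) ((b o\<^sub>L f) x) = (b o\<^sub>L f) x \<and>
     radj (b o\<^sub>L f) ((a o\<^sub>L f) x) = 0 \<and> ((a o\<^sub>L f) x = 0 \<longleftrightarrow> (f o\<^sub>L g) x = 0) \<and> ((b o\<^sub>L f) x = 0 \<longleftrightarrow> (f o\<^sub>L g) x = 0)" for x
    using c[OF ab(1)] c[OF ab(2)] c[OF projsD(1)[OF g]] by (simp add: ab ff blinfun.bilinear_simps)
  ultimately show ?thesis unfolding halved_def by blast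
qed

text \<open>If \<open>s\<close> is a partial isometry from \<open>e\<close> onto a proper subprojection and \<open>d = e - s s\<^sup>*\<close>, the ranges
  of the \<open>s\<^sup>n d\<close> are orthogonal copies of \<open>d\<close>; the even and the odd ones each receive the part of
  \<open>e\<close> below the central support of \<open>d\<close>.\<close>

lemma local_halving:
  assumes e: "gen e Y" and s: "s \<in> M" "radj s o\<^sub>L s = e" "e o\<^sub>L (s o\<^sub>L radj s) = s o\<^sub>L radj s" "s o\<^sub>L radj s \<noteq> e"
  shows "\<exists>f\<in>central_projs. f o\<^sub>L e \<noteq> 0 \<and> halved (f o\<^sub>L e)"
proof -
  note e1 = genD(1)[OF e]
  note ps = partial_isometry_source[OF e1 s(2)] and pr = partial_isometry_range[OF e1 s(1,2)]
  have es: "e (s x) = s x" for x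
  proof -
    have "e ((s o\<^sub>L radj s) (s x)) = (s o\<^sub>L radj s) (s x)" using s(3) by (metis blinfun_apply_blinfun_compose)
    then show ?thesis by (simp add: ps)
  qed
  define d where "d = e - (s o\<^sub>L radj s)"
  have d: "d x = e x - s (radj s x)" for x by (simp add: d_def blinfun.bilinear_simps)
  have sre: "s (radj s (e x)) = s (radj s x)" for x
    using orth_proj_le_sym[OF projsD(2)[OF e1] projsD(2)[OF pr(1)]] es by simp
  have dd: "d (d x) = d x" for x
    by (simp add: d blinfun.bilinear_simps projsD(3)[OF e1] es sre ps)
  have dproj: "d \<in> projs"
    using e1 s(1) dd by (auto simp: projs_def orth_proj_def d_def selfadj_iff intro!: diff_mem comp_mem radj_mem orth_projD)
  have ed: "e (d x) = d x" for x by (simp add: d blinfun.bilinear_simps projsD(3)[OF e1] es)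
  have ds: "inner (d x) (s y) = 0" for x y
  proof -
    have "d (s y) = 0" by (simp add: d es ps)
    then show ?thesis using projsD(4)[OF dproj, of x "s y"] by (simp only: inner_zero_right)
  qed
  note orth = shift_orthogonal[OF s(2) es ed ds]
  have dM: "d \<in> M" using projsD(1)[OF dproj] .
  from countable_detection[OF e dM] obtain a where *: "\<forall>n :: nat. a n \<in> M"
    "\<forall>x. e x = x \<longrightarrow> (\<forall>n. d (a n x) = 0) \<longrightarrow> central_support d x = 0" by (elim exE conjE)
  note a = *(1)[rule_format] *(2)[rule_format]
  define f where "f = central_support d"
  have f: "f \<in> central_projs" using central_support(1)[OF dM] by (simp add: f_def)
  define g where "g = f o\<^sub>L e"
  have g: "g \<in> projs" unfolding g_def using f e1 by (rule central_comp_projs)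
  have gx: "g x = f (e x)" for x by (simp add: g_def)
  note cf = central_projsD(2)[OF f]
  have ggx: "e (g x) = g x" "f (g x) = g x" for x
    using cf[OF projsD(1)[OF e1]] projsD(3)[OF e1] projsD(3)[OF central_projsD(1)[OF f]] by (simp_all add: gx)
  \<comment> \<open>The parity \<open>i\<close> separates the two families: \<open>i = 0\<close>
    takes even and \<open>i = 1\<close> odd powers of \<open>s\<close>. Each power carries one of
    the operators \<open>a n\<close> that detect the central support of \<open>d\<close>, so the sum
    over \<open>n\<close> is injective on the part of \<open>e\<close> below that support.\<close>
  define T where "T = (\<lambda>i n. opow s (2 * n + i) o\<^sub>L (d o\<^sub>L a n))"
  have TM: "T i n \<in> M" for i n using s(1) dM a(1) by (simp add: T_def comp_mem opow_mem)
  have Torth: "inner (T i m x) (T j n y) = 0" if "2 * m + i \<noteq> 2 * n + j" for i j m n x y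
    using that by (simp add: T_def orth(1))
  have Tnorm: "T i n x = 0 \<longleftrightarrow> d (a n x) = 0" for i n x
  proof -
    have "inner (T i n x) (T i n x) = inner (d (a n x)) (d (a n x))" by (simp add: T_def orth(1))
    then show ?thesis by (metis inner_eq_zero_iff)
  qed
  have "\<forall>i. \<exists>S. S \<in> M \<and> (\<forall>x. S x = 0 \<longleftrightarrow> (\<forall>n. T i n x = 0)) \<and>
      (\<forall>b :: 'a operator. (\<forall>n x. b (T i n x) = 0) \<longrightarrow> (\<forall>x. b (S x) = 0))"
    using orthogonal_series[OF TM] Torth by (simp add: Bex_def)
  from choice[OF this] obtain S where *: "\<forall>i. S i \<in> M \<and> (\<forall>x. S i x = 0 \<longleftrightarrow> (\<forall>n. T i n x = 0)) \<and>
      (\<forall>b :: 'a operator. (\<forall>n x. b (T i n x) = 0) \<longrightarrow> (\<forall>x. b (S i x) = 0))" by (elim exE)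
  note S = *[THEN spec, THEN conjunct1] *[THEN spec, THEN conjunct2, THEN conjunct1, rule_format]
    *[THEN spec, THEN conjunct2, THEN conjunct2, rule_format]
  have eS: "e (S i x) = S i x" for i x
  proof -
    have "(id_blinfun - e) (T i n x) = 0" for n x by (simp add: compl_apply_eq_0 T_def orth(2))
    then show ?thesis using S(3)[of "id_blinfun - e" i x] by (simp add: compl_apply_eq_0)
  qed
  \<comment> \<open>A series is only known to be annihilated when all its terms are. Orthogonality
    is therefore passed from the terms to the sums one factor at a time, with an adjoint taken in
    between.\<close>
  have S10: "radj (S 1) (S 0 x) = 0" for x
  proof -
    have z: "radj (T 1 m) (S 0 x) = 0" for m x
    proof (rule S(3))
      fix n y
      have "2 * n + 0 \<noteq> 2 * m + (1::nat)" by presburger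
      then have "inner (radj (T 1 m) (T 0 n y)) w = 0" for w
        by (simp only: inner_radj') (metis Torth)
      then show "radj (T 1 m) (T 0 n y) = 0" by (metis inner_eq_zero_iff)
    qed
    have "inner (radj (S 0) (T 1 m y)) w = 0" for m y w
      using z[of m w] by (metis inner_commute inner_radj inner_zero_right)
    then have "radj (S 0) (T 1 m y) = 0" for m y by (metis inner_eq_zero_iff)
    then have "radj (S 0) (S 1 w) = 0" for w by (rule S(3))
    then have "inner (radj (S 1) (S 0 x)) w = 0" for w by (metis inner_commute inner_radj inner_zero_right)
    then show ?thesis by (metis inner_eq_zero_iff)
  qed
  have ker: "S i (g x) = 0 \<longleftrightarrow> g x = 0" for i x
  proof
    assume "S i (g x) = 0"
    then have "\<forall>n. T i n (g x) = 0" using S(2) by blast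
    then have "central_support d (g x) = 0" by (intro a(2) ggx(1)) (simp add: Tnorm)
    then show "g x = 0" using ggx(2) by (simp add: f_def)
  qed (simp add: blinfun.bilinear_simps)
  have gS: "g (S i (g x)) = S i (g x)" for i x
    using cf[OF S(1)] ggx by (simp add: gx[of "S i (g x)"] eS)
  have "radj (S 1 o\<^sub>L g) ((S 0 o\<^sub>L g) x) = 0" for x
    by (simp add: S10 blinfun.bilinear_simps del: One_nat_def)
  then have "\<forall>x. g ((S 0 o\<^sub>L g) x) = (S 0 o\<^sub>L g) x \<and> g ((S 1 o\<^sub>L g) x) = (S 1 o\<^sub>L g) x \<and>
    radj (S 1 o\<^sub>L g) ((S 0 o\<^sub>L g) x) = 0 \<and> ((S 0 o\<^sub>L g) x = 0 \<longleftrightarrow> g x = 0) \<and> ((S 1 o\<^sub>L g) x = 0 \<longleftrightarrow> g x = 0)"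
    by (simp add: gS ker)
  then have "halved g"
    unfolding halved_def using S(1) g by (meson comp_mem projsD(1))
  moreover have "g \<noteq> 0"
  proof
    assume "g = 0"
    then have "f (e (d x)) = 0" for x using gx[of "d x"] by simp
    then have "d x = 0" for x using central_support_apply(1)[OF dproj, of x] ed by (simp add: f_def)
    then have "e x = (s o\<^sub>L radj s) x" for x by (simp add: d)
    then show False using s(4) by (metis blinfun_eqI)
  qed
  ultimately show ?thesis using f unfolding g_def by blast
qed

text \<open>\<open>c n\<close> is the part outside the first \<open>n\<close> projections, the
  product of the complements, and \<open>k n\<close> is what \<open>f n\<close> adds to the earlier
  ones. The finite sums of the \<open>k n\<close> telescope.\<close>

lemma central_disjointify:
  assumes f: "\<And>n :: nat. f n \<in> central_projs"
  shows "\<exists>c k. (\<forall>n. c n \<in> central_projs) \<and> (\<forall>n. k n \<in> central_projs) \<and> (\<forall>n x. k n x = f n (c n x)) \<and>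
    (\<forall>m n x. m \<noteq> n \<longrightarrow> k m (k n x) = 0) \<and> (\<forall>n x. (\<Sum>j<n. k j x) + c n x = x) \<and>
    (\<forall>m n x. m < n \<longrightarrow> c n (f m x) = 0)"
proof -
  define c where "c = rec_nat id_blinfun (\<lambda>n c. (id_blinfun - f n) o\<^sub>L c)"
  have c0: "c 0 = id_blinfun" and cS: "c (Suc n) = (id_blinfun - f n) o\<^sub>L c n" for n by (simp_all add: c_def)
  have c: "c n \<in> central_projs" for n
    by (induction n) (simp_all only: c0 cS id_central compl_central f central_comp)
  have fc: "f m (c n x) = c n (f m x)" for m n x
    using central_projsD(2)[OF f projsD(1)[OF central_projsD(1)[OF c]]] .
  have ff: "f n (f n x) = f n x" for n x using projsD(3)[OF central_projsD(1)[OF f]] .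
  have cf: "c n (f m x) = 0" if "m < n" for m n x
    using that
  proof (induction n)
    case (Suc n)
    show ?case
    proof (cases "m = n")
      case True
      then show ?thesis by (simp add: cS blinfun.bilinear_simps ff flip: fc)
    next
      case False
      with Suc have "c n (f m x) = 0" by simp
      then show ?thesis by (simp add: cS blinfun.bilinear_simps)
    qed
  qed simp
  define k where "k = (\<lambda>n. c n o\<^sub>L f n)"
  have k: "k n \<in> central_projs" for n unfolding k_def using c f by (rule central_comp)
  have kk: "k m (k n x) = 0" if "m \<noteq> n" for m n x
  proof (cases "m < n")
    case True
    then show ?thesis using cf[OF True] by (simp add: k_def fc)
  next
    case False
    then have "n < m" using that by simp
    have "c m (c n (f n x)) = c n (c m (f n x))"
      using central_projsD(2)[OF c projsD(1)[OF central_projsD(1)[OF c]]] .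
    then have "c m (c n (f n x)) = 0" by (simp add: cf[OF \<open>n < m\<close>] blinfun.bilinear_simps)
    then show ?thesis by (simp add: k_def blinfun.bilinear_simps flip: fc)
  qed
  have sum: "(\<Sum>j<n. k j x) + c n x = x" for n x
    by (induction n) (simp_all add: c0 cS k_def fc blinfun.bilinear_simps)
  have kx: "k n x = f n (c n x)" for n x by (simp add: k_def fc)
  show ?thesis
    by (rule exI[of _ c], rule exI[of _ k], intro conjI allI impI)
      (rule c k kx sum | erule kk cf)+
qed

text \<open>Countable joins of halved pieces are the infima that \<open>least_projection\<close>
  asks for in \<open>halved_gen\<close>. Once the pieces are made disjoint, their operators have
  orthogonal ranges, and \<open>orthogonal_series\<close> sums them without losing
  injectivity.\<close>

lemma halved_countable_join:
  assumes e: "e \<in> projs" and f: "\<And>n :: nat. f n \<in> central_projs" and h: "\<And>n. halved (f n o\<^sub>L e)"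
  shows "\<exists>g\<in>central_projs. halved (g o\<^sub>L e) \<and> (\<forall>n x. f n (g x) = f n x)"
proof -
  from central_disjointify[of f, OF f] obtain c k where *: "\<forall>n. c n \<in> central_projs" "\<forall>n. k n \<in> central_projs"
    "\<forall>n x. k n x = f n (c n x)" "\<forall>m n x. m \<noteq> n \<longrightarrow> k m (k n x) = 0" "\<forall>n x. (\<Sum>j<n. k j x) + c n x = x"
    "\<forall>m n x. m < n \<longrightarrow> c n (f m x) = 0" by (elim exE conjE)
  note c = *(1)[rule_format] and k = *(2)[rule_format] and kx = *(3)[rule_format] and kk = *(4)[rule_format]
    and sum = *(5)[rule_format]
  have fc: "f m (c n x) = c n (f m x)" for m n x
    using central_projsD(2)[OF f projsD(1)[OF central_projsD(1)[OF c]]] .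
  have kf: "(\<forall>n. k n x = 0) \<longleftrightarrow> (\<forall>n. f n x = 0)" for x
  proof
    assume k0: "\<forall>n. k n x = 0"
    then have "c n x = x" for n using sum[of x n] by simp
    then show "\<forall>n. f n x = 0" using k0 kx by metis
  qed (simp add: kx fc blinfun.bilinear_simps)
  have "\<exists>a b. a \<in> M \<and> b \<in> M \<and> (\<forall>x. (k n o\<^sub>L e) (a x) = a x \<and> (k n o\<^sub>L e) (b x) = b x \<and> radj b (a x) = 0 \<and>
     (a x = 0 \<longleftrightarrow> (k n o\<^sub>L e) x = 0) \<and> (b x = 0 \<longleftrightarrow> (k n o\<^sub>L e) x = 0))" for n
  proof -
    have "halved (c n o\<^sub>L (f n o\<^sub>L e))"
      using c central_comp_projs[OF f e] h by (rule halved_central)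
    moreover have "c n o\<^sub>L (f n o\<^sub>L e) = k n o\<^sub>L e" by (simp add: kx fc blinfun_eq_iff)
    ultimately show ?thesis unfolding halved_def by auto
  qed
  then obtain a b where ab: "\<And>n. a n \<in> M" "\<And>n. b n \<in> M" "\<And>n x. k n (e (a n x)) = a n x" "\<And>n x. k n (e (b n x)) = b n x"
     "\<And>n x. radj (b n) (a n x) = 0" "\<And>n x. a n x = 0 \<longleftrightarrow> k n (e x) = 0" "\<And>n x. b n x = 0 \<longleftrightarrow> k n (e x) = 0"
    by simp metis
  have ke: "k n (e x) = e (k n x)" for n x using central_projsD(2)[OF k projsD(1)[OF e]] .
  have kidem: "k n (k n x) = k n x" for n x using projsD(3)[OF central_projsD(1)[OF k]] .
  have ka: "k n (a n x) = a n x" "k n (b n x) = b n x" for n x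
    by (metis ab(3) kidem, metis ab(4) kidem)
  have ea: "e (a n x) = a n x" "e (b n x) = b n x" for n x
    by (metis ab(3) ke projsD(3)[OF e], metis ab(4) ke projsD(3)[OF e])
  have k_inner: "inner (k m x) (k n y) = 0" if "m \<noteq> n" for m n x y
    using projsD(4)[OF central_projsD(1)[OF k], of m x "k n y"] kk[OF that] by simp
  have orth: "inner (a m x) (a n y) = 0" "inner (b m x) (b n y) = 0" "inner (a m x) (b n y) = 0" if "m \<noteq> n" for m n x y
    using k_inner[OF that, of "a m x" "a n y"] k_inner[OF that, of "b m x" "b n y"] k_inner[OF that, of "a m x" "b n y"]
    by (simp_all only: ka)
  have "\<exists>S\<in>M. (\<forall>x. S x = 0 \<longleftrightarrow> (\<forall>n. a n x = 0)) \<and>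
      (\<forall>d :: 'a operator. (\<forall>n x. d (a n x) = 0) \<longrightarrow> (\<forall>x. d (S x) = 0))"
    by (rule orthogonal_series[OF ab(1)]) (rule orth(1))
  then obtain A where *: "A \<in> M" "\<forall>x. A x = 0 \<longleftrightarrow> (\<forall>n. a n x = 0)"
    "\<forall>d :: 'a operator. (\<forall>n x. d (a n x) = 0) \<longrightarrow> (\<forall>x. d (A x) = 0)" by (elim bexE conjE)
  note A = *(1) *(2)[rule_format] *(3)[rule_format]
  have "\<exists>S\<in>M. (\<forall>x. S x = 0 \<longleftrightarrow> (\<forall>n. b n x = 0)) \<and>
      (\<forall>d :: 'a operator. (\<forall>n x. d (b n x) = 0) \<longrightarrow> (\<forall>x. d (S x) = 0))"
    by (rule orthogonal_series[OF ab(2)]) (rule orth(2))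
  then obtain B where *: "B \<in> M" "\<forall>x. B x = 0 \<longleftrightarrow> (\<forall>n. b n x = 0)"
    "\<forall>d :: 'a operator. (\<forall>n x. d (b n x) = 0) \<longrightarrow> (\<forall>x. d (B x) = 0)" by (elim bexE conjE)
  note B = *(1) *(2)[rule_format] *(3)[rule_format]
  have "range f \<subseteq> M" using f by (auto intro: projsD central_projsD)
  moreover have "d (T x) = 0" if "T \<in> M" "d \<in> range f" "\<forall>d\<in>range f. blinfun_apply d x = 0" for T d x
  proof -
    from that(2) obtain n where "d = f n" by blast
    then show ?thesis using that central_projsD(2)[OF f that(1)] by (simp add: blinfun.bilinear_simps)
  qed
  \<comment> \<open>\<open>g'\<close> projects onto the joint kernel of the \<open>f n\<close>; its
    complement is their join.\<close>
  ultimately obtain g' where g': "g' \<in> central_projs" "\<And>x. g' x = x \<longleftrightarrow> (\<forall>n. f n x = 0)"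
    using central_null_proj[of "range f"] by auto
  define g where "g = id_blinfun - g'"
  have g: "g \<in> central_projs" unfolding g_def by (rule compl_central[OF g'(1)])
  have g0: "g x = 0 \<longleftrightarrow> (\<forall>n. f n x = 0)" for x using g'(2)[of x] by (simp only: g_def compl_apply_eq_0)
  have fg: "f n (g x) = f n x" for n x
  proof -
    have "g (x - g x) = 0"
      using projsD(3)[OF central_projsD(1)[OF g]] by (simp add: blinfun.bilinear_simps)
    then have "f n (x - g x) = 0" unfolding g0 by blast
    then show ?thesis by (simp add: blinfun.bilinear_simps)
  qed
  have gk: "g (k n x) = k n x" for n x
  proof -
    have "g (f n x) = f n x"
      using central_projsD(2)[OF f projsD(1)[OF central_projsD(1)[OF g]], of n x] fg by simp
    moreover note kx[of n x]
    moreover have "g (f n y) = f n y" for y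
      using central_projsD(2)[OF f projsD(1)[OF central_projsD(1)[OF g]], of n y] fg by simp
    ultimately show ?thesis by simp
  qed
  have ga: "(g o\<^sub>L e) (a n x) = a n x" "(g o\<^sub>L e) (b n x) = b n x" for n x
    using gk[of n "a n x"] gk[of n "b n x"] by (simp_all add: ka ea)
  have "halved (g o\<^sub>L e)"
    unfolding halved_def
  proof (rule bexI[of _ A], rule bexI[of _ B], intro allI conjI)
    show "A \<in> M" "B \<in> M" using A B by auto
    show "(g o\<^sub>L e) (A x) = A x" for x
    proof -
      have "(id_blinfun - (g o\<^sub>L e)) (a n x) = 0" for n x using ga by (simp only: compl_apply_eq_0)
      then have "(id_blinfun - (g o\<^sub>L e)) (A x) = 0" by (rule A(3))
      then show ?thesis by (simp only: compl_apply_eq_0)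
    qed
    show "(g o\<^sub>L e) (B x) = B x" for x
    proof -
      have "(id_blinfun - (g o\<^sub>L e)) (b n x) = 0" for n x using ga by (simp only: compl_apply_eq_0)
      then have "(id_blinfun - (g o\<^sub>L e)) (B x) = 0" by (rule B(3))
      then show ?thesis by (simp only: compl_apply_eq_0)
    qed
    have "g (e x) = 0 \<longleftrightarrow> (\<forall>n. k n (e x) = 0)" for x unfolding g0 kf ..
    then show "A x = 0 \<longleftrightarrow> (g o\<^sub>L e) x = 0" "B x = 0 \<longleftrightarrow> (g o\<^sub>L e) x = 0" for x
      by (simp_all add: A B ab)
    show "radj B (A x) = 0" for x
    proof -
      have "inner (a m y) (b n z) = 0" for m n y z
      proof (cases "m = n")
        case True
        have "inner (radj (b n) (a n y)) z = inner (a n y) (b n z)" by (rule inner_radj')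
        then show ?thesis using True ab(5)[of n y] by simp
      qed (rule orth(3))
      then have "inner (radj (b n) (a m y)) w = 0" for m n y w by (simp only: inner_radj')
      then have "radj (b n) (a m y) = 0" for m n y by (metis inner_eq_zero_iff)
      then have "radj (b n) (A y) = 0" for n y by (rule A(3))
      then have "inner (radj A (b n z)) y = 0" for n y z
        by (metis inner_commute inner_radj inner_zero_right)
      then have "radj A (b n z) = 0" for n z by (metis inner_eq_zero_iff)
      then have "radj A (B z) = 0" for z by (rule B(3))
      then have "inner (radj B (A x)) y = 0" for y by (metis inner_commute inner_radj inner_zero_right)
      then show ?thesis by (metis inner_eq_zero_iff)
    qed
  qed
  with g fg show ?thesis by blast
qed

end

lemma opow_Suc_right: "opow s (Suc n) = opow s n o\<^sub>L s"
  by (induction n) (simp_all add: blinfun_eq_iff)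

text \<open>The assumption is the failure of finiteness for every nonzero projection, written with
  \<open>radj\<close> so that the comparison theory stays on the real Hilbert space.\<close>

locale type_III_algebra = operator_algebra +
  assumes infinite: "p \<in> projs \<Longrightarrow> p \<noteq> 0 \<Longrightarrow>
    \<exists>v\<in>M. radj v o\<^sub>L v = p \<and> p o\<^sub>L (v o\<^sub>L radj v) = v o\<^sub>L radj v \<and> v o\<^sub>L radj v \<noteq> p"
begin

text \<open>Exhaustion: if the part of \<open>e\<close> outside a maximal halved central piece were nonzero,
  local halving would enlarge the piece.\<close>

lemma halved_gen:
  assumes e: "gen e Y"
  shows "halved e"
proof -
  note e1 = genD(1)[OF e]
  \<comment> \<open>Complements are collected, so that a least member of \<open>F\<close>
    corresponds to a maximal halved piece.\<close>
  define F where "F = {g. \<exists>f\<in>central_projs. g = (id_blinfun - f) o\<^sub>L e \<and> halved (f o\<^sub>L e)}"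
  have "\<exists>g\<in>F. \<forall>g'\<in>F. \<forall>x. g' (g x) = g x"
  proof (rule least_projection[OF e])
    show "F \<subseteq> projs" using central_comp_projs[OF compl_central e1] by (auto simp: F_def)
    have "halved (0 o\<^sub>L e)" unfolding halved_def using zero_mem by (intro bexI[of _ 0]) auto
    then have "(id_blinfun - 0) o\<^sub>L e \<in> F" unfolding F_def using zero_central by blast
    then show "F \<noteq> {}" by blast
    show "e (g x) = g x" if "g \<in> F" for g x
    proof -
      from that obtain f where "f \<in> central_projs" "g = (id_blinfun - f) o\<^sub>L e" by (auto simp: F_def)
      then show ?thesis using central_apply_le(2)[OF compl_central e1] by simp
    qed
    show "\<exists>g\<in>F. \<forall>n x. G n (g x) = g x" if G: "\<And>n. G n \<in> F" for G :: "nat \<Rightarrow> 'a operator"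
    proof -
      have "\<forall>n. \<exists>f. f \<in> central_projs \<and> G n = (id_blinfun - f) o\<^sub>L e \<and> halved (f o\<^sub>L e)"
        using G by (auto simp: F_def)
      from choice[OF this] obtain f where f: "\<And>n. f n \<in> central_projs" "\<And>n. G n = (id_blinfun - f n) o\<^sub>L e"
        "\<And>n. halved (f n o\<^sub>L e)" by blast
      from halved_countable_join[of e f, OF e1 f(1,3)] obtain g where g: "g \<in> central_projs" "halved (g o\<^sub>L e)"
        "\<And>n x. f n (g x) = f n x" by blast
      have "G n (((id_blinfun - g) o\<^sub>L e) x) = ((id_blinfun - g) o\<^sub>L e) x" for n x
      proof -
        note ce = central_apply_le(2)[OF compl_central[OF g(1)] e1, of x]
        have "f n ((id_blinfun - g) (e x)) = 0" by (simp add: blinfun.bilinear_simps g(3))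
        then have "G n ((id_blinfun - g) (e x)) = (id_blinfun - g) (e x)"
          unfolding f(2) blinfun_apply_blinfun_compose ce by (simp only: blinfun.diff_left id_blinfun.rep_eq id_apply diff_zero)
        then show ?thesis by simp
      qed
      moreover have "(id_blinfun - g) o\<^sub>L e \<in> F" using g by (auto simp: F_def)
      ultimately show ?thesis by blast
    qed
  qed
  then obtain g where gF: "g \<in> F" and least: "\<And>g' x. g' \<in> F \<Longrightarrow> g' (g x) = g x" by blast
  from gF obtain f where f: "f \<in> central_projs" "g = (id_blinfun - f) o\<^sub>L e" "halved (f o\<^sub>L e)"
    by (auto simp: F_def)
  have g: "g \<in> projs" unfolding f(2) using central_comp_projs[OF compl_central[OF f(1)] e1] .
  have eg: "e (g x) = g x" for x unfolding f(2) using central_apply_le(2)[OF compl_central[OF f(1)] e1] by simp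
  show ?thesis
  proof (cases "g = 0")
    case True
    then have "(id_blinfun - f) (e x) = 0" for x using f(2) by (metis blinfun_apply_blinfun_compose zero_blinfun.rep_eq)
    then have "f o\<^sub>L e = e" by (simp add: compl_apply_eq_0 blinfun_eq_iff)
    then show ?thesis using f(3) by simp
  next
    case False
    from infinite[OF g this] obtain s where s: "s \<in> M" "radj s o\<^sub>L s = g" "g o\<^sub>L (s o\<^sub>L radj s) = s o\<^sub>L radj s"
      "s o\<^sub>L radj s \<noteq> g" by blast
    from local_halving[OF gen_sub[OF e g eg] s] obtain f' where f': "f' \<in> central_projs" "f' o\<^sub>L g \<noteq> 0" "halved (f' o\<^sub>L g)"
      by blast
    define k where "k = f' o\<^sub>L (id_blinfun - f)"
    have k: "k \<in> central_projs" unfolding k_def using f'(1) compl_central[OF f(1)] by (rule central_comp)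
    have "k o\<^sub>L e = f' o\<^sub>L g" by (simp add: k_def f(2) blinfun_eq_iff)
    then have "(id_blinfun - k) o\<^sub>L e \<in> F" using k f'(3) by (auto simp: F_def)
    \<comment> \<open>\<open>g\<close> lies below every member of \<open>F\<close>, in particular
      below the complement of the new piece \<open>k\<close>. This gives \<open>k g = 0\<close>,
      although \<open>k g = f' g\<close> is nonzero.\<close>
    from least[OF this] have "(id_blinfun - k) (g x) = g x" for x using eg by simp
    then have kg: "k (g x) = 0" for x by (simp add: blinfun.bilinear_simps)
    have "(id_blinfun - f) (g x) = g x" for x
      unfolding f(2) using central_apply_le(3)[OF compl_central[OF f(1)] e1] by simp
    then have "f' (g x) = 0" for x using kg[of x] by (simp add: k_def)
    then have "f' o\<^sub>L g = 0" by (simp add: blinfun_eq_iff)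
    with f'(2) show ?thesis by simp
  qed
qed

text \<open>The polar parts \<open>s\<close> and \<open>d\<close> of the two halves embed
  \<open>e\<close> isometrically into itself with orthogonal ranges, so \<open>s\<^sup>n d\<close>
  gives infinitely many orthogonal copies of the whole of \<open>e\<close>.\<close>

lemma orthogonal_copies:
  assumes e: "gen e Y"
  shows "\<exists>t :: nat \<Rightarrow> 'a operator. (\<forall>n. t n \<in> M \<and> radj (t n) o\<^sub>L t n = e) \<and> (\<forall>n x. e (t n x) = t n x) \<and>
    (\<forall>m n x y. m \<noteq> n \<longrightarrow> inner (t m x) (t n y) = 0)"
proof -
  note e1 = genD(1)[OF e]
  from halved_gen[OF e] obtain a b where ab: "a \<in> M" "b \<in> M" "\<And>x. e (a x) = a x" "\<And>x. e (b x) = b x"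
    "\<And>x. radj b (a x) = 0" "\<And>x. a x = 0 \<longleftrightarrow> e x = 0" "\<And>x. b x = 0 \<longleftrightarrow> e x = 0"
    unfolding halved_def by blast
  from polar_mem[OF ab(1) e1 ab(6)] obtain s where *: "s \<in> M" "radj s o\<^sub>L s = e"
    "\<forall>c :: 'a operator. (\<forall>x. c (a x) = 0) \<longrightarrow> (\<forall>x. c (s x) = 0)" by (elim bexE conjE)
  note s = *(1,2) *(3)[rule_format]
  from polar_mem[OF ab(2) e1 ab(7)] obtain d where *: "d \<in> M" "radj d o\<^sub>L d = e"
    "\<forall>c :: 'a operator. (\<forall>x. c (b x) = 0) \<longrightarrow> (\<forall>x. c (d x) = 0)" by (elim bexE conjE)
  note d = *(1,2) *(3)[rule_format]
  have es: "e (s x) = s x" and ed: "e (d x) = d x" for x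
    using s(3)[of "id_blinfun - e"] d(3)[of "id_blinfun - e"] ab(3,4) unfolding compl_apply_eq_0 by blast+
  have "radj b (s x) = 0" for x using s(3) ab(5) .
  then have "inner (radj s (b x)) y = 0" for x y by (metis inner_commute inner_radj inner_zero_right)
  then have "radj s (b x) = 0" for x by (metis inner_eq_zero_iff)
  then have "radj s (d x) = 0" for x by (rule d(3))
  then have ds: "inner (d x) (s y) = 0" for x y by (metis inner_radj' inner_zero_left)
  note orth = shift_orthogonal[OF s(2) es ed ds]
  have "radj (opow s n o\<^sub>L d) o\<^sub>L (opow s n o\<^sub>L d) = e" for n
  proof -
    have "inner (radj (opow s n o\<^sub>L d) ((opow s n o\<^sub>L d) x)) y = inner (e x) y" for x y
    proof -
      have "inner (radj (opow s n o\<^sub>L d) ((opow s n o\<^sub>L d) x)) y = inner (d x) (d y)"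
        unfolding inner_radj' by (simp add: orth(1))
      also have "\<dots> = inner (radj d (d x)) y" by (simp only: inner_radj')
      finally show ?thesis using d(2) by (metis blinfun_apply_blinfun_compose)
    qed
    then have "inner y (radj (opow s n o\<^sub>L d) ((opow s n o\<^sub>L d) x)) = inner y (e x)" for x y
      by (simp only: inner_commute[of y])
    then have "radj (opow s n o\<^sub>L d) ((opow s n o\<^sub>L d) x) = e x" for x by (rule inner_eqI)
    then show ?thesis by (intro blinfun_eqI) simp
  qed
  then show ?thesis
    using orth s(1) d(1) by (intro exI[of _ "\<lambda>n. opow s n o\<^sub>L d"]) (simp add: comp_mem opow_mem)
qed

text \<open>Countably many \<open>q a\<^sub>n\<close> separate \<open>p\<close>; sending their ranges to orthogonal copies and summing gives an
  operator that is injective on \<open>p\<close>, whose polar part is the embedding.\<close>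

lemma embedding:
  assumes p: "gen p Y" and q: "q \<in> projs" and pq: "\<And>x. central_support q (p x) = p x"
  shows "\<exists>v\<in>M. radj v o\<^sub>L v = p \<and> (\<forall>x. q (v x) = v x)"
proof -
  note p1 = genD(1)[OF p] and qM = projsD(1)[OF q]
  from countable_detection[OF p qM] obtain a where *: "\<forall>n :: nat. a n \<in> M"
    "\<forall>x. p x = x \<longrightarrow> (\<forall>n. q (a n x) = 0) \<longrightarrow> central_support q x = 0" by (elim exE conjE)
  note a = *(1)[rule_format] *(2)[rule_format]
  have "countable (\<Union>n. (\<lambda>y. q (a n y)) ` Y)" using genD(2)[OF p] by auto
  \<comment> \<open>\<open>e\<close> is the part of \<open>q\<close> reached by the vectors
    \<open>q (a n y)\<close>. Being countably generated, it has orthogonal copies below itself and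
    hence below \<open>q\<close>, whatever the size of \<open>q\<close>.\<close>
  from gen_exists[OF this] obtain e where e: "gen e (\<Union>n. (\<lambda>y. q (a n y)) ` Y)" by blast
  note e1 = genD(1)[OF e]
  have qe: "q (e x) = e x" for x
    using e q by (rule gen_le) (auto simp: projsD(3)[OF q])
  have eqa: "e (q (a n (p x))) = q (a n (p x))" for n x
  proof -
    have "(id_blinfun - e) y = 0" if "y \<in> (\<Union>n. (\<lambda>y. q (a n y)) ` Y)" for y
      unfolding compl_apply_eq_0 using genD(3)[OF e that] .
    moreover have "(id_blinfun - e) o\<^sub>L (q o\<^sub>L a n) \<in> M"
      by (intro comp_mem diff_mem id_mem projsD(1)[OF e1] qM a(1))
    ultimately have "((id_blinfun - e) o\<^sub>L (q o\<^sub>L a n)) (p x) = 0"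
      by (intro genD(4)[OF p]) auto
    then show ?thesis unfolding blinfun_apply_blinfun_compose compl_apply_eq_0 .
  qed
  from orthogonal_copies[OF e] obtain t :: "nat \<Rightarrow> 'a operator" where *: "\<forall>n. t n \<in> M \<and> radj (t n) o\<^sub>L t n = e"
    "\<forall>n x. e (t n x) = t n x" "\<forall>m n x y. m \<noteq> n \<longrightarrow> inner (t m x) (t n y) = 0" by (elim exE conjE)
  note t = *(1)[THEN spec, THEN conjunct1] *(1)[THEN spec, THEN conjunct2] *(2,3)[rule_format]
  define T where "T = (\<lambda>n. t n o\<^sub>L (q o\<^sub>L (a n o\<^sub>L p)))"
  have T: "T n x = t n (q (a n (p x)))" for n x by (simp add: T_def)
  have T0: "T n x = 0 \<longleftrightarrow> q (a n (p x)) = 0" for n x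
    using partial_isometry_source(2)[OF e1 t(2), of n "q (a n (p x))"] by (simp add: T eqa) (metis norm_eq_zero)
  have TM: "T n \<in> M" for n unfolding T_def by (intro comp_mem t(1) qM a(1) projsD(1)[OF p1])
  have "\<exists>S\<in>M. (\<forall>x. S x = 0 \<longleftrightarrow> (\<forall>n. T n x = 0)) \<and>
      (\<forall>b :: 'a operator. (\<forall>n x. b (T n x) = 0) \<longrightarrow> (\<forall>x. b (S x) = 0))"
    by (rule orthogonal_series[OF TM]) (simp add: T t(4))
  then obtain S where *: "S \<in> M" "\<forall>x. S x = 0 \<longleftrightarrow> (\<forall>n. T n x = 0)"
    "\<forall>b :: 'a operator. (\<forall>n x. b (T n x) = 0) \<longrightarrow> (\<forall>x. b (S x) = 0)" by (elim bexE conjE)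
  note S = *(1) *(2)[rule_format] *(3)[rule_format]
  have "S x = 0 \<longleftrightarrow> p x = 0" for x
  proof
    assume "S x = 0"
    then have "\<forall>n. q (a n (p x)) = 0" using S(2) T0 by blast
    then have "central_support q (p x) = 0" by (intro a(2) projsD(3)[OF p1]) blast
    then show "p x = 0" using pq by simp
  qed (simp add: S(2) T blinfun.bilinear_simps)
  moreover have "q (S x) = S x" for x
  proof -
    have "(id_blinfun - q) (T n y) = 0" for n y
      unfolding compl_apply_eq_0 T using qe t(3) by metis
    then have "(id_blinfun - q) (S x) = 0" by (rule S(3))
    then show ?thesis by (simp only: compl_apply_eq_0)
  qed
  ultimately show ?thesis using S(1) p1 q by (intro partial_isometry_of_range_le)
qed

end

context operator_algebra
begin

text \<open>With \<open>D = P - g\<close>, the vectors \<open>x\<close> of \<open>P\<close> with \<open>D (s\<^sup>*)\<^sup>n x = 0\<close> for all \<open>n\<close> are the part that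
  the Cantor-Schroeder-Bernstein argument leaves fixed; \<open>w\<close> is \<open>s\<close> on its complement.\<close>

lemma schroeder_bernstein:
  assumes P: "P \<in> projs" and s: "s \<in> M" "radj s o\<^sub>L s = P" and g: "g \<in> projs" "\<And>x. P (g x) = g x"
    and gs: "\<And>x. g (s x) = s x"
  shows "\<exists>w\<in>M. radj w o\<^sub>L w = P \<and> w o\<^sub>L radj w = g"
proof -
  note ps = partial_isometry_source[OF P s(2)]
  define D where "D = P - g"
  have Dx: "D x = P x - g x" for x by (simp add: D_def blinfun.bilinear_simps)
  define t where "t = radj s"
  have tM: "t \<in> M" unfolding t_def using s(1) by (rule radj_mem)
  have ts: "t (s x) = P x" and Pt: "P (t x) = t x" and sP: "s (P x) = s x" for x
    using ps by (simp_all add: t_def)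
  have tg: "t (g x) = t x" for x
  proof -
    have "g o\<^sub>L s = s" using gs by (simp add: blinfun_eq_iff)
    then have "radj (g o\<^sub>L s) = radj s" by simp
    then show ?thesis by (simp add: projsD(5)[OF g(1)] t_def) (metis blinfun_apply_blinfun_compose)
  qed
  have "insert (id_blinfun - P) (range (\<lambda>n. D o\<^sub>L opow t n)) \<subseteq> M"
    by (auto simp: D_def intro!: diff_mem id_mem comp_mem opow_mem projsD(1)[OF P] projsD(1)[OF g(1)] tM)
  from null_proj[OF this] obtain \<kappa> where \<kappa>: "\<kappa> \<in> projs"
    "\<And>x. \<kappa> x = x \<longleftrightarrow> P x = x \<and> (\<forall>n. D (opow t n x) = 0)" by (auto simp: compl_apply_eq_0)
  have \<kappa>\<kappa>: "\<kappa> (\<kappa> x) = \<kappa> x" for x using projsD(3)[OF \<kappa>(1)] .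
  have \<kappa>D: "P (\<kappa> x) = \<kappa> x" "D (opow t n (\<kappa> x)) = 0" for n x using \<kappa>(2)[of "\<kappa> x"] \<kappa>\<kappa> by auto
  have g\<kappa>: "g (\<kappa> x) = \<kappa> x" for x using \<kappa>D(2)[of 0 x] \<kappa>D(1)[of x] by (simp add: Dx)
  have t\<kappa>: "\<kappa> (t (\<kappa> x)) = t (\<kappa> x)" for x
    unfolding \<kappa>(2) using \<kappa>D(2)[of "Suc _" x] by (simp add: Pt opow_Suc_right del: opow.simps(2))
  have \<kappa>P: "\<kappa> (P x) = \<kappa> x" for x
    using orth_proj_le_sym[OF projsD(2)[OF P] projsD(2)[OF \<kappa>(1)]] \<kappa>D(1) by blast
  have Ps: "P (s x) = s x" for x using g(2)[of "s x"] gs[of x] by simp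
  \<comment> \<open>The operator \<open>w\<close> below has final projection
    \<open>s (1 - \<kappa>) (radj s) + \<kappa>\<close>, so it ends at \<open>g\<close> exactly when
    \<open>Q = \<kappa>\<close>. Since \<open>Q\<close> is self-adjoint, this follows from
    \<open>Q \<kappa> = \<kappa>\<close> and \<open>\<kappa> Q = Q\<close>.\<close>
  define Q where "Q = (s o\<^sub>L (\<kappa> o\<^sub>L t)) + g - (s o\<^sub>L t)"
  have Q: "Q x = s (\<kappa> (t x)) + g x - s (t x)" for x by (simp add: Q_def blinfun.bilinear_simps)
  have Q\<kappa>: "Q (\<kappa> x) = \<kappa> x" for x by (simp add: Q t\<kappa> g\<kappa>)
  have \<kappa>Q: "\<kappa> (Q x) = Q x" for x
  proof -
    have tQ: "t (Q x) = \<kappa> (t x)" by (simp add: Q blinfun.bilinear_simps ts tg \<kappa>D(1) Pt)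
    have "D (Q x) = 0" by (simp add: Q Dx blinfun.bilinear_simps g(2) gs Ps projsD(3)[OF g(1)])
    moreover have "D (opow t (Suc n) (Q x)) = 0" for n
      using \<kappa>D(2)[of n "t x"] by (simp add: opow_Suc_right tQ del: opow.simps(2))
    ultimately have "D (opow t n (Q x)) = 0" for n by (cases n) (auto simp del: opow.simps(2))
    moreover have "P (Q x) = Q x" by (simp add: Q blinfun.bilinear_simps g(2) Ps)
    ultimately show ?thesis unfolding \<kappa>(2) by blast
  qed
  have "radj Q = Q" using projsD(5)[OF g(1)] projsD(5)[OF \<kappa>(1)]
    by (simp add: Q_def t_def blinfun_eq_iff blinfun.bilinear_simps)
  moreover have "radj (Q o\<^sub>L \<kappa>) = radj \<kappa>" by (rule arg_cong[of _ _ radj], rule blinfun_eqI) (simp add: Q\<kappa>)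
  ultimately have "\<kappa> o\<^sub>L Q = \<kappa>" by (simp add: projsD(5)[OF \<kappa>(1)])
  then have "\<kappa> (Q x) = \<kappa> x" for x by (metis blinfun_apply_blinfun_compose)
  with \<kappa>Q have \<kappa>_eq: "s (\<kappa> (t x)) + g x - s (t x) = \<kappa> x" for x by (simp add: Q)
  have \<kappa>s: "\<kappa> (s (\<kappa> x)) = \<kappa> (s x)" for x
  proof -
    have "radj (\<kappa> o\<^sub>L (t o\<^sub>L \<kappa>)) = radj (t o\<^sub>L \<kappa>)" by (rule arg_cong[of _ _ radj], rule blinfun_eqI) (simp add: t\<kappa>)
    then have "(\<kappa> o\<^sub>L s) o\<^sub>L \<kappa> = \<kappa> o\<^sub>L s" by (simp add: projsD(5)[OF \<kappa>(1)] t_def)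
    then show ?thesis by (metis blinfun_apply_blinfun_compose)
  qed
  define w where "w = s - (s o\<^sub>L \<kappa>) + \<kappa>"
  have w: "w x = s x - s (\<kappa> x) + \<kappa> x" for x by (simp add: w_def blinfun.bilinear_simps)
  have rw: "radj w x = t x - \<kappa> (t x) + \<kappa> x" for x
    by (simp add: w_def blinfun.bilinear_simps t_def projsD(5)[OF \<kappa>(1)])
  have "radj w (w x) = P x" for x
    by (simp add: rw w blinfun.bilinear_simps ts \<kappa>D(1) \<kappa>P \<kappa>\<kappa> t\<kappa> \<kappa>s)
  moreover have "w (radj w x) = g x" for x
    using \<kappa>_eq[of x] by (simp add: rw w blinfun.bilinear_simps \<kappa>\<kappa> \<kappa>s algebra_simps)
  moreover have "w \<in> M" unfolding w_def by (intro add_mem diff_mem comp_mem s(1) projsD(1)[OF \<kappa>(1)])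
  ultimately show ?thesis by (intro bexI[of _ w]) (simp_all add: blinfun_eq_iff)
qed

end

section \<open>Partial isometries approximated by unitaries\<close>

context type_III_algebra
begin

text \<open>Bessel's inequality for the orthogonal range projections of the copies: the squared
  norms are summable.\<close>

lemma orthogonal_copies_vanish:
  fixes t :: "nat \<Rightarrow> 'a operator"
  assumes e: "e \<in> projs" and t: "\<And>n. radj (t n) o\<^sub>L t n = e" "\<And>m n x y. m \<noteq> n \<Longrightarrow> inner (t m x) (t n y) = 0"
  shows "(\<lambda>n. (t n o\<^sub>L radj (t n)) z) \<longlonglongrightarrow> 0"
proof -
  note ps = partial_isometry_source[OF e t(1)]
  have norm_t: "norm (t n (radj (t n) z)) = norm (radj (t n) z)" for n using ps by simp
  have "(\<Sum>n<k. (norm (radj (t n) z))\<^sup>2) \<le> (norm z)\<^sup>2" for k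
  proof -
    define w where "w = (\<Sum>n<k. t n (radj (t n) z))"
    have "inner z w = (\<Sum>n<k. (norm (radj (t n) z))\<^sup>2)"
      by (simp add: w_def inner_sum_right power2_norm_eq_inner inner_radj')
    moreover have "inner w w = (\<Sum>n<k. (norm (radj (t n) z))\<^sup>2)"
    proof -
      have "inner w w = (\<Sum>n<k. \<Sum>m<k. inner (t m (radj (t m) z)) (t n (radj (t n) z)))"
        by (simp add: w_def inner_sum_left inner_sum_right)
      also have "\<dots> = (\<Sum>n<k. \<Sum>m<k. if n = m then (norm (radj (t n) z))\<^sup>2 else 0)"
        using t(2) by (intro sum.cong refl) (auto simp: norm_t[symmetric] power2_norm_eq_inner)
      finally show ?thesis by simp
    qed
    moreover have "0 \<le> inner (z - w) (z - w)" by simp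
    ultimately show ?thesis
      by (simp add: inner_diff_left inner_diff_right inner_commute power2_norm_eq_inner)
  qed
  then have "summable (\<lambda>k. (norm (radj (t k) z))\<^sup>2)"
    by (intro summableI_nonneg_bounded[where x = "(norm z)\<^sup>2"]) auto
  then have "(\<lambda>k. sqrt ((norm (radj (t k) z))\<^sup>2)) \<longlonglongrightarrow> sqrt 0"
    by (intro tendsto_real_sqrt summable_LIMSEQ_zero)
  then have "(\<lambda>k. norm (t k (radj (t k) z))) \<longlonglongrightarrow> 0" by (simp add: norm_t)
  then show ?thesis by (simp add: tendsto_norm_zero_iff)
qed

text \<open>The partial isometry is first restricted to \<open>r = e - e\<^sub>n\<close>, where \<open>e\<^sub>n\<close> is a copy of \<open>e\<close> that is
  small on the given vectors; this leaves enough room on both sides to match the complements.\<close>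

lemma partial_isometry_unitary_approx:
  assumes e: "gen e Y" and v: "v \<in> M" "radj v o\<^sub>L v = e" and W: "finite W" "\<And>z. z \<in> W \<Longrightarrow> e z = z" and \<epsilon>: "\<epsilon> > 0"
  shows "\<exists>u\<in>M. radj u o\<^sub>L u = id_blinfun \<and> u o\<^sub>L radj u = id_blinfun \<and> (\<forall>z\<in>W. norm (u z - v z) < \<epsilon>)"
proof -
  note e1 = genD(1)[OF e]
  from orthogonal_copies[OF e] obtain t :: "nat \<Rightarrow> 'a operator" where *: "\<forall>n. t n \<in> M \<and> radj (t n) o\<^sub>L t n = e"
    "\<forall>n x. e (t n x) = t n x" "\<forall>m n x y. m \<noteq> n \<longrightarrow> inner (t m x) (t n y) = 0" by (elim exE conjE)
  note t = *(1)[THEN spec, THEN conjunct1] *(1)[THEN spec, THEN conjunct2] *(2,3)[rule_format]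
  have "\<forall>\<^sub>F n in sequentially. \<forall>z\<in>W. norm ((t n o\<^sub>L radj (t n)) z) < \<epsilon> / 2"
  proof (rule eventually_ball_finite[OF W(1)], rule ballI)
    fix z
    have "(\<lambda>n. norm ((t n o\<^sub>L radj (t n)) z)) \<longlonglongrightarrow> 0"
      by (intro tendsto_norm_zero orthogonal_copies_vanish[OF e1 t(2)] t(4))
    then show "\<forall>\<^sub>F n in sequentially. norm ((t n o\<^sub>L radj (t n)) z) < \<epsilon> / 2"
      using \<epsilon> by (auto dest: order_tendstoD(2)[of _ _ _ "\<epsilon> / 2"])
  qed
  from eventually_happens'[OF sequentially_bot this] obtain n
    where n: "\<And>z. z \<in> W \<Longrightarrow> norm ((t n o\<^sub>L radj (t n)) z) < \<epsilon> / 2" by (elim exE) (rule that, blast)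
  define k where "k = t n"
  have k: "k \<in> M" "radj k o\<^sub>L k = e" "\<And>x. e (k x) = k x" using t by (auto simp: k_def)
  define e' where "e' = k o\<^sub>L radj k"
  have e': "e' \<in> projs" unfolding e'_def by (rule partial_isometry_range(1)[OF e1 k(1,2)])
  have e'x: "e' x = k (radj k x)" for x by (simp add: e'_def)
  note psk = partial_isometry_source[OF e1 k(2)] and psv = partial_isometry_source[OF e1 v(2)]
  have ee': "e (e' x) = e' x" and e'e: "e' (e x) = e' x" and e'e': "e' (e' x) = e' x" for x
  proof -
    show ee': "e (e' x) = e' x" for x by (simp add: e'x k(3))
    then show "e' (e x) = e' x" using orth_proj_le_sym[OF projsD(2)[OF e1] projsD(2)[OF e']] by blast
    show "e' (e' x) = e' x" by (rule projsD(3)[OF e'])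
  qed
  have "countable (Y \<union> v ` Y)" using genD(2)[OF e] by auto
  \<comment> \<open>Everything takes place below \<open>P\<close>, which dominates \<open>e\<close>
    and the range of \<open>v\<close>; outside \<open>P\<close> the unitary is the identity.
    \<open>P\<close> is chosen countably generated so that it embeds into \<open>e'\<close>.\<close>
  from gen_exists[OF this] obtain P where P: "gen P (Y \<union> v ` Y)" by blast
  note P1 = genD(1)[OF P]
  have PP: "P (P x) = P x" and ee: "e (e x) = e x" for x using projsD(3)[OF P1] projsD(3)[OF e1] by auto
  have Pe: "P (e x) = e x" for x using genD(3)[OF P] by (intro gen_le[OF e P1]) blast
  have Pv: "P (v x) = v x" for x
  proof -
    have "((id_blinfun - P) o\<^sub>L v) (e x) = 0"
    proof (rule genD(4)[OF e])
      show "(id_blinfun - P) o\<^sub>L v \<in> M" by (intro comp_mem diff_mem id_mem projsD(1)[OF P1] v(1))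
      show "((id_blinfun - P) o\<^sub>L v) y = 0" if "y \<in> Y" for y
        unfolding blinfun_apply_blinfun_compose compl_apply_eq_0 using genD(3)[OF P] that by blast
    qed
    then have "P (v (e x)) = v (e x)" unfolding blinfun_apply_blinfun_compose compl_apply_eq_0 .
    then show ?thesis by (simp only: psv)
  qed
  note c = central_support(1)[OF projsD(1)[OF e']]
  \<comment> \<open>\<open>e\<close> is equivalent to \<open>e'\<close> through \<open>k\<close>, so
    both have the same central support.\<close>
  have ce: "central_support e' (e x) = e x" for x
  proof -
    have "e' (k x) = k x" by (simp add: e'x psk)
    then have "central_support e' (k x) = k x" using central_support_apply(1)[OF e', of "k x"] by simp
    then have "radj k (k x) = central_support e' (radj k (k x))"
      using central_projsD(2)[OF c radj_mem[OF k(1)], of "k x"] by simp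
    then show ?thesis by (simp add: psk)
  qed
  have cP: "central_support e' (P x) = P x" for x
  proof (rule gen_le[OF P central_projsD(1)[OF c]])
    fix y assume "y \<in> Y \<union> v ` Y"
    then consider "y \<in> Y" | z where "z \<in> Y" "y = v z" by blast
    then show "central_support e' y = y"
    proof cases
      case 1
      then show ?thesis using ce[of y] genD(3)[OF e] by simp
    next
      case 2
      then have "central_support e' (v (e z)) = v (e z)" using central_projsD(2)[OF c v(1)] ce by simp
      with 2 show ?thesis by (simp add: psv)
    qed
  qed
  from embedding[OF P e' cP] obtain s where s: "s \<in> M" "radj s o\<^sub>L s = P" "\<And>x. e' (s x) = s x" by blast
  note pss = partial_isometry_source[OF P1 s(2)]
  have es: "e (s x) = s x" for x using ee'[of "s x"] s(3) by simp
  define r where "r = e - e'"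
  have r: "r x = e x - e' x" for x by (simp add: r_def blinfun.bilinear_simps)
  have rM: "r \<in> M" unfolding r_def by (intro diff_mem projsD(1)[OF e1] projsD(1)[OF e'])
  have rr: "r (r x) = r x" "e (r x) = r x" "r (e x) = r x" "P (r x) = r x" "r (s x) = 0" for x
    by (simp_all add: r blinfun.bilinear_simps ee ee' e'e e'e' Pe es s(3)) (metis Pe ee')
  have radj_r: "radj r = r" by (simp add: r_def projsD(5)[OF e1] projsD(5)[OF e'])
  have radjP: "radj P = P" using projsD(5)[OF P1] .
  have rP: "r (P x) = r x" for x
  proof -
    have "radj (P o\<^sub>L r) = radj r" by (rule arg_cong[of _ _ radj], rule blinfun_eqI) (simp add: rr)
    then have "r o\<^sub>L P = r" by (simp add: radj_r radjP)
    then show ?thesis by (metis blinfun_apply_blinfun_compose)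
  qed
  have vP: "radj v (P x) = radj v x" for x
  proof -
    have "radj (P o\<^sub>L v) = radj v" by (rule arg_cong[of _ _ radj], rule blinfun_eqI) (simp add: Pv)
    then have "radj v o\<^sub>L P = radj v" by (simp add: radjP)
    then show ?thesis by (metis blinfun_apply_blinfun_compose)
  qed
  \<comment> \<open>\<open>r\<close> and \<open>R\<close> are the initial and final projections of
    the restricted \<open>v\<close>. Each of their complements in \<open>P\<close> still contains a
    copy of \<open>P\<close>, inside \<open>e'\<close> and inside the image of \<open>e'\<close>
    under \<open>v\<close> respectively, so by \<open>schroeder_bernstein\<close> both are
    equivalent to \<open>P\<close> and hence to each other.\<close>
  define g1 where "g1 = P - r"
  have g1: "g1 x = P x - r x" for x by (simp add: g1_def blinfun.bilinear_simps)
  define R where "R = (v o\<^sub>L r) o\<^sub>L radj v"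
  have R: "R x = v (r (radj v x))" for x by (simp add: R_def)
  define g2 where "g2 = P - R"
  have g2: "g2 x = P x - R x" for x by (simp add: g2_def blinfun.bilinear_simps)
  have RR: "R (R x) = R x" "P (R x) = R x" "R (P x) = R x" for x by (simp_all add: R psv rr Pv vP)
  have g1p: "g1 \<in> projs"
    by (simp add: projs_def orth_proj_iff blinfun_eq_iff g1 blinfun.bilinear_simps PP rr rP)
      (simp add: g1_def radjP radj_r diff_mem projsD(1)[OF P1] rM blinfun.bilinear_simps)
  have g2p: "g2 \<in> projs"
    by (simp add: projs_def orth_proj_iff blinfun_eq_iff g2 blinfun.bilinear_simps PP RR)
      (simp add: g2_def R_def radjP radj_r diff_mem comp_mem radj_mem v(1) projsD(1)[OF P1] rM blinfun_eq_iff blinfun.bilinear_simps)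
  have "\<exists>w\<in>M. radj w o\<^sub>L w = P \<and> w o\<^sub>L radj w = g1"
  proof (rule schroeder_bernstein[OF P1 s(1,2) g1p])
    show "P (g1 x) = g1 x" for x by (simp add: g1 blinfun.bilinear_simps PP rr)
    have "P (s x) = s x" for x using Pe[of "s x"] es by simp
    then show "g1 (s x) = s x" for x by (simp add: g1 rr)
  qed
  then obtain w1 where w1: "w1 \<in> M" "radj w1 o\<^sub>L w1 = P" "w1 o\<^sub>L radj w1 = g1" by blast
  have "\<exists>w\<in>M. radj w o\<^sub>L w = P \<and> w o\<^sub>L radj w = g2"
  proof (rule schroeder_bernstein[OF P1 _ _ g2p])
    show "v o\<^sub>L s \<in> M" using v(1) s(1) by (rule comp_mem)
    show "radj (v o\<^sub>L s) o\<^sub>L (v o\<^sub>L s) = P" by (simp add: blinfun_eq_iff psv es pss)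
    show "P (g2 x) = g2 x" for x by (simp add: g2 blinfun.bilinear_simps PP RR)
    show "g2 ((v o\<^sub>L s) x) = (v o\<^sub>L s) x" for x by (simp add: g2 Pv R psv es rr blinfun.bilinear_simps)
  qed
  then obtain w2 where w2: "w2 \<in> M" "radj w2 o\<^sub>L w2 = P" "w2 o\<^sub>L radj w2 = g2" by blast
  note ps1 = partial_isometry_source[OF P1 w1(2)] and ps2 = partial_isometry_source[OF P1 w2(2)]
  have ww: "w1 (radj w1 x) = g1 x" "w2 (radj w2 x) = g2 x" for x
    using w1(3) w2(3) by (metis blinfun_apply_blinfun_compose)+
  define y where "y = w2 o\<^sub>L radj w1"
  define y' where "y' = w1 o\<^sub>L radj w2"
  have y: "y x = w2 (radj w1 x)" and y': "y' x = w1 (radj w2 x)" for x by (simp_all add: y_def y'_def)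
  have radj_y: "radj y = y'" by (simp add: y_def y'_def)
  have y'y: "y' (y x) = g1 x" and yy': "y (y' x) = g2 x" for x
    by (simp_all add: y y' ps1 ps2 ww)
  have g1y': "g1 (y' x) = y' x" and g2y: "g2 (y x) = y x" for x
    by (simp_all add: y y' ps1 ps2 flip: ww)
  have "y o\<^sub>L g1 = radj (g1 o\<^sub>L y')" by (simp add: radj_y[symmetric] projsD(5)[OF g1p])
  also have "\<dots> = radj y'" by (rule arg_cong[of _ _ radj], rule blinfun_eqI) (simp add: g1y')
  finally have yg1: "y (g1 x) = y x" for x by (metis blinfun_apply_blinfun_compose radj_radj radj_y)
  have "y' o\<^sub>L g2 = radj (g2 o\<^sub>L y)" by (simp add: radj_y projsD(5)[OF g2p])
  also have "\<dots> = radj y" by (rule arg_cong[of _ _ radj], rule blinfun_eqI) (simp add: g2y)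
  finally have y'g2: "y' (g2 x) = y' x" for x by (metis blinfun_apply_blinfun_compose radj_y)
  have g1r: "g1 (r x) = 0" "g1 (P x) = g1 x" "r (g1 x) = 0" "P (g1 x) = g1 x" for x
    by (simp_all add: g1 blinfun.bilinear_simps rr rP PP)
  have g2v: "g2 (v (r x)) = 0" "g2 (P x) = g2 x" "r (radj v (g2 x)) = 0" "P (g2 x) = g2 x" for x
    by (simp_all add: g2 blinfun.bilinear_simps Pv R psv rr PP RR vP)
  have yr: "y (r x) = 0" "y (P x) = y x" "r (y' x) = 0" "P (y' x) = y' x" for x
    using yg1[of "r x"] yg1[of "P x"] yg1[of x] g1y'[of x] g1r(3)[of "y' x"] g1r(4)[of "y' x"] g1r(1,2)[of x]
    by (simp_all add: blinfun.bilinear_simps)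
  have y'v: "y' (v (r x)) = 0" "y' (P x) = y' x" "r (radj v (y x)) = 0" "P (y x) = y x" for x
    using y'g2[of "v (r x)"] y'g2[of "P x"] y'g2[of x] g2y[of x] g2v(3)[of "y x"] g2v(4)[of "y x"] g2v(1,2)[of x]
    by (simp_all add: blinfun.bilinear_simps)
  \<comment> \<open>Three orthogonal parts: \<open>v\<close> from \<open>r\<close> to
    \<open>R\<close>, the partial isometry \<open>y\<close> from \<open>P - r\<close> to
    \<open>P - R\<close>, and the identity outside \<open>P\<close>.\<close>
  define u where "u = (v o\<^sub>L r) + y + (id_blinfun - P)"
  have u: "u x = v (r x) + y x + (x - P x)" for x by (simp add: u_def blinfun.bilinear_simps)
  have ru: "radj u x = r (radj v x) + y' x + (x - P x)" for x
    by (simp add: u_def blinfun.bilinear_simps radj_r radjP radj_y)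
  have "radj u (u x) = x" for x
    by (simp add: ru u blinfun.bilinear_simps psv rr vP y'v y'y Pv g1 PP)
  moreover have "u (radj u x) = x" for x
    by (simp add: ru u blinfun.bilinear_simps rr rP yr yy' PP g2 R)
  moreover have "u \<in> M"
    unfolding u_def y_def
    by (intro add_mem diff_mem comp_mem id_mem v(1) rM w1(1) w2(1) radj_mem projsD(1)[OF P1])
  moreover have "norm (u z - v z) < \<epsilon>" if "z \<in> W" for z
  proof -
    have ez: "e z = z" using W(2) that .
    have Pz: "P z = z" using Pe[of z] ez by simp
    \<comment> \<open>\<open>u\<close> and \<open>v\<close> agree on \<open>r z\<close>, and on the
      remaining part \<open>e' z\<close> each contributes less than
      \<open>\<epsilon> / 2\<close>.\<close>
    have "u z - v z = y z - v (e' z)" using ez by (simp add: u r Pz blinfun.bilinear_simps)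
    also have "y z = y (e' z)" using yr(1)[of z] ez by (simp add: r blinfun.bilinear_simps)
    finally have uv: "u z - v z = y (e' z) - v (e' z)" .
    have "norm (v (e' z)) = norm (e' z)" by (simp add: psv ee')
    moreover have "norm (y (e' z)) \<le> norm (e' z)"
    proof -
      have "(norm (y (e' z)))\<^sup>2 = inner (g1 (e' z)) (e' z)"
        by (simp only: norm_radj_apply_square radj_y y'y)
      also have "\<dots> = (norm (g1 (e' z)))\<^sup>2" by (rule orth_proj_inner[OF projsD(2)[OF g1p]])
      finally have "norm (y (e' z)) = norm (g1 (e' z))" by simp
      then show ?thesis using orth_proj_norm_le[OF projsD(2)[OF g1p]] by simp
    qed
    moreover have "norm (e' z) < \<epsilon> / 2" using n[OF that] by (simp add: e'_def k_def)
    ultimately show ?thesis unfolding uv using norm_triangle_ineq4[of "y (e' z)" "v (e' z)"] by linarith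
  qed
  ultimately show ?thesis by (intro bexI[of _ u]) (auto simp: blinfun_eq_iff)
qed

text \<open>Only the vectors \<open>Q l x\<close> with \<open>x\<close> in \<open>X\<close> matter.
  The projections \<open>e l\<close> generated by them embed below the \<open>p l\<close>, and the
  embeddings add up to one partial isometry \<open>V\<close> with
  \<open>V (Q l x) = p l (V x)\<close>. Replacing \<open>V\<close> by a unitary that is close on
  these vectors costs \<open>\<epsilon> / 2\<close> on each side.\<close>

lemma unitary_intertwiner:
  fixes p Q :: "nat \<Rightarrow> 'a operator"
  assumes p: "\<And>l. l < m \<Longrightarrow> p l \<in> projs" and pp: "\<And>i j x. i < m \<Longrightarrow> j < m \<Longrightarrow> i \<noteq> j \<Longrightarrow> p i (p j x) = 0"
    and Q: "\<And>l. l < m \<Longrightarrow> Q l \<in> projs" and QQ: "\<And>i j x. i < m \<Longrightarrow> j < m \<Longrightarrow> i \<noteq> j \<Longrightarrow> Q i (Q j x) = 0"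
    and Qsum: "\<And>x. (\<Sum>l<m. Q l x) = x" and cle: "\<And>l x. l < m \<Longrightarrow> central_support (p l) (Q l x) = Q l x"
    and X: "finite X" and \<epsilon>: "\<epsilon> > 0"
  shows "\<exists>u\<in>M. radj u o\<^sub>L u = id_blinfun \<and> u o\<^sub>L radj u = id_blinfun \<and>
    (\<forall>x\<in>X. \<forall>l<m. norm (u (Q l x) - p l (u x)) < \<epsilon>)"
proof -
  define Y where "Y = (\<lambda>l. Q l ` X)"
  have "\<exists>e. gen e (Y l)" for l using gen_exists X by (simp add: Y_def countable_finite)
  then obtain e where e: "\<And>l. gen (e l) (Y l)" by metis
  note e1 = genD(1)[OF e]
  have Qe: "Q l (e l x) = e l x" if "l < m" for l x
    using e Q[OF that] projsD(3)[OF Q[OF that]] by (intro gen_le[OF e]) (auto simp: Y_def)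
  have eQ: "e l (Q l x) = e l x" if "l < m" for l x
    using orth_proj_le_sym[OF projsD(2)[OF Q[OF that]] projsD(2)[OF e1]] Qe[OF that] by blast
  have ee: "e i (e j x) = 0" if "i < m" "j < m" "i \<noteq> j" for i j x
  proof -
    have "e i (e j x) = e i (Q i (Q j (e j x)))" using that by (simp add: eQ Qe)
    then show ?thesis using QQ[OF that] by (simp add: blinfun.bilinear_simps)
  qed
  have "\<exists>v. l < m \<longrightarrow> v \<in> M \<and> radj v o\<^sub>L v = e l \<and> (\<forall>x. p l (v x) = v x)" for l
  proof (cases "l < m")
    case True
    have "central_support (p l) (e l x) = e l x" for x using cle[OF True, of "e l x"] Qe[OF True] by simp
    from embedding[OF e p[OF True] this] show ?thesis by blast
  qed blast
  then have "\<forall>l. \<exists>v. l < m \<longrightarrow> v \<in> M \<and> radj v o\<^sub>L v = e l \<and> (\<forall>x. p l (v x) = v x)" by blast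
  from choice[OF this] obtain v where v: "\<And>l. l < m \<Longrightarrow> v l \<in> M" "\<And>l. l < m \<Longrightarrow> radj (v l) o\<^sub>L v l = e l"
    "\<And>l x. l < m \<Longrightarrow> p l (v l x) = v l x" by blast
  note ps = partial_isometry_source[OF e1 v(2)]
  have vv: "radj (v i) (v j x) = 0" if "i < m" "j < m" "i \<noteq> j" for i j x
  proof -
    have "inner (radj (v i) (v j x)) y = inner (p j (v j x)) (p i (v i y))" for y
      using that by (simp add: inner_radj' v(3))
    also have "\<dots> y = inner (p i (p j (v j x))) (v i y)" for y
      using projsD(4)[OF p[OF that(1)]] by simp
    also have "\<dots> y = 0" for y using pp[OF that] by simp
    finally show ?thesis by (metis inner_eq_zero_iff)
  qed
  define E V where "E = (\<Sum>l<m. e l)" and "V = (\<Sum>l<m. v l)"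
  have E: "E x = (\<Sum>l<m. e l x)" and V: "V x = (\<Sum>l<m. v l x)" for x
    by (simp_all add: E_def V_def blinfun.bilinear_simps)
  have single: "(\<Sum>l<m. f l) = f i" if "i < m" "\<And>l. l < m \<Longrightarrow> l \<noteq> i \<Longrightarrow> f l = 0" for i and f :: "nat \<Rightarrow> 'a"
    using that by (subst sum.remove[of _ i]) (auto intro!: sum.neutral)
  have VM: "V \<in> M" unfolding V_def using v(1) by (auto intro: sum_mem)
  have VV: "radj V o\<^sub>L V = E"
  proof (rule blinfun_eqI)
    fix x
    have "(radj V o\<^sub>L V) x = (\<Sum>j<m. \<Sum>i<m. radj (v i) (v j x))"
      by (simp add: V_def blinfun.bilinear_simps)
    also have "\<dots> = (\<Sum>j<m. e j x)"
    proof (rule sum.cong[OF refl])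
      fix j assume "j \<in> {..<m}"
      then have j: "j < m" by simp
      have "(\<Sum>i<m. radj (v i) (v j x)) = radj (v j) (v j x)" using vv j by (intro single) auto
      then show "(\<Sum>i<m. radj (v i) (v j x)) = e j x" using ps(3) j by simp
    qed
    finally show "(radj V o\<^sub>L V) x = E x" by (simp add: E)
  qed
  have eE: "e l (E x) = e l x" if "l < m" for l x
  proof -
    have "e l (E x) = (\<Sum>i<m. e l (e i x))" by (simp add: E blinfun.bilinear_simps)
    also have "\<dots> = e l (e l x)" using that ee by (intro single) auto
    finally show ?thesis using projsD(3)[OF e1] by simp
  qed
  have Eproj: "E \<in> projs"
  proof -
    have "E (E x) = E x" for x
    proof -
      have "E (E x) = (\<Sum>l<m. e l (E x))" by (rule E)
      also have "\<dots> = (\<Sum>l<m. e l x)" by (intro sum.cong refl) (simp add: eE)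
      also have "\<dots> = E x" by (rule E[symmetric])
      finally show ?thesis .
    qed
    moreover have "E \<in> M" unfolding E_def using e1 by (auto intro: sum_mem projsD(1))
    moreover have "radj E = E" by (simp add: VV[symmetric])
    ultimately show ?thesis by (simp add: projs_def orth_proj_iff blinfun_eq_iff)
  qed
  have Ey: "E y = y" if "l < m" "y \<in> Y l" for l y
  proof -
    have y: "e l y = y" using genD(3)[OF e that(2)] .
    have "E y = e l y"
      unfolding E using that(1) ee[of _ l y] y by (intro single) auto
    with y show ?thesis by simp
  qed
  have EX: "E x = x" if "x \<in> X" for x
  proof -
    have "E (Q l x) = Q l x" if "l < m" for l using Ey[OF that] \<open>x \<in> X\<close> by (simp add: Y_def)
    then have "E (\<Sum>l<m. Q l x) = (\<Sum>l<m. Q l x)" by (simp add: blinfun.bilinear_simps)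
    then show ?thesis by (simp only: Qsum)
  qed
  have genE: "gen E (\<Union>l<m. Y l)"
    unfolding gen_def
  proof (intro conjI ballI impI allI Eproj)
    show "countable (\<Union>l<m. Y l)" using X by (simp add: Y_def countable_finite)
    show "E y = y" if "y \<in> (\<Union>l<m. Y l)" for y using that Ey by blast
    show "a (E x) = 0" if "a \<in> M" "\<forall>y\<in>(\<Union>l<m. Y l). blinfun_apply a y = 0" for a x
    proof -
      have "a (e l x) = 0" if "l < m" for l
        using \<open>a \<in> M\<close> \<open>\<forall>y\<in>_. _\<close> that by (intro genD(4)[OF e]) auto
      then show ?thesis by (simp add: E blinfun.bilinear_simps)
    qed
  qed
  define W where "W = X \<union> (\<Union>l<m. Y l)"
  have W: "finite W" "\<And>z. z \<in> W \<Longrightarrow> E z = z" using X EX Ey by (auto simp: W_def Y_def)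
  obtain u where u: "u \<in> M" "radj u o\<^sub>L u = id_blinfun" "u o\<^sub>L radj u = id_blinfun"
    "\<And>z. z \<in> W \<Longrightarrow> norm (u z - V z) < \<epsilon> / 2"
    using partial_isometry_unitary_approx[OF genE VM VV W, of "\<epsilon> / 2"] \<epsilon> by auto
  have "norm (u (Q l x) - p l (u x)) < \<epsilon>" if x: "x \<in> X" and l: "l < m" for x l
  proof -
    have elQ: "e l x = Q l x"
      using genD(3)[OF e, of "Q l x" l] x eQ[OF l] by (simp add: Y_def)
    have "V (Q l x) = v l (Q l x)"
    proof -
      have "v i (Q l x) = 0" if "i < m" "i \<noteq> l" for i
      proof -
        have "v i (Q l x) = v i (e i (Q i (Q l x)))" using that by (simp add: eQ ps)
        then show ?thesis using QQ[OF that(1) l that(2)] by (simp add: blinfun.bilinear_simps)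
      qed
      then show ?thesis unfolding V using l by (intro single) auto
    qed
    also have "\<dots> = v l x" using l by (simp add: ps flip: elQ)
    also have "\<dots> = p l (V x)"
    proof -
      have "p l (v i x) = 0" if "i < m" "i \<noteq> l" for i
        using pp[OF l that(1), of "v i x"] v(3)[OF that(1)] that by simp
      then have "(\<Sum>i<m. p l (v i x)) = p l (v l x)" using l by (intro single) auto
      then show ?thesis by (simp add: V blinfun.bilinear_simps v(3)[OF l])
    qed
    finally have VQ: "V (Q l x) = p l (V x)" .
    have "norm (u (Q l x) - V (Q l x)) < \<epsilon> / 2" "norm (u x - V x) < \<epsilon> / 2"
      using u(4) x l by (auto simp: W_def Y_def)
    moreover have "norm (p l (u x - V x)) \<le> norm (u x - V x)"
      by (rule orth_proj_norm_le[OF projsD(2)[OF p[OF l]]])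
    moreover have "u (Q l x) - p l (u x) = (u (Q l x) - V (Q l x)) - p l (u x - V x)"
      by (simp add: VQ blinfun.bilinear_simps)
    ultimately show ?thesis
      using norm_triangle_ineq4[of "u (Q l x) - V (Q l x)" "p l (u x - V x)"] by (simp only:)
  qed
  with u show ?thesis by blast
qed

end

section \<open>Spectral partitions of normal operators\<close>

text \<open>\<open>A\<close> is cut at the levels \<open>t i = i * s - K\<close> with
  \<open>K = norm A\<close>, and \<open>r j\<close> is the part below level \<open>j\<close> that no
  earlier level has taken, a band of width \<open>s\<close>. The bands commute with whatever
  commutes with \<open>A\<close>, so those of commuting operators can be multiplied.\<close>

lemma selfadj_partition:
  fixes A :: "'a::{real_inner,banach} operator"
  assumes A: "selfadj A" and s: "s > 0"
  shows "\<exists>n r t. (\<forall>j<n. orth_proj (r j) \<and> (\<forall>S. commutes S A \<longrightarrow> commutes S (r j))) \<and>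
    (\<forall>i<n. \<forall>j<n. i \<noteq> j \<longrightarrow> (\<forall>x. r i (r j x) = 0)) \<and> (\<forall>x. (\<Sum>j<n::nat. r j x) = x) \<and>
    (\<forall>j<n. \<forall>x. norm (A (r j x) - t j *\<^sub>R r j x) \<le> s * norm (r j x))"
proof -
  define K where "K = norm A"
  have form: "\<bar>inner (A x) x\<bar> \<le> K * (norm x)\<^sup>2" for x
  proof -
    have "\<bar>inner (A x) x\<bar> \<le> norm (A x) * norm x" by (rule Cauchy_Schwarz_ineq2)
    also have "\<dots> \<le> (K * norm x) * norm x" by (intro mult_right_mono norm_blinfun_le) (simp_all add: K_def)
    finally show ?thesis by (simp add: power2_eq_square mult.assoc)
  qed
  define t where "t = (\<lambda>i. real i * s - K)"
  \<comment> \<open>The top level has to exceed the norm of \<open>A\<close>, so that nothing is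
    left above it.\<close>
  obtain m :: nat where "real m > 2 * K / s" using reals_Archimedean2 by blast
  then have m: "t m > K" using s by (simp add: t_def field_simps)
  have "\<forall>i. \<exists>p. orth_proj p \<and> (\<forall>S. commutes S A \<longrightarrow> commutes S p) \<and>
    (\<forall>x. p x = x \<longrightarrow> inner (A x) x \<le> t i * (norm x)\<^sup>2) \<and> (\<forall>x. p x = 0 \<longrightarrow> t i * (norm x)\<^sup>2 \<le> inner (A x) x)"
    using spectral_cut[OF A] by blast
  from choice[OF this] obtain p where *: "\<forall>i. orth_proj (p i) \<and> (\<forall>S. commutes S A \<longrightarrow> commutes S (p i)) \<and>
    (\<forall>x. p i x = x \<longrightarrow> inner (A x) x \<le> t i * (norm x)\<^sup>2) \<and> (\<forall>x. p i x = 0 \<longrightarrow> t i * (norm x)\<^sup>2 \<le> inner (A x) x)"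
    by (elim exE)
  define good where "good = (\<lambda>T. \<forall>S. commutes S A \<longrightarrow> commutes S T)"
  have good_p: "good (p i)" for i
    unfolding good_def by (rule *[THEN spec, of i, THEN conjunct2, THEN conjunct1])
  note p = *[THEN spec, THEN conjunct1] good_p
    *[THEN spec, THEN conjunct2, THEN conjunct2, THEN conjunct1, rule_format]
    *[THEN spec, THEN conjunct2, THEN conjunct2, THEN conjunct2, rule_format]
  have goodD: "commutes S T" if "good T" "commutes S A" for S T
    using that(1) unfolding good_def by (rule allE) (erule mp, rule that(2))
  have gg: "commutes S T" if "good S" "good T" for S T
  proof -
    have "commutes A S" by (rule goodD[OF that(1)]) (simp add: commutes_def)
    then show ?thesis by (rule goodD[OF that(2) commutes_sym])
  qed
  have good_comp: "good (S o\<^sub>L T)" if "good S" "good T" for S T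
    unfolding good_def
  proof (intro allI impI)
    fix R assume "commutes R A"
    from goodD[OF that(1) this] goodD[OF that(2) this] show "commutes R (S o\<^sub>L T)"
      by (simp add: commutes_def)
  qed
  have good_compl: "good (id_blinfun - T)" if "good T" for T
    using goodD[OF that] by (auto simp: good_def commutes_def[of _ "id_blinfun - T"] blinfun.bilinear_simps dest: commutesD)
  define c where "c = rec_nat id_blinfun (\<lambda>n c. (id_blinfun - p n) o\<^sub>L c)"
  have c0: "c 0 = id_blinfun" and cS: "c (Suc n) = (id_blinfun - p n) o\<^sub>L c n" for n by (simp_all add: c_def)
  have c: "orth_proj (c n) \<and> good (c n)" for n
  proof (induction n)
    case 0
    then show ?case by (simp add: c0 good_def commutes_def)
  next
    case (Suc n)
    then show ?case
      unfolding cS using p by (intro conjI orth_proj_comp orth_proj_compl gg good_compl good_comp) auto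
  qed
  have pc: "p i (c j x) = c j (p i x)" for i j x
    using gg[OF p(2) conjunct2[OF c]] by (simp add: commutes_def)
  have ppc: "p i (p i x) = p i x" for i x using orth_projD(1)[OF p(1)] .
  have cp: "c j (p i x) = 0" if "i < j" for i j x
    using that
  proof (induction j)
    case (Suc j)
    show ?case
    proof (cases "i = j")
      case True
      then show ?thesis by (simp add: cS blinfun.bilinear_simps ppc flip: pc)
    next
      case False
      with Suc have "c j (p i x) = 0" by simp
      then show ?thesis by (simp add: cS blinfun.bilinear_simps)
    qed
  qed simp
  define r where "r = (\<lambda>j. p j o\<^sub>L c j)"
  have r: "orth_proj (r j)" "good (r j)" for j
    unfolding r_def using p c by (auto intro!: orth_proj_comp gg good_comp)
  have rr: "r i (r j x) = 0" if "i < j" for i j x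
  proof -
    have "commutes (c i) (p j)" "commutes (p i) (p j)" using gg p c by blast+
    then have "r i (r j x) = p j (c i (c j (p i x)))"
      by (simp add: r_def pc commutes_def)
    then show ?thesis by (simp add: cp[OF that] blinfun.bilinear_simps)
  qed
  have rr': "r i (r j x) = 0" if "i \<noteq> j" for i j x
  proof (cases "i < j")
    case False
    then have "j < i" using that by simp
    moreover have "r i (r j x) = r j (r i x)" using gg[OF r(2) r(2)] by (simp add: commutes_def)
    ultimately show ?thesis using rr by simp
  qed (rule rr)
  have sum: "(\<Sum>j<n. r j x) + c n x = x" for n x
    by (induction n) (simp_all add: c0 cS r_def blinfun.bilinear_simps)
  have "c (Suc m) x = 0" for x
  proof -
    define y where "y = c (Suc m) x"
    have "p m y = 0" unfolding y_def pc by (rule cp) simp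
    then have "t m * (norm y)\<^sup>2 \<le> K * (norm y)\<^sup>2" using p(4)[of m y] form[of y] by linarith
    then have "(norm y)\<^sup>2 \<le> 0" using m by (simp add: mult_le_cancel_right)
    then show ?thesis by (simp add: y_def)
  qed
  then have rsum: "(\<Sum>j<Suc m. r j x) = x" for x using sum[where n = "Suc m" and x = x] by simp
  have "norm (A (r j x) - t j *\<^sub>R r j x) \<le> s * norm (r j x)" for j x
  proof (rule selfadj_band_norm_le[OF A r(1) _ s])
    show "commutes (r j) A" by (rule commutes_sym, rule goodD[OF r(2)]) (simp add: commutes_def)
    show "r j (r j x) = r j x" by (rule orth_projD(1)[OF r(1)])
    fix y assume y: "r j y = y"
    have "p j (r j y) = r j y" by (simp add: r_def ppc)
    then show "inner (A y) y \<le> t j * (norm y)\<^sup>2" using p(3) y by simp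
    show "(t j - s) * (norm y)\<^sup>2 \<le> inner (A y) y"
    proof (cases j)
      case 0
      \<comment> \<open>The lowest band has no cut beneath it; its lower bound comes from
        \<open>A \<ge> - K = t 0\<close>.\<close>
      have "(t j - s) * (norm y)\<^sup>2 \<le> - (K * (norm y)\<^sup>2)"
        using s 0 by (simp add: t_def algebra_simps)
      then show ?thesis using form[of y] by linarith
    next
      case (Suc i)
      have "p i (r j y) = p j (c j (p i y))"
        using gg[OF p(2) p(2), of i j] by (simp add: r_def pc commutes_def)
      then have "p i y = 0" using y cp[of i j] Suc by (simp add: blinfun.bilinear_simps)
      then have "t i * (norm y)\<^sup>2 \<le> inner (A y) y" by (rule p(4))
      then show ?thesis using Suc by (simp add: t_def algebra_simps)
    qed
  qed
  then show ?thesis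
    using r(1) r(2)[unfolded good_def] rr' rsum
    by (intro exI[of _ "Suc m"] exI[of _ r] exI[of _ t]) blast
qed

section \<open>Partitions of the identity in the algebra\<close>

context operator_algebra
begin

definition partition :: "nat \<Rightarrow> (nat \<Rightarrow> 'a operator) \<Rightarrow> bool" where
  "partition n q \<longleftrightarrow> (\<forall>j<n. q j \<in> projs) \<and> (\<forall>i<n. \<forall>j<n. i \<noteq> j \<longrightarrow> (\<forall>x. q i (q j x) = 0)) \<and>
    (\<forall>x. (\<Sum>j<n. q j x) = x)"

lemma partitionD:
  assumes "partition n q"
  shows "j < n \<Longrightarrow> q j \<in> projs" "i < n \<Longrightarrow> j < n \<Longrightarrow> i \<noteq> j \<Longrightarrow> q i (q j x) = 0" "(\<Sum>j<n. q j x) = x"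
  using assms by (auto simp: partition_def)

lemma partition_norm:
  assumes q: "partition n q"
  shows "(norm x)\<^sup>2 = (\<Sum>j<n. (norm (q j x))\<^sup>2)"
proof -
  have "(norm x)\<^sup>2 = inner (\<Sum>j<n. q j x) x" by (simp add: partitionD(3)[OF q] power2_norm_eq_inner)
  also have "\<dots> = (\<Sum>j<n. (norm (q j x))\<^sup>2)"
    unfolding inner_sum_left
    by (intro sum.cong refl orth_proj_inner projsD(2) partitionD(1)[OF q]) simp
  finally show ?thesis .
qed

text \<open>The components of \<open>T x\<close> are the vectors \<open>T (q j x)\<close>, so bounds
  on the pieces add up by Pythagoras with no loss in the constant.\<close>

lemma partition_norm_le:
  assumes q: "partition n q" and comm: "\<And>j. j < n \<Longrightarrow> commutes (q j) T" and c: "c \<ge> 0"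
    and le: "\<And>j. j < n \<Longrightarrow> norm (T (q j x)) \<le> c * norm (q j x)"
  shows "norm (T x) \<le> c * norm x"
proof -
  have "(norm (T x))\<^sup>2 = (\<Sum>j<n. (norm (T (q j x)))\<^sup>2)"
    unfolding partition_norm[OF q, of "T x"] using comm by (intro sum.cong refl) (simp add: commutes_def)
  also have "\<dots> \<le> (\<Sum>j<n. (c * norm (q j x))\<^sup>2)"
    using le by (intro sum_mono power_mono) auto
  also have "\<dots> = (c * norm x)\<^sup>2"
    by (simp add: power_mult_distrib partition_norm[OF q, of x] sum_distrib_left)
  finally show ?thesis by (rule power2_le_imp_le) (use c in simp)
qed

lemma partition_norm_ge:
  assumes q: "partition n q" and comm: "\<And>j. j < n \<Longrightarrow> commutes (q j) T" and c: "c \<ge> 0"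
    and ge: "\<And>j. j < n \<Longrightarrow> c * norm (q j x) \<le> norm (T (q j x))"
  shows "c * norm x \<le> norm (T x)"
proof -
  have "(c * norm x)\<^sup>2 = (\<Sum>j<n. (c * norm (q j x))\<^sup>2)"
    by (simp add: power_mult_distrib partition_norm[OF q, of x] sum_distrib_left)
  also have "\<dots> \<le> (\<Sum>j<n. (norm (T (q j x)))\<^sup>2)"
    using ge c by (intro sum_mono power_mono) auto
  also have "\<dots> = (norm (T x))\<^sup>2"
    unfolding partition_norm[OF q, of "T x"] using comm by (intro sum.cong refl) (simp add: commutes_def)
  finally show ?thesis by (rule power2_le_imp_le) simp
qed

end

section \<open>Complex scalars as operators, and von Neumann algebras as commutants\<close>

definition scalar_op :: "complex \<Rightarrow> 'a::complex_hilbert_space operator" where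
  "scalar_op c = Blinfun (scaleC c)"

lemma inner_scaleC: "inner (scaleC c x) y = inner x (scaleC (cnj c) (y :: 'a::complex_hilbert_space))"
  unfolding Re_cinner[symmetric] cinner_scaleC_left cinner_scaleC_right by simp

lemma norm_scaleC: "norm (scaleC c x) = cmod c * norm (x :: 'a::complex_hilbert_space)"
proof -
  have "(norm (scaleC c x))\<^sup>2 = inner x (scaleC (cnj c * c) x)"
    by (simp add: power2_norm_eq_inner inner_scaleC scaleC_scaleC)
  also have "cnj c * c = complex_of_real ((cmod c)\<^sup>2)"
    by (simp add: complex_norm_square mult.commute del: of_real_power)
  also have "inner x (scaleC \<dots> x) = (cmod c * norm x)\<^sup>2"
    by (simp only: scaleC_of_real inner_scaleR_right) (simp add: power_mult_distrib power2_norm_eq_inner)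
  finally show ?thesis by (simp add: power2_eq_iff_nonneg)
qed

lemma scalar_op_apply [simp]: "scalar_op c x = scaleC c x"
proof -
  have "bounded_linear (scaleC c :: 'a \<Rightarrow> 'a)"
  proof (rule bounded_linear_intro[where K = "cmod c"])
    show "scaleC c (r *\<^sub>R x) = r *\<^sub>R scaleC c x" for r and x :: 'a
      by (simp add: scaleC_scaleC mult.commute flip: scaleC_of_real)
  qed (simp_all add: scaleC_add_right norm_scaleC)
  then show ?thesis by (simp add: scalar_op_def bounded_linear_Blinfun_apply)
qed

lemma radj_scalar_op: "radj (scalar_op c) = scalar_op (cnj c)"
  by (rule radj_eqI) (simp add: inner_scaleC)

lemma scalar_op_of_real: "scalar_op (complex_of_real r) = r *\<^sub>R id_blinfun"
  by (rule blinfun_eqI) (simp add: scaleC_of_real blinfun.bilinear_simps)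

lemma scalar_op_diff: "scalar_op (c - d) = scalar_op c - scalar_op d"
  by (intro blinfun_eqI) (simp add: blinfun.bilinear_simps eq_diff_eq flip: scaleC_add_left)

lemma bounded_operators_iff: "T \<in> bounded_operators \<longleftrightarrow> (\<forall>c. commutes T (scalar_op c))"
  by (simp add: bounded_operators_def commutes_def)

text \<open>The imaginary part of \<open>cinner x y\<close> is, up to sign, the real inner product
  of \<open>\<i> x\<close> with \<open>y\<close>. For complex-linear \<open>T\<close> the defining
  identity of the real adjoint therefore carries over to \<open>cinner\<close>.\<close>

lemma adj_eq_radj:
  assumes T: "T \<in> bounded_operators"
  shows "adj T = radj T"
proof -
  have comm: "commutes (radj T) (scalar_op c)" for c
    using T commutes_radj[of T "scalar_op (cnj c)"] by (simp add: bounded_operators_iff radj_scalar_op)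
  have "radj T \<in> bounded_operators" using comm by (simp add: bounded_operators_iff)
  moreover have "cinner (T x) y = cinner x (radj T y)" for x y
    unfolding complex_eq_iff Re_cinner Im_cinner
    using T by (simp add: inner_radj bounded_operators_def flip: inner_radj)
  ultimately show ?thesis
    unfolding adj_def using adjoint_exists[OF T] by (intro the1_equality) blast+
qed

locale complex_vn_algebra =
  fixes M :: "'a::complex_hilbert_space operator set"
  assumes vn: "von_neumann_algebra M"
begin

lemma bounded: "T \<in> M \<Longrightarrow> T \<in> bounded_operators"
  using vn by (auto simp: von_neumann_algebra_def)

lemma adj_mem: "T \<in> M \<Longrightarrow> adj T = radj T \<and> radj T \<in> M"
  using vn adj_eq_radj[OF bounded] unfolding von_neumann_algebra_def by metis

lemma commutant_iff: "T \<in> commutant B \<longleftrightarrow> T \<in> bounded_operators \<and> (\<forall>S\<in>B. commutes T S)"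
  by (auto simp: commutant_def commutes_iff)

sublocale operator_algebra "commutant M \<union> range scalar_op" M
proof
  show "radj S \<in> commutant M \<union> range scalar_op" if "S \<in> commutant M \<union> range scalar_op" for S
  proof (cases "S \<in> commutant M")
    case True
    have "commutes (radj S) (scalar_op c)" for c
      using True commutes_radj[of S "scalar_op (cnj c)"]
      by (simp add: commutant_iff bounded_operators_iff radj_scalar_op)
    moreover have "commutes (radj S) T" if "T \<in> M" for T
      using True adj_mem[OF that] commutes_radj[of S "radj T"] by (simp add: commutant_iff)
    ultimately show ?thesis by (simp add: commutant_iff bounded_operators_iff)
  next
    case False
    then show ?thesis using that radj_scalar_op by auto
  qed
  show "T \<in> M \<longleftrightarrow> (\<forall>S\<in>commutant M \<union> range scalar_op. commutes T S)" for T
  proof -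
    have "T \<in> M \<longleftrightarrow> T \<in> commutant (commutant M)" using vn by (simp add: von_neumann_algebra_def)
    then show ?thesis by (auto simp: commutant_iff bounded_operators_iff)
  qed
qed

lemma scalar_mem: "scalar_op c \<in> M"
  unfolding mem_iff
  by (auto simp: commutant_iff bounded_operators_iff commutes_def scaleC_scaleC mult.commute)

lemma scalar_commutes: "T \<in> M \<Longrightarrow> T (scaleC c x) = scaleC c (T x)"
  using bounded by (auto simp: bounded_operators_def)

lemma center_iff: "z \<in> center M \<longleftrightarrow> z \<in> M \<and> (\<forall>T\<in>M. commutes z T)"
  using bounded by (auto simp: center_def commutant_iff)

lemma scalar_center: "scalar_op c \<in> center M"
  by (auto simp: center_iff scalar_mem commutes_def scalar_commutes)

lemma center_mem: "z \<in> center M \<Longrightarrow> z \<in> M" and center_commutes: "z \<in> center M \<Longrightarrow> T \<in> M \<Longrightarrow> z (T x) = T (z x)"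
  by (auto simp: center_iff commutes_def)

lemma centerI: "z \<in> M \<Longrightarrow> (\<And>T x. T \<in> M \<Longrightarrow> z (T x) = T (z x)) \<Longrightarrow> z \<in> center M"
  by (simp add: center_iff commutes_def)

lemma center_add: "z \<in> center M \<Longrightarrow> w \<in> center M \<Longrightarrow> z + w \<in> center M"
  by (rule centerI) (simp_all add: add_mem center_mem blinfun.bilinear_simps center_commutes)

lemma center_diff: "z \<in> center M \<Longrightarrow> w \<in> center M \<Longrightarrow> z - w \<in> center M"
  by (rule centerI) (simp_all add: diff_mem center_mem blinfun.bilinear_simps center_commutes)

lemma center_comp: "z \<in> center M \<Longrightarrow> w \<in> center M \<Longrightarrow> z o\<^sub>L w \<in> center M"
  by (rule centerI) (simp_all add: comp_mem center_mem, metis center_commutes)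

lemma center_zero: "0 \<in> center M" and center_id: "id_blinfun \<in> center M"
  by (auto simp: center_iff commutes_def zero_mem id_mem)

lemma center_sum: "(\<And>i. i \<in> I \<Longrightarrow> T i \<in> center M) \<Longrightarrow> (\<Sum>i\<in>I. T i) \<in> center M"
  by (induction I rule: infinite_finite_induct) (auto simp: center_zero center_add)

lemma center_radj: "z \<in> center M \<Longrightarrow> radj z \<in> center M"
  unfolding center_iff by (metis commutes_radj radj_mem radj_radj)

lemma central_projs_center: "f \<in> central_projs \<Longrightarrow> f \<in> center M"
  by (auto simp: center_iff central_projs_def projs_def)

lemma projections_eq: "projections M = projs"
  using adj_mem by (auto simp: projections_def projs_def orth_proj_iff)

lemma normal_iff: "h \<in> M \<Longrightarrow> normal_operator h \<longleftrightarrow> commutes (radj h) h"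
  using adj_mem bounded by (auto simp: normal_operator_def commutes_iff)

text \<open>Write \<open>k = A + \<i> B\<close>; normality makes the self-adjoint parts
  \<open>A\<close> and \<open>B\<close> commute. The products of their spectral bands form the
  partition, and each part contributes an error of \<open>\<delta> / 2\<close>.\<close>

lemma normal_partition:
  assumes k: "k \<in> M" "normal_operator k" and \<delta>: "\<delta> > 0"
  shows "\<exists>n q \<mu>. partition n q \<and> (\<forall>j<n. commutes (q j) k \<and>
    (\<forall>x. norm ((k - scalar_op (\<mu> j)) (q j x)) \<le> \<delta> * norm (q j x)))"
proof -
  define J :: "'a operator" where "J = scalar_op \<i>"
  have J: "J x = scaleC \<i> x" for x by (simp add: J_def)
  have kk: "radj k (k x) = k (radj k x)" for x using k by (simp add: normal_iff commutes_def)
  have Jk: "k (J x) = J (k x)" "radj k (J x) = J (radj k x)" for x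
    using scalar_commutes[OF k(1)] scalar_commutes[OF radj_mem[OF k(1)]] by (simp_all add: J)
  have JJ: "J (J x) = - x" for x
    using scaleC_of_real[of "-1" x] by (simp add: J scaleC_scaleC)
  have "scalar_op 0 = (0 :: 'a operator)" using scalar_op_of_real[of 0] by simp
  then have rJ: "radj J = - J"
    using scalar_op_diff[of 0 \<i>, where 'a = 'a] by (simp add: J_def radj_scalar_op)
  define A where "A = (1/2) *\<^sub>R (k + radj k)"
  \<comment> \<open>\<open>J\<close> is multiplication by \<open>\<i>\<close>, so this is the
    imaginary part \<open>(k - radj k) / (2 \<i>)\<close>.\<close>
  define B where "B = (1/2) *\<^sub>R (J o\<^sub>L (radj k - k))"
  have A: "A x = (1/2) *\<^sub>R (k x + radj k x)" and B: "B x = (1/2) *\<^sub>R J (radj k x - k x)" for x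
    by (simp_all add: A_def B_def blinfun.bilinear_simps)
  have AB: "A x + J (B x) = k x" for x
  proof -
    have "J (B x) = (1/2) *\<^sub>R (k x - radj k x)" by (simp add: B blinfun.bilinear_simps JJ)
    then have "A x + J (B x) = (1/2) *\<^sub>R (k x + k x)" by (simp add: A algebra_simps)
    also have "\<dots> = k x" by (simp flip: scaleR_2)
    finally show ?thesis .
  qed
  have sA: "selfadj A" by (simp add: selfadj_iff A_def add.commute)
  have "radj B x = B x" for x
    by (simp add: B_def rJ blinfun.bilinear_simps Jk)
  then have sB: "selfadj B" by (simp add: selfadj_iff blinfun_eq_iff)
  have comm: "commutes S A \<and> commutes S B" if "commutes S k" "commutes S (radj k)" "commutes S J" for S
    using that by (simp add: commutes_def A B blinfun.bilinear_simps)
  have commk: "commutes k k" "commutes k (radj k)" "commutes k J"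
    using kk Jk by (simp_all add: commutes_def)
  have commJ: "commutes J k" "commutes J (radj k)" "commutes J J"
    using Jk by (simp_all add: commutes_def)
  have commA: "commutes A B" by (simp add: commutes_def A B blinfun.bilinear_simps kk Jk algebra_simps)
  from selfadj_partition[OF sA, of "\<delta>/2"] \<delta> obtain n1 :: nat and r t where
    r: "\<forall>j<n1. orth_proj (r j) \<and> (\<forall>S. commutes S A \<longrightarrow> commutes S (r j))"
    "\<forall>i<n1. \<forall>j<n1. i \<noteq> j \<longrightarrow> (\<forall>x. r i (r j x) = 0)" "\<forall>x. (\<Sum>j<n1. r j x) = x"
    "\<forall>j<n1. \<forall>x. norm (A (r j x) - t j *\<^sub>R r j x) \<le> \<delta>/2 * norm (r j x)" by auto
  from selfadj_partition[OF sB, of "\<delta>/2"] \<delta> obtain n2 :: nat and r' t' where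
    r': "\<forall>j<n2. orth_proj (r' j) \<and> (\<forall>S. commutes S B \<longrightarrow> commutes S (r' j))"
    "\<forall>i<n2. \<forall>j<n2. i \<noteq> j \<longrightarrow> (\<forall>x. r' i (r' j x) = 0)" "\<forall>x. (\<Sum>j<n2. r' j x) = x"
    "\<forall>j<n2. \<forall>x. norm (B (r' j x) - t' j *\<^sub>R r' j x) \<le> \<delta>/2 * norm (r' j x)" by auto
  have AM: "A \<in> M" unfolding A_def by (intro scaleR_mem add_mem k(1) radj_mem)
  have BM: "B \<in> M" unfolding B_def J_def by (intro scaleR_mem comp_mem diff_mem k(1) radj_mem scalar_mem)
  have rM: "r i \<in> projs" if "i < n1" for i
    using r(1) that AM unfolding projs_def mem_iff by (blast intro: commutes_sym)
  have r'M: "r' i \<in> projs" if "i < n2" for i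
    using r'(1) that BM unfolding projs_def mem_iff by (blast intro: commutes_sym)
  have rB: "commutes (r i) B" if "i < n1" for i
    using r(1) that commutes_sym[OF commA] commutes_sym by blast
  have rr': "r i (r' j x) = r' j (r i x)" if "i < n1" "j < n2" for i j x
    using r'(1) that rB commutes_def by blast
  have rk: "commutes (r i) k" if "i < n1" for i
    using r(1) that comm[OF commk] commutes_sym by blast
  have r'k: "commutes (r' i) k" if "i < n2" for i
    using r'(1) that comm[OF commk] commutes_sym by blast
  define I where "I = {..<n1} \<times> {..<n2}"
  have finI: "finite I" by (simp add: I_def)
  obtain \<beta> where \<beta>: "bij_betw \<beta> {..<card I} I"
    using ex_bij_betw_nat_finite[OF finI] by (auto simp: lessThan_atLeast0)
  have \<beta>I: "fst (\<beta> l) < n1" "snd (\<beta> l) < n2" if "l < card I" for l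
  proof -
    have "\<beta> l \<in> I" using bij_betwE[OF \<beta>] that by blast
    then show "fst (\<beta> l) < n1" "snd (\<beta> l) < n2" unfolding I_def by (simp_all add: mem_Times_iff)
  qed
  have \<beta>_inj: "\<beta> i \<noteq> \<beta> j" if "i < card I" "j < card I" "i \<noteq> j" for i j
    using \<beta> that by (auto simp: bij_betw_def inj_on_def)
  define q where "q = (\<lambda>l. r (fst (\<beta> l)) o\<^sub>L r' (snd (\<beta> l)))"
  have qx: "q l x = r (fst (\<beta> l)) (r' (snd (\<beta> l)) x)" for l x by (simp add: q_def)
  have q: "partition (card I) q"
    unfolding partition_def
  proof (intro conjI allI impI)
    show "q l \<in> projs" if "l < card I" for l
    proof -
      have "orth_proj (q l)" unfolding q_def
        using rM[OF \<beta>I(1)[OF that]] r'M[OF \<beta>I(2)[OF that]] rr'[OF \<beta>I[OF that]]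
        by (intro orth_proj_comp) (auto simp: projs_def commutes_def)
      then show ?thesis
        using rM[OF \<beta>I(1)[OF that]] r'M[OF \<beta>I(2)[OF that]] by (simp add: projs_def q_def comp_mem)
    qed
    show "q i (q j x) = 0" if ij: "i < card I" "j < card I" "i \<noteq> j" for i j x
    proof -
      have e: "q i (q j x) = r (fst (\<beta> i)) (r (fst (\<beta> j)) (r' (snd (\<beta> i)) (r' (snd (\<beta> j)) x)))"
        using rr'[OF \<beta>I(1)[OF ij(2)] \<beta>I(2)[OF ij(1)]] by (simp add: qx)
      have "fst (\<beta> i) \<noteq> fst (\<beta> j) \<or> snd (\<beta> i) \<noteq> snd (\<beta> j)" using \<beta>_inj[OF ij] by (auto simp: prod_eq_iff)
      then show ?thesis
        unfolding e using r(2) r'(2) \<beta>I[OF ij(1)] \<beta>I[OF ij(2)] by (auto simp: blinfun.bilinear_simps)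
    qed
    show "(\<Sum>j<card I. q j x) = x" for x
    proof -
      have "(\<Sum>l<card I. q l x) = (\<Sum>(i, j)\<in>I. r i (r' j x))"
        using sum.reindex_bij_betw[OF \<beta>, of "\<lambda>(i, j). r i (r' j x)"] by (simp add: qx case_prod_unfold)
      also have "\<dots> = (\<Sum>i<n1. r i (\<Sum>j<n2. r' j x))"
        by (simp add: I_def blinfun.bilinear_simps flip: sum.cartesian_product)
      finally show ?thesis using r(3) r'(3) by simp
    qed
  qed
  define \<mu> where "\<mu> = (\<lambda>l. Complex (t (fst (\<beta> l))) (t' (snd (\<beta> l))))"
  have "commutes (q l) k \<and> norm ((k - scalar_op (\<mu> l)) (q l x)) \<le> \<delta> * norm (q l x)" if l: "l < card I" for l x
  proof
    show "commutes (q l) k"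
      using rk[OF \<beta>I(1)[OF l]] r'k[OF \<beta>I(2)[OF l]] by (simp add: commutes_def qx)
    define i j where "i = fst (\<beta> l)" and "j = snd (\<beta> l)"
    have ij: "i < n1" "j < n2" using \<beta>I[OF l] by (auto simp: i_def j_def)
    define y where "y = q l x"
    have y: "r i y = y" "r' j y = y"
      using projsD(3)[OF rM[OF ij(1)]] projsD(3)[OF r'M[OF ij(2)]] rr'[OF ij]
      by (simp_all add: y_def qx i_def j_def)
    have "scaleC (\<mu> l) y = t i *\<^sub>R y + J (t' j *\<^sub>R y)"
    proof -
      have "\<mu> l = complex_of_real (t i) + \<i> * complex_of_real (t' j)"
        by (simp add: \<mu>_def i_def j_def complex_eq_iff)
      then show ?thesis by (simp add: scaleC_add_left scaleC_of_real J flip: scaleC_scaleC)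
    qed
    then have "(k - scalar_op (\<mu> l)) y = (A y - t i *\<^sub>R y) + J (B y - t' j *\<^sub>R y)"
      by (simp add: blinfun.bilinear_simps AB[symmetric])
    then have "norm ((k - scalar_op (\<mu> l)) y) \<le> norm (A y - t i *\<^sub>R y) + norm (B y - t' j *\<^sub>R y)"
      using norm_triangle_ineq[of "A y - t i *\<^sub>R y" "J (B y - t' j *\<^sub>R y)"] by (simp add: J norm_scaleC)
    also have "\<dots> \<le> \<delta>/2 * norm y + \<delta>/2 * norm y"
      using r(4)[rule_format, OF ij(1), of y] r'(4)[rule_format, OF ij(2), of y] by (simp add: y)
    finally show "norm ((k - scalar_op (\<mu> l)) (q l x)) \<le> \<delta> * norm (q l x)" by (simp add: y_def)
  qed
  with q show ?thesis by (intro exI[of _ "card I"] exI[of _ q] exI[of _ \<mu>]) blast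
qed

end

section \<open>The essential central spectrum\<close>

lemma operator_ring_simps:
  "carrier (operator_ring A) = A" "mult (operator_ring A) = (o\<^sub>L)" "one (operator_ring A) = id_blinfun"
  "zero (operator_ring A) = 0" "add (operator_ring A) = (+)"
  by (simp_all add: operator_ring_def)

lemma operator_idealI:
  assumes A: "ring (operator_ring A)" and I: "I \<subseteq> A" "0 \<in> I"
    and add: "\<And>x y. x \<in> I \<Longrightarrow> y \<in> I \<Longrightarrow> x + y \<in> I" and minus: "\<And>x. x \<in> I \<Longrightarrow> - x \<in> I"
    and l: "\<And>a x. a \<in> A \<Longrightarrow> x \<in> I \<Longrightarrow> a o\<^sub>L x \<in> I" and r: "\<And>a x. a \<in> A \<Longrightarrow> x \<in> I \<Longrightarrow> x o\<^sub>L a \<in> I"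
  shows "ideal I (operator_ring A)"
proof (rule idealI[OF A])
  interpret ring "operator_ring A" by fact
  show "subgroup I (add_monoid (operator_ring A))"
  proof (rule subgroup.intro)
    show "inv\<^bsub>add_monoid (operator_ring A)\<^esub> x \<in> I" if "x \<in> I" for x
    proof -
      have "inv\<^bsub>add_monoid (operator_ring A)\<^esub> x = - x"
        unfolding a_inv_def[symmetric]
        using that I minus[OF that] by (intro minus_equality) (auto simp: operator_ring_simps)
      then show ?thesis using minus[OF that] by simp
    qed
  qed (use I add in \<open>auto simp: operator_ring_simps\<close>)
qed (use l r in \<open>auto simp: operator_ring_simps\<close>)

lemma operator_idealD:
  assumes "ideal I (operator_ring A)"
  shows "I \<subseteq> A" "0 \<in> I" "x \<in> I \<Longrightarrow> y \<in> I \<Longrightarrow> x + y \<in> I"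
    "a \<in> A \<Longrightarrow> x \<in> I \<Longrightarrow> a o\<^sub>L x \<in> I" "a \<in> A \<Longrightarrow> x \<in> I \<Longrightarrow> x o\<^sub>L a \<in> I"
proof -
  interpret ideal I "operator_ring A" by fact
  show "I \<subseteq> A" using a_subset by (simp add: operator_ring_simps)
  show "0 \<in> I" using additive_subgroup.zero_closed[OF is_additive_subgroup] by (simp add: operator_ring_simps)
  show "x + y \<in> I" if "x \<in> I" "y \<in> I"
    using additive_subgroup.a_closed[OF is_additive_subgroup that] by (simp add: operator_ring_simps)
  show "a o\<^sub>L x \<in> I" if "a \<in> A" "x \<in> I" using I_l_closed[of x a] that by (simp add: operator_ring_simps)
  show "x o\<^sub>L a \<in> I" if "a \<in> A" "x \<in> I" using I_r_closed[of x a] that by (simp add: operator_ring_simps)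
qed

lemma operator_coset: "I +>\<^bsub>operator_ring A\<^esub> a = (\<lambda>x. x + a) ` I"
  by (auto simp: a_r_coset_def' operator_ring_simps)

text \<open>The lower bound makes \<open>T\<close> injective with closed range. By normality
  \<open>radj T x\<close> and \<open>T x\<close> have the same norm, so \<open>radj T\<close> is
  injective too and the range is dense.\<close>

lemma bounded_below_inverse:
  fixes T :: "'a::{real_inner,banach} operator"
  assumes T: "commutes (radj T) T" and c: "c > 0" and below: "\<And>x. c * norm x \<le> norm (T x)"
  shows "\<exists>B. (\<forall>x. blinfun_apply B (T x) = x) \<and> (\<forall>x. T (blinfun_apply B x) = x) \<and> (\<forall>S. commutes S T \<longrightarrow> commutes S B)"
proof -
  have norm_radj: "norm (radj T x) = norm (T x)" for x
  proof -
    have "(norm (radj T x))\<^sup>2 = inner (radj (radj T) (radj T x)) x" by (rule norm_radj_apply_square)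
    also have "\<dots> = (norm (T x))\<^sup>2" using T by (simp only: radj_radj norm_radj_apply_square commutes_def)
    finally show ?thesis by simp
  qed
  have inj: "x = y" if "T x = T y" for x y
  proof -
    have "c * norm (x - y) \<le> 0" using below[of "x - y"] that by (simp add: blinfun.bilinear_simps)
    then show ?thesis using c by (simp add: mult_le_0_iff)
  qed
  have "subspace (range (blinfun_apply T))"
    unfolding subspace_def
  proof (intro conjI ballI allI)
    show "0 \<in> range (blinfun_apply T)" using blinfun.zero_right[of T] by (metis rangeI)
    show "x + y \<in> range (blinfun_apply T)" if "x \<in> range (blinfun_apply T)" "y \<in> range (blinfun_apply T)" for x y
      using that by (auto simp flip: blinfun.add_right)
    show "r *\<^sub>R x \<in> range (blinfun_apply T)" if "x \<in> range (blinfun_apply T)" for r x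
      using that by (auto simp flip: blinfun.scaleR_right)
  qed
  moreover have "closed (range (blinfun_apply T))"
    unfolding closed_sequential_limits
  proof (intro allI impI, elim conjE)
    fix y l assume y: "\<forall>n::nat. y n \<in> range (blinfun_apply T)" "y \<longlonglongrightarrow> l"
    then have "\<forall>n. \<exists>x. y n = T x" by blast
    from choice[OF this] obtain x where x: "\<And>n. y n = T (x n)" by blast
    have "Cauchy x"
    proof (rule metric_CauchyI)
      fix e :: real assume e: "e > 0"
      have "Cauchy y" using y(2) by (rule LIMSEQ_imp_Cauchy)
      then obtain K where K: "\<And>m n. m \<ge> K \<Longrightarrow> n \<ge> K \<Longrightarrow> dist (y m) (y n) < c * e"
        using e c metric_CauchyD[of y "c * e"] by auto
      have "dist (x m) (x n) < e" if "m \<ge> K" "n \<ge> K" for m n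
      proof -
        have "c * norm (x m - x n) \<le> norm (T (x m - x n))" by (rule below)
        also have "\<dots> < c * e" using K[OF that] by (simp add: x dist_norm blinfun.bilinear_simps)
        finally show ?thesis using c by (simp add: dist_norm)
      qed
      then show "\<exists>M. \<forall>m\<ge>M. \<forall>n\<ge>M. dist (x m) (x n) < e" by blast
    qed
    then obtain x' where "x \<longlonglongrightarrow> x'" using Cauchy_convergent convergent_def by blast
    then have "(\<lambda>n. T (x n)) \<longlonglongrightarrow> T x'" by (intro blinfun.tendsto tendsto_const)
    then have "l = T x'" using y(2) LIMSEQ_unique by (simp add: x[symmetric])
    then show "l \<in> range (blinfun_apply T)" by blast
  qed
  ultimately obtain p where p: "orth_proj p" "range (blinfun_apply p) = range (blinfun_apply T)"
    using orth_proj_exists by blast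
  have surj: "\<exists>x. T x = y" for y
  proof -
    have "inner (radj T (y - p y)) x = 0" for x
    proof -
      obtain w where "T x = p w" using p(2) by blast
      then show ?thesis using orth_projD[OF p(1)]
        by (simp add: inner_radj' inner_diff_left)
    qed
    then have "radj T (y - p y) = 0" by (metis inner_eq_zero_iff)
    then have "T (y - p y) = T 0" using norm_radj[of "y - p y"] by (simp add: blinfun.bilinear_simps)
    then have "y - p y = 0" by (rule inj)
    then have "y \<in> range (blinfun_apply p)" by (metis eq_iff_diff_eq_0 rangeI)
    then show ?thesis using p(2) by auto
  qed
  then obtain b where b: "\<And>y. T (b y) = y" by metis
  have lin: "bounded_linear b"
  proof (rule bounded_linear_intro[where K = "1 / c"])
    show "b (x + y) = b x + b y" for x y by (rule inj) (simp add: b blinfun.bilinear_simps)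
    show "b (r *\<^sub>R x) = r *\<^sub>R b x" for r x by (rule inj) (simp add: b blinfun.bilinear_simps)
    show "norm (b x) \<le> norm x * (1 / c)" for x using below[of "b x"] c by (simp add: b field_simps)
  qed
  have bT: "b (T x) = x" for x by (rule inj) (simp add: b)
  have "commutes S (Blinfun b)" if "commutes S T" for S
  proof -
    have "S (b x) = b (S x)" for x
    proof (rule inj)
      have "T (S (b x)) = S (T (b x))" using that by (simp only: commutes_def)
      then show "T (S (b x)) = T (b (S x))" by (simp add: b)
    qed
    then show ?thesis by (simp add: commutes_def bounded_linear_Blinfun_apply[OF lin])
  qed
  then show ?thesis using b bT
    by (intro exI[of _ "Blinfun b"]) (simp add: bounded_linear_Blinfun_apply[OF lin])
qed

section \<open>Closed ideals and cuts by central projections\<close>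

context complex_vn_algebra
begin

lemma bicommutant_mem:
  assumes T: "T \<in> M" and B: "\<And>S. commutes S T \<Longrightarrow> commutes S B"
  shows "B \<in> M"
  unfolding mem_iff
proof
  fix S assume "S \<in> commutant M \<union> range scalar_op"
  then have "commutes T S" using T unfolding mem_iff by blast
  from B[OF commutes_sym[OF this]] show "commutes B S" by (rule commutes_sym)
qed

lemma bicommutant_center:
  assumes T: "T \<in> center M" and B: "\<And>S. commutes S T \<Longrightarrow> commutes S B"
  shows "B \<in> center M"
  unfolding center_iff
proof (intro conjI ballI)
  show "B \<in> M" using center_mem[OF T] B by (rule bicommutant_mem)
  fix S assume "S \<in> M"
  then have "commutes T S" using T unfolding center_iff by blast
  from B[OF commutes_sym[OF this]] show "commutes B S" by (rule commutes_sym)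
qed

lemma closed_algebra: "closed M"
proof -
  have "M = (\<Inter>S\<in>commutant M \<union> range scalar_op. {T. T o\<^sub>L S = S o\<^sub>L T})"
    by (auto simp: mem_iff commutes_iff)
  moreover have "closed {T :: 'a operator. T o\<^sub>L S = S o\<^sub>L T}" for S
    by (intro closed_Collect_eq bounded_bilinear.continuous_on[OF bounded_bilinear_blinfun_compose] continuous_intros)
  ultimately show ?thesis by (metis (no_types, lifting) closed_INT)
qed

lemma ideal_closed_ideal_generated:
  assumes "S \<subseteq> M"
  shows "ideal (closed_ideal_generated M S) (operator_ring M)" and "S \<subseteq> closed_ideal_generated M S"
proof -
  interpret ring "operator_ring M" by (rule ring_operator_ring(1)[OF vn])
  have "ideal M (operator_ring M)" using oneideal by (simp add: operator_ring_simps)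
  then have "M \<in> {I. ideal I (operator_ring M) \<and> closed I \<and> S \<subseteq> I}"
    using closed_algebra assms by blast
  then show "ideal (closed_ideal_generated M S) (operator_ring M)"
    unfolding closed_ideal_generated_def by (intro i_Intersect) auto
  show "S \<subseteq> closed_ideal_generated M S" by (auto simp: closed_ideal_generated_def)
qed

text \<open>The zero ideal is closed and contains all finite projections, so
  \<open>finite_ideal M\<close> contributes nothing to the sum.\<close>

lemma essential_ideal_type_III:
  assumes III: "type_III M" and \<zeta>: "\<zeta> \<subseteq> M"
  shows "essential_ideal M \<zeta> = closed_ideal_generated M \<zeta>"
proof -
  interpret ring "operator_ring M" by (rule ring_operator_ring(1)[OF vn])
  have "ideal {0} (operator_ring M)" using zeroideal by (simp add: operator_ring_simps)
  moreover have "{p. finite_projection M p} \<subseteq> {0}" using III by (auto simp: type_III_def)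
  ultimately have "finite_ideal M \<subseteq> {0}"
    unfolding finite_ideal_def closed_ideal_generated_def by (intro Inter_lower) auto
  moreover have "{p. finite_projection M p} \<subseteq> M"
    by (auto simp: finite_projection_def projections_def)
  then have "0 \<in> finite_ideal M"
    unfolding finite_ideal_def using operator_idealD(2) ideal_closed_ideal_generated(1) by blast
  ultimately have "finite_ideal M = {0}" by blast
  then show ?thesis by (auto simp: essential_ideal_def set_add_def set_mult_def operator_ring_simps)
qed

text \<open>Zorn's lemma is applied to the proper ideals of the center above the annihilator of
  \<open>f\<close>. That annihilator is proper because \<open>f\<close> is nonzero, and it contains
  \<open>1 - f\<close>.\<close>

lemma maximal_ideal_exists:
  assumes f: "f \<in> central_projs" "f \<noteq> 0"
  shows "\<exists>\<zeta>\<in>maximal_ideal_space (center M). id_blinfun - f \<in> \<zeta>"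
proof -
  have Zring: "ring (operator_ring (center M))" by (rule ring_operator_ring(2)[OF vn])
  note fZ = central_projs_center[OF f(1)]
  define J where "J = {z \<in> center M. z o\<^sub>L f = 0}"
  have J: "ideal J (operator_ring (center M))"
  proof (rule operator_idealI[OF Zring])
    show "a o\<^sub>L x \<in> J" if "a \<in> center M" "x \<in> J" for a x
      using that by (auto simp: J_def center_comp blinfun_eq_iff blinfun.bilinear_simps)
    show "x o\<^sub>L a \<in> J" if "a \<in> center M" "x \<in> J" for a x
    proof -
      have "(x o\<^sub>L a) o\<^sub>L f = a o\<^sub>L (x o\<^sub>L f)"
        using that center_commutes[of x a] center_mem[of a] by (simp add: J_def blinfun_eq_iff)
      then show ?thesis using that by (auto simp: J_def center_comp blinfun_eq_iff blinfun.bilinear_simps)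
    qed
    show "- x \<in> J" if "x \<in> J" for x
      using that center_diff[OF center_zero, of x] by (auto simp: J_def blinfun_eq_iff blinfun.bilinear_simps)
  qed (auto simp: J_def center_zero center_add blinfun_eq_iff blinfun.bilinear_simps)
  define \<A> where "\<A> = {I. ideal I (operator_ring (center M)) \<and> J \<subseteq> I \<and> id_blinfun \<notin> I}"
  have "\<exists>I\<in>\<A>. \<forall>X\<in>\<A>. I \<subseteq> X \<longrightarrow> X = I"
  proof (rule subset_Zorn_nonempty)
    have "id_blinfun \<notin> J" using f(2) by (auto simp: J_def blinfun_eq_iff)
    then show "\<A> \<noteq> {}" using J by (auto simp: \<A>_def)
    fix \<C> assume ne: "\<C> \<noteq> {}" and chain: "subset.chain \<A> \<C>"
    have sub: "ideal I (operator_ring (center M))" "J \<subseteq> I" "id_blinfun \<notin> I" if "I \<in> \<C>" for I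
      using chain that by (auto simp: subset.chain_def \<A>_def)
    note D = operator_idealD[OF sub(1)]
    have "ideal (\<Union>\<C>) (operator_ring (center M))"
    proof (rule operator_idealI[OF Zring])
      show "\<Union>\<C> \<subseteq> center M" using D(1) by blast
      show "0 \<in> \<Union>\<C>" using ne D(2) by blast
      show "x + y \<in> \<Union>\<C>" if "x \<in> \<Union>\<C>" "y \<in> \<Union>\<C>" for x y
      proof -
        from that obtain I1 I2 where I: "I1 \<in> \<C>" "I2 \<in> \<C>" "x \<in> I1" "y \<in> I2" by blast
        then have "I1 \<subseteq> I2 \<or> I2 \<subseteq> I1" using chain by (auto simp: subset.chain_def)
        then show ?thesis using I D(3) by blast
      qed
      show "- x \<in> \<Union>\<C>" if "x \<in> \<Union>\<C>" for x
      proof -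
        from that obtain I where I: "I \<in> \<C>" "x \<in> I" by blast
        have "- id_blinfun \<in> center M" using center_diff[OF center_zero center_id] by simp
        from D(4)[OF I(1) this I(2)] have "- x \<in> I"
          by (metis (no_types, lifting) blinfun_apply_blinfun_compose blinfun_eqI blinfun.minus_left id_blinfun.rep_eq id_apply)
        with I show ?thesis by blast
      qed
      show "a o\<^sub>L x \<in> \<Union>\<C>" "x o\<^sub>L a \<in> \<Union>\<C>" if "a \<in> center M" "x \<in> \<Union>\<C>" for a x
        using that D(4,5) by blast+
    qed
    then show "\<Union>\<C> \<in> \<A>" using ne sub(2,3) by (auto simp: \<A>_def)
  qed
  then obtain \<zeta> where \<zeta>: "\<zeta> \<in> \<A>" "\<And>X. X \<in> \<A> \<Longrightarrow> \<zeta> \<subseteq> X \<Longrightarrow> X = \<zeta>" by blast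
  have "maximalideal \<zeta> (operator_ring (center M))"
  proof (rule maximalidealI)
    show "ideal \<zeta> (operator_ring (center M))" using \<zeta>(1) by (simp add: \<A>_def)
    show "carrier (operator_ring (center M)) \<noteq> \<zeta>"
      using \<zeta>(1) center_id by (auto simp: \<A>_def operator_ring_simps)
    show "X = \<zeta> \<or> X = carrier (operator_ring (center M))"
      if X: "ideal X (operator_ring (center M))" "\<zeta> \<subseteq> X" for X
    proof (cases "id_blinfun \<in> X")
      case True
      then show ?thesis using ideal.one_imp_carrier[OF X(1)] by (simp add: operator_ring_simps)
    next
      case False
      then have "X \<in> \<A>" using X \<zeta>(1) by (auto simp: \<A>_def)
      then show ?thesis using \<zeta>(2) X(2) by blast
    qed
  qed
  moreover have "id_blinfun - f \<in> J"
    using projsD(3)[OF central_projsD(1)[OF f(1)]]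
    by (simp add: J_def center_diff center_id fZ blinfun_eq_iff blinfun.bilinear_simps)
  ultimately show ?thesis using \<zeta>(1) by (auto simp: maximal_ideal_space_def \<A>_def)
qed

text \<open>\<open>f\<close> is the spectral projection of \<open>A = (radj w) w\<close> for values
  up to \<open>\<epsilon>\<^sup>2\<close>. On its complement \<open>A\<close> is bounded below and
  so invertible within the center, which exhibits \<open>1 - f\<close> as a multiple of
  \<open>w\<close>.\<close>

lemma central_ideal_cut:
  assumes \<zeta>: "ideal \<zeta> (operator_ring (center M))" and w: "w \<in> \<zeta>" and \<epsilon>: "\<epsilon> > 0"
  shows "\<exists>f\<in>central_projs. id_blinfun - f \<in> \<zeta> \<and> (\<forall>v. norm (w (f v)) \<le> \<epsilon> * norm v)"
proof -
  note \<zeta>D = operator_idealD[OF \<zeta>]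
  have wZ: "w \<in> center M" using \<zeta>D(1) w by blast
  define A where "A = radj w o\<^sub>L w"
  have AZ: "A \<in> center M" unfolding A_def by (intro center_comp center_radj wZ)
  have Aform: "inner (A x) x = (norm (w x))\<^sup>2" for x by (simp add: A_def norm_radj_apply_square)
  have sA: "selfadj A" by (simp add: selfadj_iff A_def)
  from spectral_cut[OF sA, of "\<epsilon>\<^sup>2"] obtain f where f: "orth_proj f" "\<forall>S. commutes S A \<longrightarrow> commutes S f"
    "\<forall>x. f x = x \<longrightarrow> inner (A x) x \<le> \<epsilon>\<^sup>2 * (norm x)\<^sup>2" "\<forall>x. f x = 0 \<longrightarrow> \<epsilon>\<^sup>2 * (norm x)\<^sup>2 \<le> inner (A x) x"
    by (elim exE conjE)
  have fZ: "f \<in> center M" using AZ f(2)[rule_format] by (rule bicommutant_center)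
  then have fM: "f \<in> M" and fcen: "f \<in> central_projs"
    using f(1) by (simp_all add: center_iff central_projs_def projs_def)
  note ff = orth_projD(1)[OF f(1)]
  have Af: "A (f x) = f (A x)" for x using center_commutes[OF AZ fM] .
  have small: "norm (w (f v)) \<le> \<epsilon> * norm v" for v
  proof -
    have "(norm (w (f v)))\<^sup>2 \<le> \<epsilon>\<^sup>2 * (norm (f v))\<^sup>2" using f(3) ff Aform by metis
    also have "\<dots> \<le> \<epsilon>\<^sup>2 * (norm v)\<^sup>2"
      using orth_proj_norm_le[OF f(1), of v] by (intro mult_left_mono power_mono) auto
    finally have "(norm (w (f v)))\<^sup>2 \<le> (\<epsilon> * norm v)\<^sup>2" by (simp add: power_mult_distrib)
    then show ?thesis by (rule power2_le_imp_le) (use \<epsilon> in simp)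
  qed
  define f' where "f' = id_blinfun - f"
  have f': "f' x = x - f x" for x by (simp add: f'_def blinfun.bilinear_simps)
  have f'Z: "f' \<in> center M" unfolding f'_def by (intro center_diff center_id fZ)
  \<comment> \<open>Adding \<open>f\<close> makes the operator bounded below on the whole space
    while leaving \<open>A\<close> unchanged on the complement of \<open>f\<close>, so a global
    inverse can be used there.\<close>
  define T where "T = (A o\<^sub>L f') + f"
  have T: "T x = A (f' x) + f x" for x by (simp add: T_def blinfun.bilinear_simps)
  have TZ: "T \<in> center M" unfolding T_def by (intro center_add center_comp AZ f'Z fZ)
  define m where "m = min (\<epsilon>\<^sup>2) 1"
  have m: "m > 0" "m \<le> \<epsilon>\<^sup>2" "m \<le> 1" using \<epsilon> by (simp_all add: m_def)
  have below: "m * norm x \<le> norm (T x)" for x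
  proof (cases "x = 0")
    case False
    have ff': "f (f' x) = 0" by (simp add: f' blinfun.bilinear_simps ff)
    have "inner (T x) x = inner (A (f' x)) (f' x) + (norm (f x))\<^sup>2"
    proof -
      have "inner (A (f' x)) (f x) = inner (A (f (f' x))) x"
        using orth_projD(2)[OF f(1)] by (simp add: Af)
      then have "inner (A (f' x)) (f x) = 0" by (simp add: ff' blinfun.bilinear_simps)
      then have "inner (A (f' x)) x = inner (A (f' x)) (f' x)" by (simp add: f' inner_diff_right)
      then show ?thesis by (simp add: T inner_add_left orth_proj_inner[OF f(1)])
    qed
    moreover have "\<epsilon>\<^sup>2 * (norm (f' x))\<^sup>2 \<le> inner (A (f' x)) (f' x)" using f(4) ff' by blast
    moreover have "m * (norm (f' x))\<^sup>2 \<le> \<epsilon>\<^sup>2 * (norm (f' x))\<^sup>2" "m * (norm (f x))\<^sup>2 \<le> 1 * (norm (f x))\<^sup>2"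
      using m by (intro mult_right_mono; simp)+
    moreover have "(norm x)\<^sup>2 = (norm (f x))\<^sup>2 + (norm (f' x))\<^sup>2"
      using orth_proj_pythagoras[OF f(1), of x] by (simp add: f')
    ultimately have "m * (norm x)\<^sup>2 \<le> inner (T x) x" by (simp add: distrib_left)
    also have "\<dots> \<le> norm (T x) * norm x" by (rule norm_cauchy_schwarz)
    finally have "(m * norm x) * norm x \<le> norm (T x) * norm x" by (simp add: power2_eq_square)
    then show ?thesis using False by simp
  qed simp
  have "commutes (radj T) T"
    using center_radj[OF TZ] center_mem[OF TZ] by (auto simp: center_iff)
  from bounded_below_inverse[OF this m(1) below] obtain B where B: "\<And>x. blinfun_apply B (T x) = x" "\<And>S. commutes S T \<Longrightarrow> commutes S B"
    by blast
  have "B \<in> center M" using TZ B(2) by (rule bicommutant_center)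
  then have "((B o\<^sub>L f') o\<^sub>L radj w) o\<^sub>L w \<in> \<zeta>"
    by (intro \<zeta>D(4) w center_comp center_radj wZ f'Z)
  moreover have "((B o\<^sub>L f') o\<^sub>L radj w) o\<^sub>L w = f'"
  proof (rule blinfun_eqI)
    fix x
    have "T (f' x) = f' (A x)"
      by (simp add: T f' blinfun.bilinear_simps ff Af)
    then have "B (f' (A x)) = f' x" using B(1)[of "f' x"] by simp
    then show "(((B o\<^sub>L f') o\<^sub>L radj w) o\<^sub>L w) x = f' x" by (simp add: A_def)
  qed
  ultimately show ?thesis using fcen small unfolding f'_def by auto
qed

text \<open>The operators with this property form a closed ideal of \<open>M\<close> containing
  \<open>\<zeta>\<close>. Centrality of \<open>f\<close> handles multiplication from the right, and
  sums use \<open>1 - f g = (1 - f) + f (1 - g)\<close>, which stays in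
  \<open>\<zeta>\<close>.\<close>

lemma closed_ideal_cut:
  assumes \<zeta>: "ideal \<zeta> (operator_ring (center M))" and x: "x \<in> closed_ideal_generated M \<zeta>" and \<epsilon>: "\<epsilon> > 0"
  shows "\<exists>f\<in>central_projs. id_blinfun - f \<in> \<zeta> \<and> (\<forall>v. norm (x (f v)) \<le> \<epsilon> * norm v)"
proof -
  note \<zeta>D = operator_idealD[OF \<zeta>]
  define cut where "cut = (\<lambda>x :: 'a operator. \<lambda>\<epsilon>. \<exists>f\<in>central_projs. id_blinfun - f \<in> \<zeta> \<and> (\<forall>v. norm (x (f v)) \<le> \<epsilon> * norm v))"
  define I where "I = {x \<in> M. \<forall>\<epsilon>>0. cut x \<epsilon>}"
  have "ideal I (operator_ring M)"
  proof (rule operator_idealI[OF ring_operator_ring(1)[OF vn]])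
    show "I \<subseteq> M" by (auto simp: I_def)
    have "cut 0 \<epsilon>" if "\<epsilon> > 0" for \<epsilon>
      unfolding cut_def using id_central \<zeta>D(2) that by (intro bexI[of _ id_blinfun]) auto
    then show "0 \<in> I" by (simp add: I_def zero_mem)
    show "x + y \<in> I" if xy: "x \<in> I" "y \<in> I" for x y
    proof -
      have "cut (x + y) \<epsilon>" if "\<epsilon> > 0" for \<epsilon>
      proof -
        have "cut x (\<epsilon>/2)" "cut y (\<epsilon>/2)" using xy that by (simp_all add: I_def)
        then obtain f g where f: "f \<in> central_projs" "id_blinfun - f \<in> \<zeta>" "\<And>v. norm (x (f v)) \<le> \<epsilon>/2 * norm v"
          and g: "g \<in> central_projs" "id_blinfun - g \<in> \<zeta>" "\<And>v. norm (y (g v)) \<le> \<epsilon>/2 * norm v"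
          unfolding cut_def by blast
        have fg: "f (g v) = g (f v)" for v using central_projsD(2)[OF f(1) projsD(1)[OF central_projsD(1)[OF g(1)]]] .
        have "(id_blinfun - f) + (f o\<^sub>L (id_blinfun - g)) \<in> \<zeta>"
          by (intro \<zeta>D(3,4) f g central_projs_center)
        moreover have "(id_blinfun - f) + (f o\<^sub>L (id_blinfun - g)) = id_blinfun - (f o\<^sub>L g)"
          by (rule blinfun_eqI) (simp add: blinfun.bilinear_simps)
        moreover have "norm ((x + y) ((f o\<^sub>L g) v)) \<le> \<epsilon> * norm v" for v
        proof -
          have "norm (x (f (g v))) \<le> \<epsilon>/2 * norm (g v)" "norm (y (g (f v))) \<le> \<epsilon>/2 * norm (f v)" using f g by auto
          moreover have "norm (g v) \<le> norm v" "norm (f v) \<le> norm v"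
            using orth_proj_norm_le projsD(2) central_projsD(1) f(1) g(1) by blast+
          moreover have "\<epsilon>/2 * norm (g v) \<le> \<epsilon>/2 * norm v" "\<epsilon>/2 * norm (f v) \<le> \<epsilon>/2 * norm v"
            using calculation(3,4) \<open>\<epsilon> > 0\<close> by (intro mult_left_mono; simp)+
          ultimately show ?thesis
            using norm_triangle_ineq[of "x (f (g v))" "y (g (f v))"] by (simp add: blinfun.bilinear_simps fg)
        qed
        ultimately show ?thesis unfolding cut_def using central_comp[OF f(1) g(1)] by (intro bexI[of _ "f o\<^sub>L g"]) auto
      qed
      then show ?thesis using xy by (simp add: I_def add_mem)
    qed
    show "- x \<in> I" if "x \<in> I" for x
      using that diff_mem[OF zero_mem, of x] by (simp add: I_def cut_def blinfun.bilinear_simps)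
    show "a o\<^sub>L x \<in> I" if ax: "a \<in> M" "x \<in> I" for a x
    proof -
      have "cut (a o\<^sub>L x) \<epsilon>" if "\<epsilon> > 0" for \<epsilon>
      proof -
        have na: "norm a + 1 > 0" by (simp add: add_nonneg_pos)
        then have "cut x (\<epsilon> / (norm a + 1))" using ax that by (simp add: I_def)
        then obtain f where f: "f \<in> central_projs" "id_blinfun - f \<in> \<zeta>" "\<And>v. norm (x (f v)) \<le> \<epsilon> / (norm a + 1) * norm v"
          unfolding cut_def by blast
        have "norm ((a o\<^sub>L x) (f v)) \<le> \<epsilon> * norm v" for v
        proof -
          have "norm (a (x (f v))) \<le> (norm a + 1) * norm (x (f v))" by (rule norm_blinfun_le) simp
          also have "\<dots> \<le> (norm a + 1) * (\<epsilon> / (norm a + 1) * norm v)"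
            using f(3) na by (intro mult_left_mono) auto
          also have "\<dots> = \<epsilon> * norm v" using na by simp
          finally show ?thesis by simp
        qed
        then show ?thesis unfolding cut_def using f by blast
      qed
      then show ?thesis using ax by (simp add: I_def comp_mem)
    qed
    show "x o\<^sub>L a \<in> I" if ax: "a \<in> M" "x \<in> I" for a x
    proof -
      have "cut (x o\<^sub>L a) \<epsilon>" if "\<epsilon> > 0" for \<epsilon>
      proof -
        have na: "norm a + 1 > 0" by (simp add: add_nonneg_pos)
        then have "cut x (\<epsilon> / (norm a + 1))" using ax that by (simp add: I_def)
        then obtain f where f: "f \<in> central_projs" "id_blinfun - f \<in> \<zeta>" "\<And>v. norm (x (f v)) \<le> \<epsilon> / (norm a + 1) * norm v"
          unfolding cut_def by blast
        have "norm ((x o\<^sub>L a) (f v)) \<le> \<epsilon> * norm v" for v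
        proof -
          have "norm (x (f (a v))) \<le> \<epsilon> / (norm a + 1) * norm (a v)" by (rule f(3))
          also have "\<dots> \<le> \<epsilon> / (norm a + 1) * ((norm a + 1) * norm v)"
            using na that by (intro mult_left_mono norm_blinfun_le) auto
          also have "\<dots> = \<epsilon> * norm v" using na by simp
          finally show ?thesis using central_projsD(2)[OF f(1) ax(1)] by simp
        qed
        then show ?thesis unfolding cut_def using f by blast
      qed
      then show ?thesis using ax by (simp add: I_def comp_mem)
    qed
  qed
  moreover have "closed I"
    unfolding closed_sequential_limits
  proof (intro allI impI, elim conjE)
    fix X l assume X: "\<forall>n::nat. X n \<in> I" "X \<longlonglongrightarrow> l"
    have "l \<in> M" using closed_algebra X unfolding closed_sequential_limits I_def by blast
    moreover have "cut l \<epsilon>" if "\<epsilon> > 0" for \<epsilon>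
    proof -
      obtain n where n: "norm (X n - l) < \<epsilon> / 2"
        using LIMSEQ_D[OF X(2), of "\<epsilon> / 2"] \<open>\<epsilon> > 0\<close> by auto
      have "cut (X n) (\<epsilon>/2)" using X(1) that by (simp add: I_def)
      then obtain f where f: "f \<in> central_projs" "id_blinfun - f \<in> \<zeta>" "\<And>v. norm (X n (f v)) \<le> \<epsilon>/2 * norm v"
        unfolding cut_def by blast
      have "norm (l (f v)) \<le> \<epsilon> * norm v" for v
      proof -
        have "norm ((X n - l) (f v)) \<le> \<epsilon>/2 * norm (f v)" using n by (intro norm_blinfun_le) simp
        also have "\<dots> \<le> \<epsilon>/2 * norm v"
          using orth_proj_norm_le projsD(2) central_projsD(1) f(1) that by (intro mult_left_mono) auto
        finally show ?thesis
          using f(3)[of v] norm_triangle_ineq4[of "X n (f v)" "(X n - l) (f v)"] by (simp add: blinfun.bilinear_simps)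
      qed
      then show ?thesis unfolding cut_def using f by blast
    qed
    ultimately show "l \<in> I" by (simp add: I_def)
  qed
  moreover have "\<zeta> \<subseteq> I"
    using central_ideal_cut[OF \<zeta>] \<zeta>D(1) center_mem by (auto simp: I_def cut_def)
  ultimately have "closed_ideal_generated M \<zeta> \<subseteq> I" unfolding closed_ideal_generated_def by blast
  then show ?thesis using x \<epsilon> by (auto simp: I_def cut_def)
qed

lemma normal_diff_center:
  assumes h: "h \<in> M" "normal_operator h" and z: "z \<in> center M"
  shows "normal_operator (h - z)"
proof -
  have "radj h (h x) = h (radj h x)" "radj z (z x) = z (radj z x)" "z (h x) = h (z x)"
    "z (radj h x) = radj h (z x)" "radj z (h x) = h (radj z x)" for x
    using h(2) normal_iff[OF h(1)]
    by (simp add: commutes_def, intro center_commutes center_radj z h(1) radj_mem center_mem[OF z])+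
  then have "commutes (radj (h - z)) (h - z)" by (simp add: commutes_def blinfun.bilinear_simps)
  then show ?thesis using normal_iff[OF diff_mem[OF h(1) center_mem[OF z]]] by simp
qed

text \<open>Both directions are by contradiction. If \<open>h - z\<close> is bounded below on
  \<open>f\<close>, its inverse there is an inverse modulo every maximal ideal containing
  \<open>1 - f\<close>. If \<open>b\<close> inverts \<open>h - z\<close> modulo the ideal of
  \<open>\<zeta>\<close>, the remainder \<open>b (h - z) - 1\<close> has norm at most 1/2 on some
  central \<open>f\<close> with \<open>1 - f\<close> in \<open>\<zeta>\<close>; this
  \<open>f\<close> is nonzero since \<open>\<zeta>\<close> is proper, and \<open>h - z\<close> is
  bounded below on it.\<close>

lemma essential_central_spectrum_iff:
  assumes III: "type_III M" and h: "h \<in> M" "normal_operator h"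
  shows "z \<in> essential_central_spectrum M h \<longleftrightarrow> z \<in> center M \<and>
    (\<forall>f\<in>central_projs. f \<noteq> 0 \<longrightarrow> (\<forall>\<delta>>0. \<exists>x. x \<noteq> 0 \<and> blinfun_apply f x = x \<and> norm ((h - z) x) \<le> \<delta> * norm x))"
    (is "_ \<longleftrightarrow> _ \<and> ?NB")
proof (cases "z \<in> center M")
  case False
  then show ?thesis by (simp add: essential_central_spectrum_def)
next
  case z: True
  define S where "S = h - z"
  have SM: "S \<in> M" unfolding S_def by (intro diff_mem h center_mem z)
  define R where "R = operator_ring M"
  have Snormal: "commutes (radj S) S"
    using normal_diff_center[OF h z] SM by (simp add: normal_iff S_def)
  have id: "ideal (essential_ideal M \<zeta>) R" and sub: "\<zeta> \<subseteq> essential_ideal M \<zeta>"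
    and gen: "essential_ideal M \<zeta> = closed_ideal_generated M \<zeta>" and \<zeta>id: "ideal \<zeta> (operator_ring (center M))"
    if "\<zeta> \<in> maximal_ideal_space (center M)" for \<zeta>
  proof -
    show \<zeta>: "ideal \<zeta> (operator_ring (center M))"
      using that maximalideal.axioms(1) by (auto simp: maximal_ideal_space_def)
    then have "\<zeta> \<subseteq> M" using operator_idealD(1) center_mem by blast
    then show "ideal (essential_ideal M \<zeta>) R" "\<zeta> \<subseteq> essential_ideal M \<zeta>"
      "essential_ideal M \<zeta> = closed_ideal_generated M \<zeta>"
      using ideal_closed_ideal_generated by (simp_all add: R_def essential_ideal_type_III[OF III])
  qed
  show ?thesis
  proof
    assume spec: "z \<in> essential_central_spectrum M h"
    have "\<exists>x. x \<noteq> 0 \<and> blinfun_apply f x = x \<and> norm (S x) \<le> \<delta> * norm x" if f: "f \<in> central_projs" "f \<noteq> 0" and \<delta>: "\<delta> > 0" for f \<delta>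
    proof (rule ccontr)
      assume "\<not> ?thesis"
      then have below: "\<delta> * norm x \<le> norm (S x)" if "f x = x" for x
        using that by (cases "x = 0") (auto simp: not_le intro: less_imp_le)
      note fp = projsD[OF central_projsD(1)[OF f(1)]]
      have fS: "f (S x) = S (f x)" for x using central_projsD(2)[OF f(1) SM] .
      \<comment> \<open>The identity outside \<open>f\<close> turns the lower bound on
        \<open>f\<close> into one on the whole space.\<close>
      define T where "T = (S o\<^sub>L f) + (id_blinfun - f)"
      have T: "T x = S (f x) + (x - f x)" for x by (simp add: T_def blinfun.bilinear_simps)
      have TM: "T \<in> M" unfolding T_def by (intro add_mem comp_mem diff_mem id_mem SM fp)
      have rT: "radj T x = f (radj S x) + (x - f x)" for x by (simp add: T_def blinfun.bilinear_simps fp)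
      have fS': "f (radj S x) = radj S (f x)" for x using central_projsD(2)[OF f(1) radj_mem[OF SM]] .
      have "commutes (radj T) T"
        using Snormal by (simp add: commutes_def T rT blinfun.bilinear_simps fS fS' fp)
      moreover define c where "c = min \<delta> 1"
      have c: "c > 0" "c \<le> \<delta>" "c \<le> 1" using \<delta> by (simp_all add: c_def)
      moreover have "c * norm x \<le> norm (T x)" for x
      proof -
        have "f (T x) = S (f x)" "T x - f (T x) = x - f x" by (simp_all add: T blinfun.bilinear_simps fS fp)
        then have "(norm (T x))\<^sup>2 = (norm (S (f x)))\<^sup>2 + (norm (x - f x))\<^sup>2"
          using orth_proj_pythagoras[OF fp(2), of "T x"] by simp
        moreover have "c * norm (f x) \<le> norm (S (f x))"
          using below[of "f x"] fp(3) mult_right_mono[OF c(2), of "norm (f x)"] by (simp add: order_trans)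
        then have "(c * norm (f x))\<^sup>2 \<le> (norm (S (f x)))\<^sup>2" using c by (intro power_mono) auto
        moreover have "c * norm (x - f x) \<le> norm (x - f x)" using mult_right_mono[OF c(3), of "norm (x - f x)"] by simp
        then have "(c * norm (x - f x))\<^sup>2 \<le> (norm (x - f x))\<^sup>2" using c by (intro power_mono) auto
        moreover have "(c * norm x)\<^sup>2 = (c * norm (f x))\<^sup>2 + (c * norm (x - f x))\<^sup>2"
          using orth_proj_pythagoras[OF fp(2), of x] by (simp add: power_mult_distrib distrib_left)
        ultimately have "(c * norm x)\<^sup>2 \<le> (norm (T x))\<^sup>2" by linarith
        then show ?thesis by (rule power2_le_imp_le) simp
      qed
      ultimately obtain B where B: "\<And>x. blinfun_apply B (T x) = x" "\<And>x. T (blinfun_apply B x) = x" "\<And>R. commutes R T \<Longrightarrow> commutes R B"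
        using bounded_below_inverse[of T c] by blast
      have BM: "B \<in> M" using TM B(3) by (rule bicommutant_mem)
      define b where "b = B o\<^sub>L f"
      have bM: "b \<in> M" unfolding b_def by (intro comp_mem BM fp)
      have fB: "f (B x) = B (f x)" for x using central_projsD(2)[OF f(1) BM] .
      have Tf: "T (f x) = S (f x)" for x by (simp add: T fp)
      have bS: "b o\<^sub>L S = f"
        by (rule blinfun_eqI) (simp add: b_def fS B flip: Tf)
      have Sb: "S o\<^sub>L b = f"
      proof (rule blinfun_eqI)
        fix x
        have "S (b x) = S (f (B x))" by (simp add: b_def fB)
        also have "\<dots> = T (f (B x))" by (rule Tf[symmetric])
        also have "\<dots> = f x" by (simp only: fB B)
        finally show "(S o\<^sub>L b) x = f x" by simp
      qed
      from maximal_ideal_exists[OF f] obtain \<zeta> where \<zeta>: "\<zeta> \<in> maximal_ideal_space (center M)" "id_blinfun - f \<in> \<zeta>"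
        by blast
      define I where "I = essential_ideal M \<zeta>"
      interpret I: ideal I R unfolding I_def using id[OF \<zeta>(1)] .
      have fI: "id_blinfun - f \<in> I" using \<zeta>(2) sub[OF \<zeta>(1)] by (auto simp: I_def)
      have ID: "x \<in> I \<Longrightarrow> y \<in> I \<Longrightarrow> x + y \<in> I" "a \<in> M \<Longrightarrow> x \<in> I \<Longrightarrow> a o\<^sub>L x \<in> I" for x y a
        using operator_idealD(3,4)[of I M] I.is_ideal by (auto simp: R_def)
      have "I +>\<^bsub>R\<^esub> f = I +>\<^bsub>R\<^esub> id_blinfun"
      proof -
        have "- id_blinfun \<in> M" using diff_mem[OF zero_mem id_mem] by simp
        from ID(2)[OF this fI] have "f - id_blinfun \<in> I"
          by (metis (no_types, lifting) blinfun_eqI blinfun_apply_blinfun_compose blinfun.minus_left id_blinfun.rep_eq id_apply minus_diff_eq)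
        then have "x + f = (x + (f - id_blinfun)) + id_blinfun \<and> x + (f - id_blinfun) \<in> I"
          "x + id_blinfun = (x + (id_blinfun - f)) + f \<and> x + (id_blinfun - f) \<in> I" if "x \<in> I" for x
          using ID(1)[OF that] fI by auto
        then show ?thesis unfolding R_def operator_coset by blast
      qed
      moreover have "(I +>\<^bsub>R\<^esub> b) \<otimes>\<^bsub>R Quot I\<^esub> (I +>\<^bsub>R\<^esub> S) = I +>\<^bsub>R\<^esub> f"
        "(I +>\<^bsub>R\<^esub> S) \<otimes>\<^bsub>R Quot I\<^esub> (I +>\<^bsub>R\<^esub> b) = I +>\<^bsub>R\<^esub> f"
        using I.rcoset_mult_add[of b S] I.rcoset_mult_add[of S b] SM bM bS Sb
        by (simp_all add: FactRing_def R_def operator_ring_simps)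
      moreover have "I +>\<^bsub>R\<^esub> b \<in> carrier (R Quot I)" "I +>\<^bsub>R\<^esub> S \<in> carrier (R Quot I)"
        using SM bM by (auto simp: FactRing_def A_RCOSETS_def' R_def operator_ring_simps)
      moreover have "\<one>\<^bsub>R Quot I\<^esub> = I +>\<^bsub>R\<^esub> id_blinfun"
        by (simp add: FactRing_def R_def operator_ring_simps)
      ultimately have "I +>\<^bsub>R\<^esub> S \<in> Units (R Quot I)" unfolding Units_def by force
      then show False
        using spec \<zeta>(1) by (auto simp: essential_central_spectrum_def I_def R_def S_def)
    qed
    then show "z \<in> center M \<and> ?NB" using z by (simp add: S_def)
  next
    assume NB: "z \<in> center M \<and> ?NB"
    have "essential_ideal M \<zeta> +>\<^bsub>R\<^esub> S \<notin> Units (R Quot essential_ideal M \<zeta>)"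
      if \<zeta>: "\<zeta> \<in> maximal_ideal_space (center M)" for \<zeta>
    proof
      define I where "I = essential_ideal M \<zeta>"
      interpret I: ideal I R unfolding I_def using id[OF \<zeta>] .
      assume "essential_ideal M \<zeta> +>\<^bsub>R\<^esub> S \<in> Units (R Quot essential_ideal M \<zeta>)"
      then have "I +>\<^bsub>R\<^esub> S \<in> Units (R Quot I)" by (simp add: I_def)
      then obtain y where y: "y \<in> carrier (R Quot I)" "y \<otimes>\<^bsub>R Quot I\<^esub> (I +>\<^bsub>R\<^esub> S) = \<one>\<^bsub>R Quot I\<^esub>"
        unfolding Units_def by blast
      from y(1) obtain b where b: "b \<in> M" "y = I +>\<^bsub>R\<^esub> b"
        by (auto simp: FactRing_def A_RCOSETS_def' R_def operator_ring_simps)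
      have "I +>\<^bsub>R\<^esub> (b o\<^sub>L S) = I +>\<^bsub>R\<^esub> id_blinfun"
        using y(2) I.rcoset_mult_add[of b S] SM b
        by (simp add: FactRing_def R_def operator_ring_simps)
      moreover have "0 \<in> I" using operator_idealD(2)[of I M] I.is_ideal by (simp add: R_def)
      then have "b o\<^sub>L S \<in> I +>\<^bsub>R\<^esub> (b o\<^sub>L S)" unfolding R_def operator_coset by force
      ultimately obtain x where x: "x \<in> I" "b o\<^sub>L S = x + id_blinfun"
        unfolding R_def operator_coset by auto
      have "x \<in> closed_ideal_generated M \<zeta>" using x(1) gen[OF \<zeta>] by (simp add: I_def)
      from closed_ideal_cut[OF \<zeta>id[OF \<zeta>] this, of "1/2"] obtain f where
        f: "f \<in> central_projs" "id_blinfun - f \<in> \<zeta>" "\<And>v. norm (x (f v)) \<le> 1/2 * norm v" by auto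
      have "f \<noteq> 0"
      proof
        assume "f = 0"
        then have "\<one>\<^bsub>operator_ring (center M)\<^esub> \<in> \<zeta>" using f(2) by (simp add: operator_ring_simps)
        then show False
          using \<zeta> ideal.one_imp_carrier[OF \<zeta>id[OF \<zeta>]] maximalideal.I_notcarr[of \<zeta> "operator_ring (center M)"]
          by (auto simp: maximal_ideal_space_def)
      qed
      \<comment> \<open>This makes the norm of \<open>b (S v)\<close> at most a quarter of that of
        \<open>v\<close>; together with the half from \<open>x\<close> it stays below 1.\<close>
      define \<delta> where "\<delta> = 1 / (4 * (norm b + 1))"
      have nb: "norm b + 1 > 0" by (simp add: add_nonneg_pos)
      then have "\<delta> > 0" by (simp add: \<delta>_def)
      then obtain v where v: "v \<noteq> 0" "f v = v" "norm (S v) \<le> \<delta> * norm v"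
        using NB f(1) \<open>f \<noteq> 0\<close> unfolding S_def by blast
      have "b (S v) = x v + v" using arg_cong[OF x(2), of "\<lambda>T. T v"] by (simp add: blinfun.bilinear_simps)
      then have "norm v \<le> norm (b (S v)) + norm (x v)"
        using norm_triangle_ineq4[of "b (S v)" "x v"] by simp
      moreover have "norm (b (S v)) \<le> 1/4 * norm v"
      proof -
        have "norm (b (S v)) \<le> (norm b + 1) * norm (S v)" by (rule norm_blinfun_le) simp
        also have "\<dots> \<le> (norm b + 1) * (\<delta> * norm v)" using v(3) nb by (intro mult_left_mono) auto
        also have "\<dots> = 1/4 * norm v"
        proof -
          have "(norm b + 1) * \<delta> = 1/4" using nb by (simp add: \<delta>_def divide_simps)
          then show ?thesis by (simp only: mult.assoc[symmetric])
        qed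
        finally show ?thesis .
      qed
      moreover have "norm (x v) \<le> 1/2 * norm v" using f(3)[of v] v(2) by simp
      moreover have "norm v > 0" using v(1) by simp
      ultimately show False by linarith
    qed
    then show "z \<in> essential_central_spectrum M h"
      using z by (simp add: essential_central_spectrum_def S_def R_def)
  qed
qed

end

section \<open>Matching the spectral partitions\<close>

context complex_vn_algebra
begin

text \<open>\<open>z\<close> is in the essential central spectrum of \<open>h\<close> iff \<open>h - z\<close> satisfies this for \<open>f = 1\<close> and all \<open>\<delta> > 0\<close>.\<close>

definition approx_null :: "'a operator \<Rightarrow> 'a operator \<Rightarrow> real \<Rightarrow> bool" where
  "approx_null T f \<delta> \<longleftrightarrow> (\<forall>g\<in>central_projs. g \<noteq> 0 \<and> (\<forall>x. f (blinfun_apply g x) = g x) \<longrightarrow>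
    (\<exists>x. x \<noteq> 0 \<and> blinfun_apply g x = x \<and> norm (T x) \<le> \<delta> * norm x))"

lemma approx_nullD:
  assumes "approx_null T f \<delta>" "g \<in> central_projs" "g \<noteq> 0" "\<And>x. blinfun_apply f (blinfun_apply g x) = g x"
  obtains x where "x \<noteq> 0" "blinfun_apply g x = x" "norm (T x) \<le> \<delta> * norm x"
  using assms unfolding approx_null_def by blast

lemma central_corner:
  assumes q: "q \<in> projs" and u: "u \<noteq> 0" "central_support q u = u"
  obtains a where "a \<in> M" "q (a u) \<noteq> 0"
  using central_support(2)[OF projsD(1)[OF q], of u] u by auto

lemma proj_vanish:
  assumes p: "p \<in> projs" and "central_support p x = 0"
  shows "p x = 0"
  using central_support_apply(2)[OF p, of x] assms(2) by (simp add: blinfun.bilinear_simps)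

text \<open>One step of the successive approximation. \<open>T\<close> is cut into pieces with
  values \<open>\<mu> j\<close> at precision \<open>\<delta> / 2\<close>, and \<open>z\<close> takes
  the value \<open>\<mu> j\<close> on disjoint central pieces below the central supports of the
  pieces with \<open>cmod (\<mu> j) \<le> 2 * \<delta>\<close>. Within \<open>f\<close> these
  supports cover everything: on a central piece missing them all \<open>T\<close> would be too large
  for \<open>approx_null T f \<delta>\<close>.\<close>

lemma approx_null_step:
  assumes T: "T \<in> M" "normal_operator T" and f: "f \<in> central_projs" and \<delta>: "\<delta> > 0" and null: "approx_null T f \<delta>"
  shows "\<exists>z\<in>center M. norm z \<le> 2 * \<delta> \<and> approx_null (T - z) f (\<delta> / 2)"
proof -
  have "\<delta> / 2 > 0" using \<delta> by simp
  from normal_partition[OF T this] obtain n q \<mu> where q: "partition n q"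
    and "\<forall>j<n. commutes (q j) T \<and> (\<forall>x. norm ((T - scalar_op (\<mu> j)) (q j x)) \<le> \<delta> / 2 * norm (q j x))"
    by (elim exE conjE)
  then have qT: "\<And>j. j < n \<Longrightarrow> commutes (q j) T"
    and q\<mu>: "\<And>j x. j < n \<Longrightarrow> norm ((T - scalar_op (\<mu> j)) (q j x)) \<le> \<delta> / 2 * norm (q j x)" by blast+
  note qp = partitionD(1)[OF q]
  define F where "F = (\<lambda>j. if j < n \<and> cmod (\<mu> j) \<le> 2 * \<delta> then central_support (q j) else 0)"
  have F: "F j \<in> central_projs" for j
    using central_support(1)[OF projsD(1)[OF qp]] zero_central by (auto simp: F_def)
  from central_disjointify[of F, OF F] obtain c k where *: "\<forall>n. c n \<in> central_projs" "\<forall>n. k n \<in> central_projs"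
    "\<forall>n x. k n x = F n (c n x)" "\<forall>m n x. m \<noteq> n \<longrightarrow> k m (k n x) = 0" "\<forall>n x. (\<Sum>j<n. k j x) + c n x = x"
    "\<forall>m n x. m < n \<longrightarrow> c n (F m x) = 0" by (elim exE conjE)
  note c = *(1)[rule_format] and k = *(2)[rule_format] and kx = *(3)[rule_format] and kk = *(4)[rule_format]
    and sum = *(5)[rule_format] and cF = *(6)[rule_format]
  note cp = central_projsD(1)[OF c] and kp = central_projsD(1)[OF k] and Fp = central_projsD(1)[OF F]
  have ck: "c n (k j x) = 0" if "j < n" for j x using cF[OF that] by (simp add: kx)
  have kc: "k j (c n x) = 0" if "j < n" for j x
    using ck[OF that, of x] central_projsD(2)[OF k projsD(1)[OF cp]] by simp
  \<comment> \<open>The index \<open>n\<close> carries the remainder outside all the chosen central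
    supports, where \<open>z\<close> vanishes.\<close>
  define w where "w = (\<lambda>j. if j < n then k j else c n)"
  have w: "partition (Suc n) w"
    unfolding partition_def
  proof (intro conjI allI impI)
    show "w j \<in> projs" for j using cp kp by (simp add: w_def)
    show "w i (w j x) = 0" if "i < Suc n" "j < Suc n" "i \<noteq> j" for i j x
      using that kk[OF that(3)] ck kc by (auto simp: w_def)
    show "(\<Sum>j<Suc n. w j x) = x" for x using sum[of x n] by (simp add: w_def)
  qed
  define z where "z = (\<Sum>j<n. scalar_op (if cmod (\<mu> j) \<le> 2 * \<delta> then \<mu> j else 0) o\<^sub>L k j)"
  have z: "z \<in> center M"
    unfolding z_def by (intro center_sum center_comp scalar_center central_projs_center k)
  have zx: "z x = (\<Sum>j<n. scaleC (if cmod (\<mu> j) \<le> 2 * \<delta> then \<mu> j else 0) (k j x))" for x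
    by (simp add: z_def blinfun.bilinear_simps)
  have zk: "z (k j x) = scaleC (if cmod (\<mu> j) \<le> 2 * \<delta> then \<mu> j else 0) (k j x)" if "j < n" for j x
  proof -
    have "z (k j x) = scaleC (if cmod (\<mu> j) \<le> 2 * \<delta> then \<mu> j else 0) (k j (k j x)) +
      (\<Sum>i\<in>{..<n} - {j}. scaleC (if cmod (\<mu> i) \<le> 2 * \<delta> then \<mu> i else 0) (k i (k j x)))"
      unfolding zx using that by (intro sum.remove) auto
    also have "(\<Sum>i\<in>{..<n} - {j}. scaleC (if cmod (\<mu> i) \<le> 2 * \<delta> then \<mu> i else 0) (k i (k j x))) = 0"
      using kk by (intro sum.neutral) (simp flip: scalar_op_apply add: blinfun.bilinear_simps)
    finally show ?thesis by (simp add: projsD(3)[OF kp])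
  qed
  have "norm (z x) \<le> 2 * \<delta> * norm x" for x
  proof (rule partition_norm_le[OF w])
    show "commutes (w j) z" if "j < Suc n" for j
      using center_commutes[OF z] cp kp projsD(1) by (simp add: w_def commutes_def)
    show "norm (z (w j x)) \<le> 2 * \<delta> * norm (w j x)" if "j < Suc n" for j
    proof (cases "j < n")
      case True
      then show ?thesis using \<delta> by (simp add: w_def zk norm_scaleC mult_right_mono)
    next
      case False
      have "z (c n x) = 0"
        unfolding zx using kc by (intro sum.neutral) (simp flip: scalar_op_apply add: blinfun.bilinear_simps)
      then show ?thesis using False \<delta> by (simp add: w_def)
    qed
  qed (use \<delta> in simp)
  then have "norm z \<le> 2 * \<delta>" using \<delta> by (intro norm_blinfun_bound) auto
  moreover have "approx_null (T - z) f (\<delta> / 2)"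
    unfolding approx_null_def
  proof (intro ballI impI, elim conjE)
    fix g assume g: "g \<in> central_projs" "g \<noteq> 0" and fg: "\<forall>x. f (g x) = g x"
    note gc = central_projsD(2)[OF g(1)]
    have gcn: "g o\<^sub>L c n = 0"
    proof (rule ccontr)
      assume "g o\<^sub>L c n \<noteq> 0"
      from approx_nullD[OF null central_comp[OF g(1) c] this] fg obtain x
        where x: "x \<noteq> 0" "g (c n x) = x" "norm (T x) \<le> \<delta> * norm x" by auto
      \<comment> \<open>Only pieces with \<open>cmod (\<mu> j) > 2 * \<delta>\<close> survive here,
        and each value is known up to \<open>\<delta> / 2\<close>.\<close>
      have "(3/2 * \<delta>) * norm x \<le> norm (T x)"
      proof (rule partition_norm_ge[OF q qT])
        show "3/2 * \<delta> * norm (q j x) \<le> norm (T (q j x))" if j: "j < n" for j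
        proof (cases "cmod (\<mu> j) \<le> 2 * \<delta>")
          case True
          have "F j x = g (c n (F j x))"
            using x(2) gc[OF projsD(1)[OF Fp]] central_projsD(2)[OF c projsD(1)[OF Fp]] by metis
          then have "F j x = 0" using cF[OF j] by (simp add: blinfun.bilinear_simps)
          then have "q j x = 0" using True j by (intro proj_vanish[OF qp]) (simp_all add: F_def)
          then show ?thesis by (simp add: blinfun.bilinear_simps)
        next
          case False
          have "scaleC (\<mu> j) (q j x) = T (q j x) - (T - scalar_op (\<mu> j)) (q j x)"
            by (simp add: blinfun.bilinear_simps)
          then have "cmod (\<mu> j) * norm (q j x) \<le> norm (T (q j x)) + \<delta> / 2 * norm (q j x)"
            using norm_triangle_ineq4[of "T (q j x)" "(T - scalar_op (\<mu> j)) (q j x)"] q\<mu>[OF j, of x]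
            by (simp flip: norm_scaleC)
          moreover have "2 * \<delta> * norm (q j x) \<le> cmod (\<mu> j) * norm (q j x)"
            using False by (intro mult_right_mono) auto
          ultimately show ?thesis by (simp add: algebra_simps)
        qed
      qed (use \<delta> in simp_all)
      moreover have "\<delta> * norm x < (3/2 * \<delta>) * norm x" using x(1) \<delta> by simp
      ultimately show False using x(3) by linarith
    qed
    have "\<exists>j<n. \<exists>y. g (k j y) \<noteq> 0"
    proof (rule ccontr)
      assume "\<not> ?thesis"
      then have "g (k j y) = 0" if "j < n" for j y using that by blast
      moreover have "g (c n x) = 0" for x using gcn by (metis blinfun_apply_blinfun_compose zero_blinfun.rep_eq)
      ultimately have "g ((\<Sum>j<n. k j x) + c n x) = 0" for x by (simp add: blinfun.bilinear_simps)
      then have "g = 0" by (simp only: sum) (simp add: blinfun_eq_iff)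
      with g(2) show False by simp
    qed
    then obtain j y where j: "j < n" "g (k j y) \<noteq> 0" by blast
    define u where "u = g (k j y)"
    have near: "cmod (\<mu> j) \<le> 2 * \<delta>"
      using j(2) kx[of j y] by (auto simp: F_def blinfun.bilinear_simps split: if_splits)
    have gu: "g u = u" by (simp add: u_def projsD(3)[OF central_projsD(1)[OF g(1)]])
    have ku: "k j u = u" using gc[OF projsD(1)[OF kp]] by (simp add: u_def projsD(3)[OF kp] flip: gc)
    have "F j u = u" using kx[of j u] ku projsD(3)[OF Fp] by metis
    then have "central_support (q j) u = u" using near j(1) by (simp add: F_def)
    \<comment> \<open>\<open>u\<close> is only known to lie below the central support of
      \<open>q j\<close>; some \<open>a\<close> in \<open>M\<close> carries it into
      \<open>q j\<close> itself, and central projections follow along.\<close>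
    then obtain a where a: "a \<in> M" "q j (a u) \<noteq> 0"
      using central_corner[OF qp[OF j(1)]] j(2) u_def by blast
    define x where "x = q j (a u)"
    have qM: "q j \<in> M" using projsD(1)[OF qp[OF j(1)]] .
    have gx: "g x = x" by (simp add: x_def gc[OF qM] gc[OF a(1)] gu)
    have "k j x = x" by (simp add: x_def central_projsD(2)[OF k qM] central_projsD(2)[OF k a(1)] ku)
    then have "z x = scaleC (\<mu> j) x" using zk[OF j(1), of x] near by simp
    moreover have "q j x = x" by (simp add: x_def projsD(3)[OF qp[OF j(1)]])
    ultimately have "norm ((T - z) x) \<le> \<delta> / 2 * norm x"
      using q\<mu>[OF j(1), of x] by (simp add: blinfun.bilinear_simps)
    then show "\<exists>x. x \<noteq> 0 \<and> g x = x \<and> norm ((T - z) x) \<le> \<delta> / 2 * norm x"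
      using gx a(2) by (auto simp: x_def)
  qed
  ultimately show ?thesis using z by blast
qed

text \<open>The corrections of \<open>approx_null_step\<close> are at most
  \<open>2 * \<delta> / 2 ^ n\<close>, so they sum to a central limit within
  \<open>4 * \<delta>\<close> of the start.\<close>

lemma central_approx_point:
  assumes T: "T \<in> M" "normal_operator T" and f: "f \<in> central_projs" and z0: "z0 \<in> center M"
    and \<delta>: "\<delta> > 0" and null: "approx_null (T - z0) f \<delta>"
  shows "\<exists>z\<in>center M. norm (z - z0) \<le> 4 * \<delta> \<and> (\<forall>\<eta>>0. approx_null (T - z) f \<eta>)"
proof -
  \<comment> \<open>The clause for \<open>n = 0\<close> pins the sequence to \<open>z0\<close>, from
    which the total distance is measured.\<close>
  define P where "P = (\<lambda>n z. z \<in> center M \<and> approx_null (T - z) f (\<delta> / 2 ^ n) \<and> (n = 0 \<longrightarrow> z = z0))"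
  have "\<exists>Z. \<forall>n. P n (Z n) \<and> norm (Z (Suc n) - Z n) \<le> 2 * (\<delta> / 2 ^ n)"
  proof (rule dependent_nat_choice)
    show "\<exists>z. P 0 z" using z0 null by (simp add: P_def)
    fix z n assume z: "P n z"
    then have zc: "z \<in> center M" and nz: "approx_null (T - z) f (\<delta> / 2 ^ n)" by (auto simp: P_def)
    from approx_null_step[OF diff_mem[OF T(1) center_mem[OF zc]] normal_diff_center[OF T zc] f _ nz] \<delta>
    obtain w where w: "w \<in> center M" "norm w \<le> 2 * (\<delta> / 2 ^ n)" "approx_null (T - z - w) f (\<delta> / 2 ^ n / 2)" by auto
    then have "P (Suc n) (z + w)" using zc by (simp add: P_def center_add diff_diff_eq mult.commute)
    then show "\<exists>y. P (Suc n) y \<and> norm (y - z) \<le> 2 * (\<delta> / 2 ^ n)" using w(2) by (intro exI[of _ "z + w"]) simp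
  qed
  then obtain Z where Z: "\<And>n. Z n \<in> center M" "\<And>n. approx_null (T - Z n) f (\<delta> / 2 ^ n)" "Z 0 = z0"
    and ZS: "\<And>n. norm (Z (Suc n) - Z n) \<le> 2 * (\<delta> / 2 ^ n)" by (auto simp: P_def)
  have diff: "norm (Z (n + k) - Z n) \<le> 4 * \<delta> / 2 ^ n - 4 * \<delta> / 2 ^ (n + k)" for n k
  proof (induction k)
    case (Suc k)
    have "norm (Z (n + Suc k) - Z n) \<le> norm (Z (Suc (n + k)) - Z (n + k)) + norm (Z (n + k) - Z n)"
      using norm_triangle_ineq[of "Z (Suc (n + k)) - Z (n + k)" "Z (n + k) - Z n"] by simp
    also have "\<dots> \<le> 2 * (\<delta> / 2 ^ (n + k)) + (4 * \<delta> / 2 ^ n - 4 * \<delta> / 2 ^ (n + k))"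
      using ZS[of "n + k"] Suc by linarith
    also have "\<dots> = 4 * \<delta> / 2 ^ n - 4 * \<delta> / 2 ^ (n + Suc k)" by (simp add: field_simps)
    finally show ?case .
  qed simp
  have diff': "norm (Z m - Z n) \<le> 4 * \<delta> / 2 ^ n" if "n \<le> m" for m n
  proof -
    have "4 * \<delta> / 2 ^ (n + (m - n)) \<ge> 0" using \<delta> by simp
    with diff[of n "m - n"] that show ?thesis by simp
  qed
  \<comment> \<open>The 5 combines the error \<open>\<delta> / 2 ^ n\<close> at stage
    \<open>n\<close> with the distance \<open>4 * \<delta> / 2 ^ n\<close> from stage
    \<open>n\<close> to the limit.\<close>
  have small: "\<exists>n. 5 * \<delta> / 2 ^ n < \<eta>" if "\<eta> > 0" for \<eta>
  proof -
    obtain n where "(1/2) ^ n < \<eta> / (5 * \<delta>)"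
      using real_arch_pow_inv[of "\<eta> / (5 * \<delta>)" "1/2"] \<open>\<eta> > 0\<close> \<delta> by auto
    then have "5 * \<delta> * (1/2) ^ n < \<eta>" using \<delta> by (simp add: pos_less_divide_eq mult.commute)
    then have "5 * \<delta> / 2 ^ n < \<eta>" by (simp add: power_one_over)
    then show ?thesis ..
  qed
  have "Cauchy Z"
  proof (rule metric_CauchyI)
    fix e :: real assume "e > 0"
    then obtain n where n: "5 * \<delta> / 2 ^ n < e / 2" using small[of "e / 2"] by auto
    moreover have "4 * \<delta> / 2 ^ n \<le> 5 * \<delta> / 2 ^ n" using \<delta> by (simp add: divide_right_mono)
    ultimately have half: "norm (Z m - Z n) < e / 2" if "n \<le> m" for m using diff'[OF that] by linarith
    have "dist (Z m) (Z m') < e" if "n \<le> m" "n \<le> m'" for m m'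
    proof (rule dist_triangle_half_r)
      show "dist (Z n) (Z m) < e / 2" "dist (Z n) (Z m') < e / 2"
        using half[OF that(1)] half[OF that(2)]
        by (simp_all add: dist_norm norm_minus_commute)
    qed
    then show "\<exists>M. \<forall>m\<ge>M. \<forall>n\<ge>M. dist (Z m) (Z n) < e" by (intro exI[of _ n] allI impI)
  qed
  then obtain z where z: "Z \<longlonglongrightarrow> z" using Cauchy_convergent convergent_def by blast
  have zdiff: "norm (z - Z n) \<le> 4 * \<delta> / 2 ^ n" for n
    by (rule LIMSEQ_le_const2[OF tendsto_norm[OF tendsto_diff[OF z tendsto_const]]]) (use diff' in blast)
  have zc: "z \<in> center M"
  proof (rule centerI)
    show "z \<in> M" using closed_algebra Z(1) z center_mem unfolding closed_sequential_limits by blast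
    fix S x assume S: "S \<in> M"
    have "(\<lambda>n. Z n (S x)) \<longlonglongrightarrow> z (S x)" "(\<lambda>n. S (Z n x)) \<longlonglongrightarrow> S (z x)"
      by (intro blinfun.tendsto z tendsto_const)+
    then show "z (S x) = S (z x)" using LIMSEQ_unique by (simp add: center_commutes[OF Z(1) S])
  qed
  have "approx_null (T - z) f \<eta>" if \<eta>: "\<eta> > 0" for \<eta>
    unfolding approx_null_def
  proof (intro ballI impI, elim conjE)
    fix g assume g: "g \<in> central_projs" "g \<noteq> 0" "\<forall>x. f (g x) = g x"
    obtain n where n: "5 * \<delta> / 2 ^ n < \<eta>" using small[OF \<eta>] by blast
    obtain x where x: "x \<noteq> 0" "g x = x" "norm ((T - Z n) x) \<le> \<delta> / 2 ^ n * norm x"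
      using approx_nullD[OF Z(2)[of n] g(1,2)] g(3) by blast
    have "(T - z) x = (T - Z n) x - (z - Z n) x" by (simp add: blinfun.bilinear_simps)
    then have "norm ((T - z) x) \<le> norm ((T - Z n) x) + norm ((z - Z n) x)"
      by (simp only: norm_triangle_ineq4)
    also have "\<dots> \<le> \<delta> / 2 ^ n * norm x + 4 * \<delta> / 2 ^ n * norm x"
      using x(3) norm_blinfun_le[OF zdiff[of n], of x] by linarith
    also have "\<dots> = 5 * \<delta> / 2 ^ n * norm x" by (simp add: field_simps)
    also have "\<dots> \<le> \<eta> * norm x" using n by (intro mult_right_mono) auto
    finally show "\<exists>x. x \<noteq> 0 \<and> g x = x \<and> norm ((T - z) x) \<le> \<eta> * norm x" using x by blast
  qed
  moreover have "norm (z - z0) \<le> 4 * \<delta>" using zdiff[of 0] Z(3) by simp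
  ultimately show ?thesis using zc by blast
qed

text \<open>Membership in the spectrum is tested on every nonzero central projection, while the
  limit \<open>z1\<close> is controlled only below \<open>f\<close>. Outside \<open>f\<close> it is
  replaced by a central \<open>z2\<close> that passes the test everywhere.\<close>

lemma spectrum_point_near:
  assumes III: "type_III M" and k: "k \<in> M" "normal_operator k" and f: "f \<in> central_projs"
    and \<delta>: "\<delta> > 0" and null: "approx_null (k - scalar_op \<mu>) f \<delta>"
  shows "\<exists>z\<in>essential_central_spectrum M k. \<forall>x. f x = x \<longrightarrow> norm ((z - scalar_op \<mu>) x) \<le> 4 * \<delta> * norm x"
proof -
  from central_approx_point[OF k f scalar_center \<delta> null] obtain z1 where
    z1: "z1 \<in> center M" "norm (z1 - scalar_op \<mu>) \<le> 4 * \<delta>" "\<And>\<eta>. \<eta> > 0 \<Longrightarrow> approx_null (k - z1) f \<eta>" by blast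
  \<comment> \<open>With an error exceeding the norm of \<open>k\<close> every vector qualifies, so
    the approximation can start at 0; its limit \<open>z2\<close> shows that the spectrum is
    nonempty.\<close>
  have "approx_null (k - 0) id_blinfun (norm k + 1)"
    unfolding approx_null_def
  proof (intro ballI impI, elim conjE)
    fix g assume g: "g \<in> central_projs" "g \<noteq> 0"
    then obtain y where "g y \<noteq> 0" by (auto simp: blinfun_eq_iff)
    then show "\<exists>x. x \<noteq> 0 \<and> g x = x \<and> norm ((k - 0) x) \<le> (norm k + 1) * norm x"
      using projsD(3)[OF central_projsD(1)[OF g(1)]]
      by (intro exI[of _ "g y"]) (simp add: norm_blinfun_le)
  qed
  moreover have "norm k + 1 > 0" by (simp add: add_nonneg_pos)
  ultimately obtain z2 where z2: "z2 \<in> center M" "\<And>\<eta>. \<eta> > 0 \<Longrightarrow> approx_null (k - z2) id_blinfun \<eta>"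
    using central_approx_point[OF k id_central center_zero, of "norm k + 1"] by blast
  define z where "z = (z1 o\<^sub>L f) + (z2 o\<^sub>L (id_blinfun - f))"
  have z: "z \<in> center M"
    unfolding z_def by (intro center_add center_comp center_diff z1(1) z2(1) center_id central_projs_center f)
  have zx: "z x = z1 (f x) + z2 (x - f x)" for x by (simp add: z_def blinfun.bilinear_simps)
  have "\<exists>x. x \<noteq> 0 \<and> g x = x \<and> norm ((k - z) x) \<le> \<eta> * norm x"
    if g: "g \<in> central_projs" "g \<noteq> 0" and \<eta>: "\<eta> > 0" for g :: "'a operator" and \<eta>
  proof (cases "f o\<^sub>L g = 0")
    case False
    have ffg: "f ((f o\<^sub>L g) x) = (f o\<^sub>L g) x" for x by (simp add: projsD(3)[OF central_projsD(1)[OF f]])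
    obtain x where x: "x \<noteq> 0" "(f o\<^sub>L g) x = x" "norm ((k - z1) x) \<le> \<eta> * norm x"
      by (rule approx_nullD[OF z1(3)[OF \<eta>] central_comp[OF f g(1)] False ffg])
    have fx: "f x = x" using ffg[of x] x(2) by simp
    have "f (g x) = g (f x)" using central_projsD(2)[OF f projsD(1)[OF central_projsD(1)[OF g(1)]]] .
    then have "g x = x" using x(2) fx by simp
    moreover have "(k - z) x = (k - z1) x" by (simp add: blinfun.bilinear_simps zx fx)
    ultimately show ?thesis using x by auto
  next
    case True
    obtain x where x: "x \<noteq> 0" "g x = x" "norm ((k - z2) x) \<le> \<eta> * norm x"
      by (rule approx_nullD[OF z2(2)[OF \<eta>] g]) auto
    have "f (g x) = 0" using True by (metis blinfun_apply_blinfun_compose zero_blinfun.rep_eq)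
    then have "(k - z) x = (k - z2) x" using x(2) by (simp add: blinfun.bilinear_simps zx)
    then show ?thesis using x by auto
  qed
  then have "z \<in> essential_central_spectrum M k"
    using z by (simp add: essential_central_spectrum_iff[OF III k])
  moreover have "norm ((z - scalar_op \<mu>) x) \<le> 4 * \<delta> * norm x" if "f x = x" for x
  proof -
    have "(z - scalar_op \<mu>) x = (z1 - scalar_op \<mu>) x" using that by (simp add: blinfun.bilinear_simps zx)
    then show ?thesis using norm_blinfun_le[OF z1(2)] by simp
  qed
  ultimately show ?thesis by blast
qed

text \<open>On the central support \<open>f\<close> of a piece \<open>q j\<close> of
  \<open>k\<close>, a point \<open>z\<close> of both spectra lies within \<open>4 * \<delta>\<close>
  of \<open>\<nu> j\<close>. Hence the central supports of the pieces of \<open>h\<close> with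
  values near \<open>\<nu> j\<close> cover \<open>f\<close>, and disjoint central projections
  distribute \<open>q j\<close> over those pieces.\<close>

lemma matched_partitions:
  assumes III: "type_III M" and h: "h \<in> M" "normal_operator h" and k: "k \<in> M" "normal_operator k"
    and sub: "essential_central_spectrum M k \<subseteq> essential_central_spectrum M h" and \<delta>: "\<delta> > 0"
  shows "\<exists>m p Q \<mu>. partition m p \<and> partition m Q \<and> (\<forall>l<m. \<forall>x. central_support (p l) (Q l x) = Q l x) \<and>
    (\<forall>l<m. commutes (p l) h \<and> (\<forall>x. norm ((h - scalar_op (\<mu> l)) (p l x)) \<le> \<delta> * norm (p l x))) \<and>
    (\<forall>l<m. commutes (Q l) k \<and> (\<forall>x. norm ((k - scalar_op (\<mu> l)) (Q l x)) \<le> 8 * \<delta> * norm (Q l x)))"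
proof -
  from normal_partition[OF h \<delta>] obtain m p \<mu> where p: "partition m p"
    and *: "\<forall>l<m. commutes (p l) h \<and> (\<forall>x. norm ((h - scalar_op (\<mu> l)) (p l x)) \<le> \<delta> * norm (p l x))"
    by (elim exE conjE)
  have ph: "\<And>l. l < m \<Longrightarrow> commutes (p l) h"
    and p\<mu>: "\<And>l x. l < m \<Longrightarrow> norm ((h - scalar_op (\<mu> l)) (p l x)) \<le> \<delta> * norm (p l x)" using * by blast+
  from normal_partition[OF k \<delta>] obtain n q \<nu> where q: "partition n q"
    and "\<forall>j<n. commutes (q j) k \<and> (\<forall>x. norm ((k - scalar_op (\<nu> j)) (q j x)) \<le> \<delta> * norm (q j x))"
    by (elim exE conjE)
  then have qk: "\<And>j. j < n \<Longrightarrow> commutes (q j) k"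
    and q\<mu>: "\<And>j x. j < n \<Longrightarrow> norm ((k - scalar_op (\<nu> j)) (q j x)) \<le> \<delta> * norm (q j x)" by blast+
  note pp = partitionD(1)[OF p] and qp = partitionD(1)[OF q]
  \<comment> \<open>The 7 leaves a gap: on a central piece where only values further away occur,
    \<open>h - \<nu> j\<close> is at least \<open>7 * \<delta> - \<delta> = 6 * \<delta>\<close>,
    while the spectrum point \<open>z\<close> produces vectors on which it is at most
    \<open>\<delta> + 4 * \<delta>\<close>.\<close>
  define near where "near = (\<lambda>j l. cmod (\<mu> l - \<nu> j) \<le> 7 * \<delta>)"
  have "\<exists>\<kappa> :: nat \<Rightarrow> 'a operator. (\<forall>l. \<kappa> l \<in> central_projs) \<and> (\<forall>i l x. i \<noteq> l \<longrightarrow> \<kappa> i (\<kappa> l x) = 0) \<and>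
    (\<forall>l<m. \<forall>x. central_support (p l) (\<kappa> l x) = \<kappa> l x \<and> (\<not> near j l \<longrightarrow> \<kappa> l x = 0)) \<and>
    (\<forall>x. (\<Sum>l<m. \<kappa> l (q j x)) = q j x)" if j: "j < n" for j
  proof -
    define F where "F = (\<lambda>l. if l < m \<and> near j l then central_support (p l) else 0)"
    have F: "F l \<in> central_projs" for l
      using central_support(1)[OF projsD(1)[OF pp]] zero_central by (auto simp: F_def)
    note Fp = central_projsD(1)[OF F]
    from central_disjointify[of F, OF F] obtain c \<kappa> where *: "\<forall>n. c n \<in> central_projs" "\<forall>n. \<kappa> n \<in> central_projs"
      "\<forall>n x. \<kappa> n x = F n (c n x)" "\<forall>m n x. m \<noteq> n \<longrightarrow> \<kappa> m (\<kappa> n x) = 0" "\<forall>n x. (\<Sum>j<n. \<kappa> j x) + c n x = x"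
      "\<forall>m n x. m < n \<longrightarrow> c n (F m x) = 0" by (elim exE conjE)
    note c = *(1)[rule_format] and \<kappa>F = *(3)[rule_format] and sum = *(5)[rule_format] and cF = *(6)[rule_format]
    define f where "f = central_support (q j)"
    have f: "f \<in> central_projs" unfolding f_def using central_support(1)[OF projsD(1)[OF qp[OF j]]] .
    have ff: "f (f x) = f x" for x using projsD(3)[OF central_projsD(1)[OF f]] .
    have null: "approx_null (k - scalar_op (\<nu> j)) f \<delta>"
      unfolding approx_null_def
    proof (intro ballI impI, elim conjE)
      fix g assume g: "g \<in> central_projs" "g \<noteq> 0" "\<forall>x. f (g x) = g x"
      then obtain y where y: "g y \<noteq> 0" by (auto simp: blinfun_eq_iff)
      then obtain a where a: "a \<in> M" "q j (a (g y)) \<noteq> 0"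
        using central_corner[OF qp[OF j] y] g(3) unfolding f_def by blast
      have gc: "g (S x) = S (g x)" if "S \<in> M" for S x using central_projsD(2)[OF g(1) that] .
      have "g (q j (a (g y))) = q j (a (g y))"
        using gc[OF projsD(1)[OF qp[OF j]]] gc[OF a(1)] projsD(3)[OF central_projsD(1)[OF g(1)]] by simp
      then show "\<exists>x. x \<noteq> 0 \<and> g x = x \<and> norm ((k - scalar_op (\<nu> j)) x) \<le> \<delta> * norm x"
        using a(2) q\<mu>[OF j] by blast
    qed
    from spectrum_point_near[OF III k f \<delta> null] sub obtain z where z: "z \<in> essential_central_spectrum M h"
      and z\<mu>: "\<And>x. f x = x \<Longrightarrow> norm ((z - scalar_op (\<nu> j)) x) \<le> 4 * \<delta> * norm x" by blast
    have "f o\<^sub>L c m = 0"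
    proof (rule ccontr)
      assume nz: "f o\<^sub>L c m \<noteq> 0"
      obtain x where x: "x \<noteq> 0" "f (c m x) = x" "norm ((h - z) x) \<le> \<delta> * norm x"
        using z[unfolded essential_central_spectrum_iff[OF III h]] central_comp[OF f c] nz \<delta> by fastforce
      have fx: "f x = x" using ff[of "c m x"] x(2) by simp
      have "(h - scalar_op (\<nu> j)) x = (h - z) x + (z - scalar_op (\<nu> j)) x" by (simp add: blinfun.bilinear_simps)
      then have "norm ((h - scalar_op (\<nu> j)) x) \<le> norm ((h - z) x) + norm ((z - scalar_op (\<nu> j)) x)"
        by (simp only: norm_triangle_ineq)
      then have le: "norm ((h - scalar_op (\<nu> j)) x) \<le> \<delta> * norm x + 4 * \<delta> * norm x"
        using x(3) z\<mu>[OF fx] by linarith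
      have "(6 * \<delta>) * norm x \<le> norm ((h - scalar_op (\<nu> j)) x)"
      proof (rule partition_norm_ge[OF p])
        show "commutes (p l) (h - scalar_op (\<nu> j))" if "l < m" for l
          using ph[OF that] scalar_commutes[OF projsD(1)[OF pp[OF that]]] by (simp add: commutes_def blinfun.bilinear_simps)
        show "6 * \<delta> * norm (p l x) \<le> norm ((h - scalar_op (\<nu> j)) (p l x))" if l: "l < m" for l
        proof (cases "near j l")
          case True
          have "F l x = F l (f (c m x))" by (simp only: x(2))
          also have "\<dots> = f (c m (F l x))"
            using central_projsD(2)[OF f projsD(1)[OF Fp]] central_projsD(2)[OF c projsD(1)[OF Fp]] by simp
          finally have "F l x = 0" using cF[OF l] by (simp add: blinfun.bilinear_simps)
          then have "p l x = 0" using True l by (intro proj_vanish[OF pp]) (simp_all add: F_def)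
          then show ?thesis by (simp add: blinfun.bilinear_simps)
        next
          case False
          have "scaleC (\<mu> l - \<nu> j) (p l x) = (h - scalar_op (\<nu> j)) (p l x) - (h - scalar_op (\<mu> l)) (p l x)"
            by (simp only: scalar_op_apply[symmetric] scalar_op_diff) (simp add: blinfun.bilinear_simps)
          then have "cmod (\<mu> l - \<nu> j) * norm (p l x) \<le> norm ((h - scalar_op (\<nu> j)) (p l x)) + \<delta> * norm (p l x)"
            using norm_triangle_ineq4[of "(h - scalar_op (\<nu> j)) (p l x)" "(h - scalar_op (\<mu> l)) (p l x)"] p\<mu>[OF l, of x]
            by (simp only: norm_scaleC[symmetric])
          moreover have "7 * \<delta> * norm (p l x) \<le> cmod (\<mu> l - \<nu> j) * norm (p l x)"
            using False by (intro mult_right_mono) (auto simp: near_def)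
          ultimately show ?thesis by (simp add: algebra_simps)
        qed
      qed (use \<delta> in simp)
      moreover have "\<delta> * norm x > 0" using x(1) \<delta> by simp
      ultimately show False using le by (simp add: algebra_simps)
    qed
    then have fc: "f (c m y) = 0" for y by (metis blinfun_apply_blinfun_compose zero_blinfun.rep_eq)
    have "c m (q j y) = 0" for y
    proof -
      have "c m (q j y) = c m (f (q j y))" using central_support_apply(1)[OF qp[OF j]] by (simp add: f_def)
      also have "\<dots> = f (c m (q j y))"
        using central_projsD(2)[OF c projsD(1)[OF central_projsD(1)[OF f]]] .
      finally show ?thesis by (simp only: fc)
    qed
    then have "(\<Sum>l<m. \<kappa> l (q j x)) = q j x" for x using sum[where x = "q j x" and n = m] by simp
    moreover have "central_support (p l) (\<kappa> l x) = \<kappa> l x \<and> (\<not> near j l \<longrightarrow> \<kappa> l x = 0)" if "l < m" for l x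
      using projsD(3)[OF Fp] that by (auto simp: \<kappa>F F_def) (metis F_def Fp projsD(3))
    ultimately show ?thesis using *(2,4) by (intro exI[of _ \<kappa>]) simp
  qed
  then have "\<forall>j. \<exists>\<kappa> :: nat \<Rightarrow> 'a operator. j < n \<longrightarrow> (\<forall>l. \<kappa> l \<in> central_projs) \<and> (\<forall>i l x. i \<noteq> l \<longrightarrow> \<kappa> i (\<kappa> l x) = 0) \<and>
    (\<forall>l<m. \<forall>x. central_support (p l) (\<kappa> l x) = \<kappa> l x \<and> (\<not> near j l \<longrightarrow> \<kappa> l x = 0)) \<and>
    (\<forall>x. (\<Sum>l<m. \<kappa> l (q j x)) = q j x)" by blast
  from choice[OF this] obtain \<kappa> :: "nat \<Rightarrow> nat \<Rightarrow> 'a operator" where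
    **: "\<forall>j. j < n \<longrightarrow> (\<forall>l. \<kappa> j l \<in> central_projs) \<and> (\<forall>i l x. i \<noteq> l \<longrightarrow> \<kappa> j i (\<kappa> j l x) = 0) \<and>
    (\<forall>l<m. \<forall>x. central_support (p l) (\<kappa> j l x) = \<kappa> j l x \<and> (\<not> near j l \<longrightarrow> \<kappa> j l x = 0)) \<and>
    (\<forall>x. (\<Sum>l<m. \<kappa> j l (q j x)) = q j x)" by (elim exE)
  have \<kappa>: "\<kappa> j l \<in> central_projs" "i \<noteq> l \<Longrightarrow> \<kappa> j i (\<kappa> j l x) = 0" "(\<Sum>l<m. \<kappa> j l (q j x)) = q j x"
    "l < m \<Longrightarrow> central_support (p l) (\<kappa> j l x) = \<kappa> j l x" "l < m \<Longrightarrow> \<not> near j l \<Longrightarrow> \<kappa> j l x = 0"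
    if "j < n" for j i l x using **[rule_format, OF that] by simp_all
  have \<kappa>c: "\<kappa> j l (S x) = S (\<kappa> j l x)" if "j < n" "S \<in> M" for j l S x
    using central_projsD(2)[OF \<kappa>(1)[OF that(1)] that(2)] .
  \<comment> \<open>\<open>Q l\<close> collects the parts of the \<open>q j\<close> assigned to the
    value \<open>\<mu> l\<close>. Replacing \<open>\<nu> j\<close> by \<open>\<mu> l\<close> costs
    \<open>7 * \<delta>\<close>, hence the total error of \<open>8 * \<delta>\<close>.\<close>
  define Q where "Q = (\<lambda>l. \<Sum>j<n. \<kappa> j l o\<^sub>L q j)"
  have Q: "Q l x = (\<Sum>j<n. \<kappa> j l (q j x))" for l x by (simp add: Q_def blinfun.bilinear_simps)
  have qQ: "q j (Q l x) = \<kappa> j l (q j x)" if j: "j < n" for j l x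
  proof -
    have qM: "q j \<in> M" using projsD(1)[OF qp[OF j]] .
    have "q j (Q l x) = (\<Sum>i<n. \<kappa> i l (q j (q i x)))"
      unfolding Q blinfun.sum_right by (intro sum.cong refl) (simp add: \<kappa>c[OF _ qM])
    also have "\<dots> = \<kappa> j l (q j (q j x)) + (\<Sum>i\<in>{..<n} - {j}. \<kappa> i l (q j (q i x)))"
      using j by (intro sum.remove) auto
    also have "(\<Sum>i\<in>{..<n} - {j}. \<kappa> i l (q j (q i x))) = 0"
      using partitionD(2)[OF q j] by (intro sum.neutral) (auto simp: blinfun.bilinear_simps)
    finally show ?thesis by (simp add: projsD(3)[OF qp[OF j]])
  qed
  have QQ: "Q i (Q l x) = (if i = l then Q l x else 0)" for i l x
  proof -
    have "Q i (Q l x) = (\<Sum>j<n. \<kappa> j i (\<kappa> j l (q j x)))"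
      unfolding Q[of i] by (intro sum.cong refl) (simp add: qQ)
    moreover have "\<kappa> j l (\<kappa> j l y) = \<kappa> j l y" if "j < n" for j y
      using projsD(3)[OF central_projsD(1)[OF \<kappa>(1)[OF that]]] .
    ultimately show ?thesis using \<kappa>(2) by (auto simp: Q intro!: sum.cong sum.neutral)
  qed
  have Qproj: "Q l \<in> projs" for l
  proof -
    have t: "\<kappa> j l o\<^sub>L q j \<in> projs" if "j < n" for j using central_comp_projs[OF \<kappa>(1)[OF that] qp[OF that]] .
    have "Q l \<in> M" unfolding Q_def using t by (auto intro: sum_mem projsD(1))
    moreover have "radj (Q l) = Q l"
      unfolding Q_def radj_sum using projsD(5)[OF t] by (intro sum.cong refl) (simp del: radj_compose)
    ultimately show ?thesis by (simp add: projs_def orth_proj_iff blinfun_eq_iff QQ)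
  qed
  have Q_part: "partition m Q"
    unfolding partition_def
  proof (intro conjI allI impI)
    show "(\<Sum>l<m. Q l x) = x" for x
    proof -
      have "(\<Sum>l<m. Q l x) = (\<Sum>j<n. \<Sum>l<m. \<kappa> j l (q j x))" unfolding Q by (rule sum.swap)
      also have "\<dots> = (\<Sum>j<n. q j x)" by (intro sum.cong refl) (simp add: \<kappa>(3))
      finally show ?thesis by (simp only: partitionD(3)[OF q])
    qed
  qed (simp_all add: Qproj QQ)
  have Q_supp: "central_support (p l) (Q l x) = Q l x" if "l < m" for l x
    using \<kappa>(4) that by (simp add: Q blinfun.bilinear_simps)
  have Q_comm: "commutes (Q l) k" if "l < m" for l
  proof -
    have "\<kappa> j l (q j (k x)) = k (\<kappa> j l (q j x))" if "j < n" for j x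
      using qk[OF that] \<kappa>c[OF that k(1)] by (simp add: commutes_def)
    then show ?thesis by (simp add: commutes_def Q blinfun.bilinear_simps)
  qed
  have Q_norm: "norm ((k - scalar_op (\<mu> l)) (Q l x)) \<le> 8 * \<delta> * norm (Q l x)" if l: "l < m" for l x
  proof (rule partition_norm_le[OF q])
    show "commutes (q j) (k - scalar_op (\<mu> l))" if "j < n" for j
      using qk[OF that] scalar_commutes[OF projsD(1)[OF qp[OF that]]] by (simp add: commutes_def blinfun.bilinear_simps)
    show "norm ((k - scalar_op (\<mu> l)) (q j (Q l x))) \<le> 8 * \<delta> * norm (q j (Q l x))" if j: "j < n" for j
    proof (cases "near j l")
      case True
      define u where "u = q j (Q l x)"
      have "(k - scalar_op (\<mu> l)) u = (k - scalar_op (\<nu> j)) u - scalar_op (\<mu> l - \<nu> j) u"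
        by (simp only: scalar_op_diff) (simp add: blinfun.bilinear_simps)
      then have "norm ((k - scalar_op (\<mu> l)) u) \<le> norm ((k - scalar_op (\<nu> j)) u) + norm (scalar_op (\<mu> l - \<nu> j) u)"
        by (simp only: norm_triangle_ineq4)
      also have "norm ((k - scalar_op (\<nu> j)) u) \<le> \<delta> * norm u" unfolding u_def by (rule q\<mu>[OF j])
      also have "norm (scalar_op (\<mu> l - \<nu> j) u) \<le> 7 * \<delta> * norm u"
        using True by (simp add: norm_scaleC near_def mult_right_mono)
      finally show ?thesis by (simp add: u_def algebra_simps)
    next
      case False
      then show ?thesis using \<kappa>(5)[OF j l] by (simp add: qQ[OF j] blinfun.bilinear_simps)
    qed
  qed (use \<delta> in simp)
  show ?thesis
    by (rule exI[of _ m], rule exI[of _ p], rule exI[of _ Q], rule exI[of _ \<mu>], intro conjI allI impI)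
      (rule p Q_part | erule Q_supp ph p\<mu> Q_comm Q_norm)+
qed

lemma partition_approx:
  assumes q: "partition n q" and comm: "\<And>l. l < n \<Longrightarrow> commutes (q l) T" and c: "c \<ge> 0"
    and le: "\<And>l x. l < n \<Longrightarrow> norm ((T - scalar_op (\<mu> l)) (q l x)) \<le> c * norm (q l x)"
  shows "norm (T x - (\<Sum>l<n. scaleC (\<mu> l) (q l x))) \<le> c * norm x"
proof -
  note qp = partitionD(1)[OF q]
  define S where "S = T - (\<Sum>l<n. scalar_op (\<mu> l) o\<^sub>L q l)"
  have S: "S x = T x - (\<Sum>l<n. scaleC (\<mu> l) (q l x))" for x by (simp add: S_def blinfun.bilinear_simps)
  have single: "(\<Sum>l<n. scaleC (\<mu> l) (q l (q j x))) = scaleC (\<mu> j) (q j x)" if j: "j < n" for j x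
  proof -
    have "(\<Sum>l<n. scaleC (\<mu> l) (q l (q j x))) = scaleC (\<mu> j) (q j (q j x)) + (\<Sum>l\<in>{..<n} - {j}. scaleC (\<mu> l) (q l (q j x)))"
      using j by (intro sum.remove) auto
    also have "(\<Sum>l\<in>{..<n} - {j}. scaleC (\<mu> l) (q l (q j x))) = 0"
      using partitionD(2)[OF q _ j] by (intro sum.neutral) (auto simp flip: scalar_op_apply simp add: blinfun.bilinear_simps)
    finally show ?thesis by (simp add: projsD(3)[OF qp[OF j]])
  qed
  have "norm (S x) \<le> c * norm x"
  proof (rule partition_norm_le[OF q _ c])
    fix j assume j: "j < n"
    have "q j (\<Sum>l<n. scaleC (\<mu> l) (q l x)) = scaleC (\<mu> j) (q j x)" for x
    proof -
      have "q j (\<Sum>l<n. scaleC (\<mu> l) (q l x)) = (\<Sum>l<n. scaleC (\<mu> l) (q j (q l x)))"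
        by (simp add: blinfun.bilinear_simps scalar_commutes[OF projsD(1)[OF qp[OF j]]])
      also have "\<dots> = (\<Sum>l<n. scaleC (\<mu> l) (q l (q j x)))"
        using partitionD(2)[OF q] j by (intro sum.cong refl) (metis lessThan_iff)
      finally show ?thesis by (simp only: single[OF j])
    qed
    then show "commutes (q j) S"
      using comm[OF j] single[OF j] by (simp add: commutes_def S blinfun.bilinear_simps)
    show "norm (S (q j x)) \<le> c * norm (q j x)"
      using le[OF j, of x] by (simp add: S single[OF j] blinfun.bilinear_simps)
  qed
  then show ?thesis by (simp add: S)
qed

lemma type_III_algebra:
  assumes "type_III M"
  shows "type_III_algebra (commutant M \<union> range scalar_op) M"
proof
  fix p assume p: "p \<in> projs" "p \<noteq> 0"
  then have "\<not> finite_projection M p" using assms by (auto simp: type_III_def)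
  with p(1) obtain q where q: "p o\<^sub>L q = q" "q \<noteq> p" "mvn_equivalent M p q"
    unfolding finite_projection_def projections_eq by blast
  from q(3) obtain v where "v \<in> M" "adj v o\<^sub>L v = p" "v o\<^sub>L adj v = q"
    unfolding mvn_equivalent_def by blast
  with q(1,2) show "\<exists>v\<in>M. radj v o\<^sub>L v = p \<and> p o\<^sub>L (v o\<^sub>L radj v) = v o\<^sub>L radj v \<and> v o\<^sub>L radj v \<noteq> p"
    using adj_mem by (intro bexI[of _ v]) auto
qed

end

text \<open>The strong operator topology is pulled back from the product topology, whose basic open
  sets restrict finitely many coordinates; one \<open>\<epsilon>\<close> below the finitely many
  radii serves them all.\<close>

lemma strong_closure_iff:
  fixes k :: "'a::real_normed_vector operator"
  shows "k \<in> strong_operator_topology closure_of S \<longleftrightarrow>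
    (\<forall>X \<epsilon>. finite X \<longrightarrow> \<epsilon> > 0 \<longrightarrow> (\<exists>s\<in>S. \<forall>x\<in>X. norm (s x - k x) < \<epsilon>))"
proof
  assume k: "k \<in> strong_operator_topology closure_of S"
  show "\<forall>X \<epsilon>. finite X \<longrightarrow> \<epsilon> > 0 \<longrightarrow> (\<exists>s\<in>S. \<forall>x\<in>X. norm (s x - k x) < \<epsilon>)"
  proof (intro allI impI)
    fix X :: "'a set" and \<epsilon> :: real assume X: "finite X" and \<epsilon>: "\<epsilon> > 0"
    define U where "U = {f :: 'a operator. \<forall>x\<in>X. f x \<in> ball (k x) \<epsilon>}"
    have "openin strong_operator_topology U"
      unfolding U_def using X by (rule strong_operator_topology_basis[where x = "\<lambda>x. x"]) simp
    moreover have "k \<in> U" using \<epsilon> by (simp add: U_def)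
    ultimately have "\<exists>s. s \<in> S \<and> s \<in> U"
      using k[unfolded in_closure_of, THEN conjunct2, THEN spec, of U] by simp
    then obtain s where "s \<in> S" "\<forall>x\<in>X. s x \<in> ball (k x) \<epsilon>" by (auto simp: U_def)
    then show "\<exists>s\<in>S. \<forall>x\<in>X. norm (s x - k x) < \<epsilon>"
      by (intro bexI[of _ s]) (simp_all add: dist_norm norm_minus_commute)
  qed
next
  assume approx: "\<forall>X \<epsilon>. finite X \<longrightarrow> \<epsilon> > 0 \<longrightarrow> (\<exists>s\<in>S. \<forall>x\<in>X. norm (s x - k x) < \<epsilon>)"
  have "\<exists>s\<in>S. s \<in> T" if k: "k \<in> T" and T: "openin strong_operator_topology T" for T
  proof -
    obtain U :: "('a \<Rightarrow> 'a) set" where U: "open U" "T = blinfun_apply -` U"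
      using T unfolding strong_operator_topology_def openin_pullback_topology by auto
    have "blinfun_apply k \<in> U" using k U(2) by simp
    then obtain X where X: "blinfun_apply k \<in> (\<Pi>\<^sub>E i\<in>UNIV. X i)" "\<And>i. open (X i)" "finite {i. X i \<noteq> UNIV}"
      "(\<Pi>\<^sub>E i\<in>UNIV. X i) \<subseteq> U"
      using product_topology_open_contains_basis[of "\<lambda>_. euclidean" UNIV U "blinfun_apply k"] U(1)
      unfolding open_fun_def by auto
    have "\<exists>e>0. ball (k i) e \<subseteq> X i" for i
      using X(2)[of i] PiE_mem[OF X(1), of i] by (simp add: open_contains_ball)
    then have "\<forall>i. \<exists>e>0. ball (k i) e \<subseteq> X i" by blast
    from choice[OF this] obtain e where e: "\<And>i. e i > 0" "\<And>i. ball (k i) (e i) \<subseteq> X i" by blast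
    \<comment> \<open>The inserted 1 keeps the minimum defined when no coordinate is
      restricted.\<close>
    define \<epsilon> where "\<epsilon> = Min (insert 1 (e ` {i. X i \<noteq> UNIV}))"
    have "\<epsilon> > 0" unfolding \<epsilon>_def using X(3) e(1) by (subst Min_gr_iff) auto
    from approx[rule_format, OF X(3) this] obtain s
      where s: "s \<in> S" "\<And>i. X i \<noteq> UNIV \<Longrightarrow> norm (s i - k i) < \<epsilon>" by blast
    have "s i \<in> X i" for i
    proof (cases "X i = UNIV")
      case False
      then have "\<epsilon> \<le> e i" unfolding \<epsilon>_def using X(3) by (intro Min_le) auto
      then have "s i \<in> ball (k i) (e i)" using s(2)[OF False] by (simp add: dist_norm norm_minus_commute)
      then show ?thesis using e(2) by blast
    qed simp
    then have "blinfun_apply s \<in> U" using X(4) by auto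
    then show ?thesis using s(1) U(2) by auto
  qed
  then show "k \<in> strong_operator_topology closure_of S"
    by (auto simp: in_closure_of strong_operator_topology_topspace)
qed

theorem theorem6p8:
  fixes M :: "'a::complex_hilbert_space operator set"
    and h k :: "'a operator"
  assumes "von_neumann_algebra M" and "type_III M"
    and "h \<in> M" and "normal_operator h"
    and "k \<in> M" and "normal_operator k"
  shows "k \<in> strong_operator_topology closure_of (unitary_orbit M h) \<longleftrightarrow>
    essential_central_spectrum M k \<subseteq> essential_central_spectrum M h"
proof -
  interpret complex_vn_algebra M using assms(1) by unfold_locales
  interpret III: type_III_algebra "commutant M \<union> range scalar_op" M using assms(2) by (rule type_III_algebra)
  note h = assms(3,4) and k = assms(5,6) and specI = essential_central_spectrum_iff[OF assms(2)]
  have unitary_norm: "norm (u x) = norm x" if "radj u o\<^sub>L u = id_blinfun" for u :: "'a operator" and x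
  proof -
    have "(norm (u x))\<^sup>2 = inner ((radj u o\<^sub>L u) x) x" by (simp add: norm_radj_apply_square)
    then show ?thesis by (simp add: that power2_norm_eq_inner[symmetric])
  qed
  show ?thesis
  proof
    assume clos: "k \<in> strong_operator_topology closure_of (unitary_orbit M h)"
    show "essential_central_spectrum M k \<subseteq> essential_central_spectrum M h"
    proof
      fix z assume z: "z \<in> essential_central_spectrum M k"
      then have zc: "z \<in> center M" by (simp add: specI[OF k])
      have "\<exists>x. x \<noteq> 0 \<and> f x = x \<and> norm ((h - z) x) \<le> \<delta> * norm x"
        if f: "f \<in> central_projs" "f \<noteq> 0" and \<delta>: "\<delta> > 0" for f :: "'a operator" and \<delta>
      proof -
        have "\<delta> / 2 > 0" using \<delta> by simp
        then obtain x where x: "x \<noteq> 0" "f x = x" "norm ((k - z) x) \<le> \<delta> / 2 * norm x"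
          using z[unfolded specI[OF k]] f by blast
        have "\<delta> / 2 * norm x > 0" using x(1) \<delta> by simp
        then obtain s where s: "s \<in> unitary_orbit M h" "norm (s x - k x) < \<delta> / 2 * norm x"
          using clos[unfolded strong_closure_iff, rule_format, of "{x}" "\<delta> / 2 * norm x"] by auto
        from s(1) obtain u where u: "u \<in> M" "radj u o\<^sub>L u = id_blinfun" "u o\<^sub>L radj u = id_blinfun" "s = u o\<^sub>L h o\<^sub>L radj u"
          using adj_mem by (auto simp: unitary_orbit_def unitaries_def)
        \<comment> \<open>The test vector of \<open>k - z\<close> is moved back by the unitary. Both
          \<open>f\<close> and \<open>z\<close> commute with \<open>u\<close>, so \<open>y\<close>
          stays in \<open>f\<close> and tests \<open>h - z\<close>.\<close>
        define y where "y = radj u x"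
        have uy: "u y = x" using u(3) by (metis blinfun_apply_blinfun_compose id_blinfun.rep_eq id_apply y_def)
        have ny: "norm y = norm x" using unitary_norm[OF u(2), of y] uy by simp
        have "f y = y" using central_projsD(2)[OF f(1) radj_mem[OF u(1)], of x] x(2) by (simp add: y_def)
        moreover have "norm ((h - z) y) \<le> \<delta> * norm y"
        proof -
          have "u ((h - z) y) = (s x - k x) + (k - z) x"
            using center_commutes[OF zc u(1), of y] uy by (simp add: blinfun.bilinear_simps u(4) y_def)
          then have "norm (u ((h - z) y)) \<le> norm (s x - k x) + norm ((k - z) x)"
            by (simp only: norm_triangle_ineq)
          then show ?thesis using s(2) x(3) by (simp add: unitary_norm[OF u(2)] ny)
        qed
        moreover have "y \<noteq> 0" using ny x(1) by auto
        ultimately show ?thesis by blast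
      qed
      then show "z \<in> essential_central_spectrum M h" using zc by (simp add: specI[OF h])
    qed
  next
    assume sub: "essential_central_spectrum M k \<subseteq> essential_central_spectrum M h"
    show "k \<in> strong_operator_topology closure_of (unitary_orbit M h)"
      unfolding strong_closure_iff
    proof (intro allI impI)
      fix X :: "'a set" and \<epsilon> :: real assume X: "finite X" and \<epsilon>: "\<epsilon> > 0"
      define b where "b = (\<Sum>x\<in>X. norm x) + 1"
      have b1: "b \<ge> 1" by (simp add: b_def sum_nonneg)
      have xb: "norm x \<le> b" if "x \<in> X" for x
        using member_le_sum[OF that, of norm] X by (simp add: b_def)
      \<comment> \<open>\<open>18 = 2 * (1 + 8)\<close>: the errors \<open>\<delta>\<close> for
        \<open>h\<close> and \<open>8 * \<delta>\<close> for \<open>k\<close> then add up to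
        \<open>\<epsilon> / 2\<close> on vectors of norm at most \<open>b\<close>.\<close>
      define \<delta> where "\<delta> = \<epsilon> / (18 * b)"
      have \<delta>: "\<delta> > 0" using \<epsilon> b1 by (simp add: \<delta>_def)
      from matched_partitions[OF assms(2) h k sub \<delta>] obtain m p Q \<mu> where p: "partition m p" and Q: "partition m Q"
        and *: "\<forall>l<m. \<forall>x. central_support (p l) (Q l x) = Q l x"
        "\<forall>l<m. commutes (p l) h \<and> (\<forall>x. norm ((h - scalar_op (\<mu> l)) (p l x)) \<le> \<delta> * norm (p l x))"
        "\<forall>l<m. commutes (Q l) k \<and> (\<forall>x. norm ((k - scalar_op (\<mu> l)) (Q l x)) \<le> 8 * \<delta> * norm (Q l x))"
        by (elim exE conjE)
      have hp: "norm (h x - (\<Sum>l<m. scaleC (\<mu> l) (p l x))) \<le> \<delta> * norm x" for x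
        using *(2) \<delta> by (intro partition_approx[OF p]) auto
      have kQ: "norm (k x - (\<Sum>l<m. scaleC (\<mu> l) (Q l x))) \<le> 8 * \<delta> * norm x" for x
        using *(3) \<delta> by (intro partition_approx[OF Q]) auto
      define t where "t = (\<Sum>l<m. cmod (\<mu> l)) + 1"
      have t: "t \<ge> 1" by (simp add: t_def sum_nonneg)
      \<comment> \<open>The intertwining errors are multiplied by the values \<open>\<mu> l\<close>,
        whose moduli sum to less than \<open>t\<close>; they use the other half of
        \<open>\<epsilon>\<close>.\<close>
      define \<eta> where "\<eta> = \<epsilon> / (2 * t)"
      have \<eta>: "\<eta> > 0" using \<epsilon> t by (simp add: \<eta>_def)
      have "\<exists>u\<in>M. radj u o\<^sub>L u = id_blinfun \<and> u o\<^sub>L radj u = id_blinfun \<and>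
        (\<forall>x\<in>X. \<forall>l<m. norm (u (Q l x) - p l (u x)) < \<eta>)"
        using partitionD[OF p] partitionD[OF Q] *(1) X \<eta> by (intro III.unitary_intertwiner) auto
      then obtain u where u: "u \<in> M" "radj u o\<^sub>L u = id_blinfun" "u o\<^sub>L radj u = id_blinfun"
        and uQ: "\<And>x l. x \<in> X \<Longrightarrow> l < m \<Longrightarrow> norm (u (Q l x) - p l (u x)) < \<eta>" by blast
      \<comment> \<open>\<open>u\<close> carries the pieces of \<open>k\<close> approximately into
        those of \<open>h\<close>, so \<open>u k\<close> is close to \<open>h u\<close>, and the
        orbit point is formed with the unitary \<open>radj u\<close>.\<close>
      define s where "s = (radj u o\<^sub>L h) o\<^sub>L u"
      have uM: "adj (radj u) = u" using adj_mem[OF radj_mem[OF u(1)]] by simp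
      have "radj u \<in> unitaries M" using u by (simp add: unitaries_def uM radj_mem)
      then have "s \<in> unitary_orbit M h" unfolding unitary_orbit_def s_def using uM by force
      moreover have "norm (s x - k x) < \<epsilon>" if x: "x \<in> X" for x
      proof -
        have un: "norm (u y) = norm y" for y using unitary_norm[OF u(2)] .
        have uu: "u (radj u y) = y" for y
          using u(3) by (metis blinfun_apply_blinfun_compose id_blinfun.rep_eq id_apply)
        define w where "w = (\<Sum>l<m. scaleC (\<mu> l) (Q l x))"
        define w' where "w' = (\<Sum>l<m. scaleC (\<mu> l) (p l (u x)))"
        have "norm (s x - k x) = norm (u (s x - k x))" by (simp only: un)
        also have "u (s x - k x) = (h (u x) - w') - (u (k x - w)) - (u w - w')"
          by (simp add: s_def blinfun.bilinear_simps uu)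
        also have "norm \<dots> \<le> norm (h (u x) - w') + norm (u (k x - w)) + norm (u w - w')"
          using norm_triangle_ineq4[of "(h (u x) - w') - (u (k x - w))" "u w - w'"]
            norm_triangle_ineq4[of "h (u x) - w'" "u (k x - w)"] by linarith
        also have "norm (h (u x) - w') \<le> \<delta> * b"
        proof -
          have "norm (h (u x) - w') \<le> \<delta> * norm (u x)" unfolding w'_def by (rule hp)
          also have "\<dots> \<le> \<delta> * b" using \<delta> xb[OF x] by (simp add: un)
          finally show ?thesis .
        qed
        also have "norm (u (k x - w)) \<le> 8 * \<delta> * b"
        proof -
          have "norm (u (k x - w)) \<le> 8 * \<delta> * norm x" unfolding un w_def by (rule kQ)
          also have "\<dots> \<le> 8 * \<delta> * b" using \<delta> xb[OF x] by simp
          finally show ?thesis .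
        qed
        also have "norm (u w - w') \<le> (\<Sum>l<m. cmod (\<mu> l)) * \<eta>"
        proof -
          have "u w - w' = (\<Sum>l<m. scaleC (\<mu> l) (u (Q l x) - p l (u x)))"
            by (simp add: w_def w'_def blinfun.bilinear_simps scalar_commutes[OF u(1)] flip: sum_subtractf)
              (simp flip: scalar_op_apply add: blinfun.bilinear_simps)
          also have "norm \<dots> \<le> (\<Sum>l<m. norm (scaleC (\<mu> l) (u (Q l x) - p l (u x))))" by (rule norm_sum)
          also have "\<dots> \<le> (\<Sum>l<m. cmod (\<mu> l) * \<eta>)"
            using less_imp_le[OF uQ[OF x]] by (intro sum_mono) (simp add: norm_scaleC mult_left_mono)
          finally show ?thesis by (simp add: sum_distrib_right)
        qed
        also have "(\<Sum>l<m. cmod (\<mu> l)) * \<eta> < t * \<eta>" using \<eta> by (simp add: t_def)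
        also have "t * \<eta> = \<epsilon> / 2" using t by (simp add: \<eta>_def)
        finally have "norm (s x - k x) < \<delta> * b + 8 * \<delta> * b + \<epsilon> / 2" by simp
        also have "\<delta> * b + 8 * \<delta> * b = \<epsilon> / 2" using b1 by (simp add: \<delta>_def)
        finally show ?thesis by simp
      qed
      ultimately show "\<exists>s\<in>unitary_orbit M h. \<forall>x\<in>X. norm (s x - k x) < \<epsilon>" by blast
    qed
  qed
qed

end
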